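(* Let $D$ be a multidigraph such that the undirected graph $D'$ associated with $D$ is triangle free and series parallel. Then for any collection of chordal graphs $C_e$ ($e\in E(D)$) such that $D/\{C_e\}$ is a thickening of $D$, \[\epsilon(D / \{C_e\}) = \epsilon(\mathcal{O}_g),\] where $g$ is the chordal girth of $D / \{C_e\}$ and $\mathcal{O}_g$ is the cycle with $g$ vertices.
   Context: All graphs are finite, undirected, without multiple edges, and by convention every loop $\{i,i\}$ is an edge (loops are ignored when speaking of cycles, paths, triangles, contractions and chordality). A graph is chordal if it has no induced cycle with at least 4 vertices. The chordal girth of a graph is the number of vertices of its smallest induced cycle with at least 4 vertices, and $\infty$ if the graph is chordal. A clique is a set of pairwise adjacent vertices (singletons included); a triangle is a clique of size 3, and a graph is triangle free if it contains no triangles. A graph is series parallel if no sequence of edge contractions of it results in the complete graph on 4 vertices. Additive distance. For a graph $G$, a $G$-partial matrix is a symmetric real array $X$ with entries $X_{ij}=X_{ji}$ specified exactly for $\{i,j\}\in E(G)$ (including all diagonal entries); the vector space of these is $\mathrm{Sym}(G)$. $\mathcal{S}(G)\subseteq \mathrm{Sym}(G)$ is the cone of PSD-completable partial matrices, i.e. those whose unspecified entries can be chosen to give a positive semidefinite (PSD) matrix. $\mathcal{P}(G)$ is the cone of $X\in\mathrm{Sym}(G)$ such that for every clique $C$ of $G$ the fully specified submatrix $X|_C$ is PSD. Let $\mathrm{tr}(X)=\sum_i X_{ii}$, $\tilde{\mathcal{P}}(G)=\{X\in\mathcal{P}(G):\mathrm{tr}(X)=1\}$, and let $I_G$ be the projection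 of the identity matrix to $\mathrm{Sym}(G)$. Define $\epsilon_G(X)=\min\{\epsilon : X+\epsilon I_G\in\mathcal{S}(G)\}$ and $\epsilon(G)=\max\{\epsilon_G(X):X\in\tilde{\mathcal{P}}(G)\}$. Thickenings. A multidigraph $D$ consists of a set of vertices $V(D)$, a set of edges $E(D)$ and maps $t,h:E(D)\to V(D)$ (tail and head) with $t(e)\ne h(e)$ for all $e$; parallel edges are allowed. The undirected graph $D'$ associated with $D$ has vertex set $V(D)$ and edges $\{t(e),h(e)\}$ for $e\in E(D)$. Given for each $e\in E(D)$ a connected chordal graph $C_e$ with two distinguished vertices $T(e),H(e)\in V(C_e)$, the graph $D/\{C_e\}$ is obtained from the disjoint union of $V(D)$ and all the $C_e$ by identifying $T(e)$ with $t(e)$ and $H(e)$ with $h(e)$ for every $e\in E(D)$. It is called a thickening of $D$ if every triangle in $D/\{C_e\}$ is contained in $C_e$ for some $e\in E(D)$.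
   Formalization: Series parallel is required of each connected component of D' (the literal definition is vacuous for disconnected graphs, and K_{4,4} plus an isolated vertex is then a counterexample); D has at least 2 vertices; the undefined ε(O_∞) is read as 0. *)

theory Defs
  imports "Graph_Theory.Graph_Theory" "HOL-Library.Extended_Nat" Complex_Main
begin

text \<open>
  A finite simple undirected graph is a \<open>pair_graph\<close>: a finite vertex set with a symmetric
  irreflexive set of ordered pairs. The conventional loops at all vertices are not stored; they
  matter only for partial matrices, where they are put back by \<open>specified\<close>.
\<close>

section \<open>Cliques, induced cycles, chordality\<close>

definition clique :: "'a pair_pre_digraph \<Rightarrow> 'a set \<Rightarrow> bool" where
  "clique G S \<longleftrightarrow> S \<subseteq> pverts G \<and> (\<forall>i\<in>S. \<forall>j\<in>S. i \<noteq> j \<longrightarrow> (i, j) \<in> parcs G)"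

definition triangle :: "'a pair_pre_digraph \<Rightarrow> 'a set \<Rightarrow> bool" where
  "triangle G S \<longleftrightarrow> clique G S \<and> card S = 3"

definition triangle_free :: "'a pair_pre_digraph \<Rightarrow> bool" where
  "triangle_free G \<longleftrightarrow> (\<nexists>S. triangle G S)"

text \<open>The cycle with \<open>n\<close> vertices; it is only used for \<open>n \<ge> 4\<close>.\<close>

definition cycle_graph :: "nat \<Rightarrow> nat pair_pre_digraph" where
  "cycle_graph n = \<lparr> pverts = {..<n},
     parcs = {(i, j). i < n \<and> j < n \<and> (j = Suc i mod n \<or> i = Suc j mod n)} \<rparr>"

definition has_induced_cycle :: "'a pair_pre_digraph \<Rightarrow> nat \<Rightarrow> bool" where
  "has_induced_cycle G n \<longleftrightarrow>
     (\<exists>f. inj_on f {..<n} \<and> f ` {..<n} \<subseteq> pverts G \<and>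
        (\<forall>i<n. \<forall>j<n. (f i, f j) \<in> parcs G \<longleftrightarrow> (i, j) \<in> parcs (cycle_graph n)))"

definition chordal :: "'a pair_pre_digraph \<Rightarrow> bool" where
  "chordal G \<longleftrightarrow> (\<forall>n\<ge>4. \<not> has_induced_cycle G n)"

text \<open>The infimum of the empty set in \<^typ>\<open>enat\<close> is \<open>\<infinity>\<close>, which is the value for chordal graphs.\<close>

definition chordal_girth :: "'a pair_pre_digraph \<Rightarrow> enat" where
  "chordal_girth G = Inf {enat n | n. n \<ge> 4 \<and> has_induced_cycle G n}"

section \<open>Edge contractions and series parallel graphs\<close>

text \<open>Contraction of the edge \<open>{u, v}\<close>, with \<open>u\<close> as the name of the merged vertex; loops are
  dropped and parallel edges are merged.\<close>

definition contract_edge :: "'a \<Rightarrow> 'a \<Rightarrow> 'a pair_pre_digraph \<Rightarrow> 'a pair_pre_digraph" where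
  "contract_edge u v G = (let f = (\<lambda>x. if x = v then u else x) in
     \<lparr> pverts = f ` pverts G, parcs = {(f x, f y) | x y. (x, y) \<in> parcs G \<and> f x \<noteq> f y} \<rparr>)"

inductive contracts_to :: "'a pair_pre_digraph \<Rightarrow> 'a pair_pre_digraph \<Rightarrow> bool" where
  refl: "contracts_to G G"
| step: "contracts_to G K \<Longrightarrow> (u, v) \<in> parcs K \<Longrightarrow> contracts_to G (contract_edge u v K)"

text \<open>
  Contractions alone never change the number of connected components, so excluding a contraction
  of the whole graph to $K_4$ would make every disconnected graph series parallel. As usual, a
  graph is series parallel if each of its connected components is. The strongly connected
  components of a symmetric digraph are the connected components of the undirected graph.
\<close>

definition series_parallel :: "'a pair_pre_digraph \<Rightarrow> bool" where
  "series_parallel G \<longleftrightarrow>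
     (\<forall>H. with_proj H \<in> pre_digraph.sccs (with_proj G) \<longrightarrow>
        (\<nexists>K. contracts_to H K \<and> complete_digraph 4 (with_proj K)))"

lemma series_parallel_connected:
  assumes "pair_graph G" "Digraph_Component.connected (with_proj G)"
  shows "series_parallel G \<longleftrightarrow> (\<nexists>K. contracts_to G K \<and> complete_digraph 4 (with_proj K))"
proof -
  interpret pair_graph G by fact
  have sc: "strongly_connected (with_proj G)"
  proof -
    have "(v, u) \<in> parcs G" if "(u, v) \<in> parcs G" for u v
    proof -
      have "sym (parcs G)" using pair_sym_arcs by (simp add: symmetric_def)
      then show ?thesis using that by (rule symD)
    qed
    then have "parcs (mk_symmetric (with_proj G)) = parcs G"
      by (fastforce simp: parcs_mk_symmetric)
    then have "mk_symmetric (with_proj G) = G" by simp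
    then show ?thesis using assms(2) by (simp add: Digraph_Component.connected_def)
  qed
  have refl: "induced_subgraph (with_proj G) (with_proj G)"
    by (rule induced_subgraph_refl)
  have "with_proj H \<in> pre_digraph.sccs (with_proj G) \<longleftrightarrow> H = G" for H
  proof
    assume H: "with_proj H \<in> pre_digraph.sccs (with_proj G)"
    then have ind: "induced_subgraph (with_proj H) (with_proj G)"
      and max: "\<not> (\<exists>H'. induced_subgraph H' (with_proj G) \<and> strongly_connected H' \<and>
        verts (with_proj H) \<subset> verts H')"
      by (auto simp: pre_digraph.sccs_def)
    have "pverts H \<subseteq> pverts G"
      using ind by (auto simp: induced_subgraph_def subgraph_def)
    moreover have "\<not> verts (with_proj H) \<subset> verts (with_proj G)"
      using max sc refl by blast
    ultimately have V: "pverts H = pverts G" by auto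
    have "parcs H = {e \<in> parcs G. fst e \<in> pverts H \<and> snd e \<in> pverts H}"
      using ind by (simp add: induced_subgraph_def)
    also have "\<dots> = parcs G"
      using V arc_fst_in_verts arc_snd_in_verts by blast
    finally show "H = G" using V by simp
  next
    assume HG: "H = G"
    have "\<not> verts (with_proj G) \<subset> verts H'"
      if "induced_subgraph H' (with_proj G)" for H' :: "('a, 'a \<times> 'a) pre_digraph"
      using that unfolding induced_subgraph_def subgraph_def by blast
    then show "with_proj H \<in> pre_digraph.sccs (with_proj G)"
      using sc refl unfolding pre_digraph.sccs_def HG by blast
  qed
  then show ?thesis by (simp add: series_parallel_def)
qed

section \<open>Partial matrices and additive distance\<close>

definition specified :: "'a pair_pre_digraph \<Rightarrow> 'a \<Rightarrow> 'a \<Rightarrow> bool" where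
  "specified G i j \<longleftrightarrow> i \<in> pverts G \<and> j \<in> pverts G \<and> (i = j \<or> (i, j) \<in> parcs G)"

text \<open>Unspecified entries of a partial matrix are represented by the dummy value \<open>0\<close>.\<close>

definition Sym_space :: "'a pair_pre_digraph \<Rightarrow> ('a \<Rightarrow> 'a \<Rightarrow> real) set" where
  "Sym_space G = {X. (\<forall>i j. X i j = X j i) \<and> (\<forall>i j. \<not> specified G i j \<longrightarrow> X i j = 0)}"

definition psd_on :: "'a set \<Rightarrow> ('a \<Rightarrow> 'a \<Rightarrow> real) \<Rightarrow> bool" where
  "psd_on S M \<longleftrightarrow> (\<forall>i\<in>S. \<forall>j\<in>S. M i j = M j i) \<and>
     (\<forall>v :: 'a \<Rightarrow> real. (\<Sum>i\<in>S. \<Sum>j\<in>S. v i * M i j * v j) \<ge> 0)"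

definition completable_cone :: "'a pair_pre_digraph \<Rightarrow> ('a \<Rightarrow> 'a \<Rightarrow> real) set" where
  "completable_cone G = {X \<in> Sym_space G.
     \<exists>M. psd_on (pverts G) M \<and> (\<forall>i j. specified G i j \<longrightarrow> M i j = X i j)}"

definition clique_psd_cone :: "'a pair_pre_digraph \<Rightarrow> ('a \<Rightarrow> 'a \<Rightarrow> real) set" where
  "clique_psd_cone G = {X \<in> Sym_space G. \<forall>S. clique G S \<longrightarrow> psd_on S X}"

definition partial_trace :: "'a pair_pre_digraph \<Rightarrow> ('a \<Rightarrow> 'a \<Rightarrow> real) \<Rightarrow> real" where
  "partial_trace G X = (\<Sum>i\<in>pverts G. X i i)"

definition clique_psd_slice :: "'a pair_pre_digraph \<Rightarrow> ('a \<Rightarrow> 'a \<Rightarrow> real) set" where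
  "clique_psd_slice G = {X \<in> clique_psd_cone G. partial_trace G X = 1}"

definition partial_id :: "'a pair_pre_digraph \<Rightarrow> 'a \<Rightarrow> 'a \<Rightarrow> real" where
  "partial_id G i j = (if i = j \<and> i \<in> pverts G then 1 else 0)"

text \<open>The minimum and the maximum below are attained for every graph with at least one vertex
  (closedness of the cones, compactness of the slice), so they are an infimum and a supremum.\<close>

definition additive_distance_at :: "'a pair_pre_digraph \<Rightarrow> ('a \<Rightarrow> 'a \<Rightarrow> real) \<Rightarrow> real" where
  "additive_distance_at G X =
     Inf {\<epsilon>. (\<lambda>i j. X i j + \<epsilon> * partial_id G i j) \<in> completable_cone G}"

definition additive_distance :: "'a pair_pre_digraph \<Rightarrow> real" where
  "additive_distance G = Sup (additive_distance_at G ` clique_psd_slice G)"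

text \<open>The additive distance of the cycle with \<open>g\<close> vertices. The value at \<open>\<infinity>\<close> is a
  convention: \<open>0\<close> is both the limit for large \<open>g\<close> and the additive distance of every chordal
  graph with at least two vertices.\<close>

definition cycle_additive_distance :: "enat \<Rightarrow> real" where
  "cycle_additive_distance g =
     (case g of enat n \<Rightarrow> additive_distance (cycle_graph n) | \<infinity> \<Rightarrow> 0)"

section \<open>Thickenings of multidigraphs\<close>

definition multidigraph :: "('v, 'e) pre_digraph \<Rightarrow> bool" where
  "multidigraph D \<longleftrightarrow> fin_digraph D \<and> loopfree_digraph D"

text \<open>
  The quotient of the disjoint union of the vertices of \<open>D\<close> and all the graphs \<open>C e\<close> is
  represented by canonical representatives: \<open>Inl v\<close> is the class of a vertex \<open>v\<close> of \<open>D\<close>, and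
  \<open>Inr (e, x)\<close> is the class of a vertex \<open>x\<close> of \<open>C e\<close> other than \<open>T e\<close> and \<open>H e\<close>.
  \<open>glue D T H e\<close> is the resulting map from the vertices of \<open>C e\<close> to the quotient.
\<close>

definition glue ::
  "('v, 'e) pre_digraph \<Rightarrow> ('e \<Rightarrow> 'c) \<Rightarrow> ('e \<Rightarrow> 'c) \<Rightarrow> 'e \<Rightarrow> 'c \<Rightarrow> 'v + 'e \<times> 'c" where
  "glue D T H e x = (if x = T e then Inl (tail D e)
     else if x = H e then Inl (head D e) else Inr (e, x))"

definition glued_graph ::
  "('v, 'e) pre_digraph \<Rightarrow> ('e \<Rightarrow> 'c pair_pre_digraph) \<Rightarrow> ('e \<Rightarrow> 'c) \<Rightarrow> ('e \<Rightarrow> 'c) \<Rightarrow>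
     ('v + 'e \<times> 'c) pair_pre_digraph" where
  "glued_graph D C T H =
     \<lparr> pverts = Inl ` verts D \<union> (\<Union>e\<in>arcs D. glue D T H e ` pverts (C e)),
       parcs = (\<Union>e\<in>arcs D. {(glue D T H e x, glue D T H e y) | x y. (x, y) \<in> parcs (C e)}) \<rparr>"

definition gluing_data ::
  "('v, 'e) pre_digraph \<Rightarrow> ('e \<Rightarrow> 'c pair_pre_digraph) \<Rightarrow> ('e \<Rightarrow> 'c) \<Rightarrow> ('e \<Rightarrow> 'c) \<Rightarrow> bool" where
  "gluing_data D C T H \<longleftrightarrow>
     (\<forall>e\<in>arcs D. pair_graph (C e) \<and> Digraph_Component.connected (with_proj (C e)) \<and>
        chordal (C e) \<and> T e \<in> pverts (C e) \<and> H e \<in> pverts (C e) \<and> T e \<noteq> H e)"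

text \<open>A triangle is contained in \<open>C e\<close> as a subgraph, that is, it is the image of a triangle of
  \<open>C e\<close>; it does not suffice that its vertices belong to \<open>C e\<close> while one of its edges comes from
  an arc parallel to \<open>e\<close>.\<close>

definition thickening ::
  "('v, 'e) pre_digraph \<Rightarrow> ('e \<Rightarrow> 'c pair_pre_digraph) \<Rightarrow> ('e \<Rightarrow> 'c) \<Rightarrow> ('e \<Rightarrow> 'c) \<Rightarrow> bool" where
  "thickening D C T H \<longleftrightarrow> gluing_data D C T H \<and>
     (\<forall>S. triangle (glued_graph D C T H) S \<longrightarrow>
        (\<exists>e\<in>arcs D. \<exists>S'. triangle (C e) S' \<and> S = glue D T H e ` S'))"

lemma pair_graph_glued_graph:
  assumes D: "multidigraph D" and C: "gluing_data D C T H"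
  shows "pair_graph (glued_graph D C T H)"
proof -
  have fD: "finite (verts D)" "finite (arcs D)"
    using D by (auto simp: multidigraph_def fin_digraph_def fin_digraph_axioms_def)
  have nl: "tail D e \<noteq> head D e" if "e \<in> arcs D" for e
    using D that by (auto simp: multidigraph_def loopfree_digraph.no_loops)
  have pg: "pair_graph (C e)" if "e \<in> arcs D" for e
    using C that by (auto simp: gluing_data_def)
  have fin: "finite (pverts (C e))" "finite (parcs (C e))" if "e \<in> arcs D" for e
    using pair_fin_digraph.pair_finite_verts pair_fin_digraph.pair_finite_arcs
      pair_digraph.axioms(1)[OF pair_graph.axioms(1)[OF pg[OF that]]] by auto
  have wf: "x \<in> pverts (C e)" "y \<in> pverts (C e)" "x \<noteq> y" "(y, x) \<in> parcs (C e)"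
    if "e \<in> arcs D" "(x, y) \<in> parcs (C e)" for e x y
  proof -
    interpret pair_graph "C e" using pg that(1) .
    show "x \<in> pverts (C e)" using that(2) by (rule in_arcsD1)
    show "y \<in> pverts (C e)" using that(2) by (rule in_arcsD2)
    show "x \<noteq> y" using pair_no_loops[OF that(2)] by simp
    show "(y, x) \<in> parcs (C e)"
    proof -
      have "sym (parcs (C e))" using pair_sym_arcs by (simp add: symmetric_def)
      then show ?thesis using that(2) by (rule symD)
    qed
  qed
  have inj: "x = y" if "e \<in> arcs D" "glue D T H e x = glue D T H e y" for e x y
    using that(2) nl[OF that(1)] nl[OF that(1), symmetric]
    by (auto simp: glue_def split: if_splits)
  have finE: "finite {(glue D T H e x, glue D T H e y) | x y. (x, y) \<in> parcs (C e)}"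
    if "e \<in> arcs D" for e
  proof -
    have "{(glue D T H e x, glue D T H e y) | x y. (x, y) \<in> parcs (C e)} =
        map_prod (glue D T H e) (glue D T H e) ` parcs (C e)" by force
    then show ?thesis using fin(2)[OF that] by simp
  qed
  show ?thesis
  proof unfold_locales
    show "finite (pverts (glued_graph D C T H))"
      using fD fin(1) by (simp add: glued_graph_def)
    show "finite (parcs (glued_graph D C T H))"
      using fD finE by (simp add: glued_graph_def)
    show "symmetric (with_proj (glued_graph D C T H))"
      using wf(4) by (fastforce simp: symmetric_def glued_graph_def intro!: symI)
  next
    fix p assume "p \<in> parcs (glued_graph D C T H)"
    then obtain e x y where e: "e \<in> arcs D" "(x, y) \<in> parcs (C e)"
      and p: "p = (glue D T H e x, glue D T H e y)"
      by (auto simp: glued_graph_def)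
    show "fst p \<in> pverts (glued_graph D C T H)" "snd p \<in> pverts (glued_graph D C T H)"
      using e p wf(1,2)[OF e] by (auto simp: glued_graph_def)
    show "fst p \<noteq> snd p"
      using p wf(3)[OF e] inj[OF e(1)] by auto
  qed
qed

end

theory Submission
  imports Defs "HOL-Analysis.Convex"
begin

text \<open>
  Let \<epsilon> be (slightly above) the additive distance of the shortest induced cycle. The lower bound extends
  a partial matrix on that cycle by zero. For the upper bound it suffices that \<open>X + \<epsilon> tr(X) I\<close> is
  completable whenever \<open>X\<close> is positive semidefinite on cliques.

  For an arc \<open>e\<close> of \<open>D\<close>, the possible entries at the two terminals of \<open>C e\<close> in completions of the
  shifted matrix on \<open>C e\<close> form an interval. Choosing one number from each of these intervals so that the
  resulting partial matrix on \<open>D\<close> is completable, everything is glued along the terminals. By Helly's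
  theorem on the line, such a choice exists as soon as it exists along every cycle of \<open>D\<close>: a connected
  graph without \<open>K4\<close> minor has a vertex of degree at most 2, which is contracted into a neighbour.

  Along one cycle of \<open>D\<close>, the matrices on the chordal blocks can be completed and, by convexity, be assumed
  to be of rank one, with the diagonal at the terminals fixed. Collapsing the vertices of each block
  according to their distance from one terminal turns the data into a partial matrix on a cycle whose
  length is that of a closed chain of shortest paths in the glued graph. This length is at least the
  chordal girth, and longer cycles are easier to complete: a chord splits off a triangle.
\<close>

section \<open>Positive semidefinite matrices\<close>

text \<open>The obstacle is that the shift is a fixed multiple of the trace of the whole graph,
  while a vertex of \<open>D\<close> may be shared by many blocks. Completions of different blocks
  can be combined only if they agree on the diagonal at the terminals. This dictates the reduction
  to rank one: a block matrix is split into rank one matrices with unchanged diagonal at the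
  terminals and a remainder that vanishes there. It also dictates the collapse: an inner layer is
  replaced by its Euclidean norm, so the trace does not grow, and on a closed chain of blocks each
  terminal is counted in one block only. Parallel arcs of \<open>D\<close> enter twice: as cycles of
  length 2, which make their intervals meet pairwise, and as several intervals on one edge of the
  simple graph. Working strictly above the additive distance avoids proving that the minimum is
  attained; letting the slack tend to 0 at the end recovers equality.\<close>

definition bform :: "'a set \<Rightarrow> ('a \<Rightarrow> 'a \<Rightarrow> real) \<Rightarrow> ('a \<Rightarrow> real) \<Rightarrow> ('a \<Rightarrow> real) \<Rightarrow> real" where
  "bform S M v w = (\<Sum>i\<in>S. \<Sum>j\<in>S. v i * M i j * w j)"

lemma psd_onI:
  assumes "\<And>i j. i \<in> S \<Longrightarrow> j \<in> S \<Longrightarrow> M i j = M j i" "\<And>v. bform S M v v \<ge> 0"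
  shows "psd_on S M"
  using assms by (simp add: psd_on_def bform_def)

lemma psd_on_sym: "psd_on S M \<Longrightarrow> i \<in> S \<Longrightarrow> j \<in> S \<Longrightarrow> M i j = M j i"
  by (simp add: psd_on_def)

lemma psd_on_bform: "psd_on S M \<Longrightarrow> bform S M v v \<ge> 0"
  by (simp add: psd_on_def bform_def)

lemma bform_cong:
  assumes "\<And>i j. i \<in> S \<Longrightarrow> j \<in> S \<Longrightarrow> M i j = N i j"
  shows "bform S M v w = bform S N v w"
  unfolding bform_def using assms by (intro sum.cong HOL.refl) auto

lemma psd_on_cong:
  assumes "\<And>i j. i \<in> S \<Longrightarrow> j \<in> S \<Longrightarrow> M i j = N i j" "psd_on S M"
  shows "psd_on S N"
proof (rule psd_onI)
  show "N i j = N j i" if "i \<in> S" "j \<in> S" for i j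
    using assms that psd_on_sym[OF assms(2)] by metis
  show "bform S N v v \<ge> 0" for v
    using psd_on_bform[OF assms(2)] bform_cong[OF assms(1), of S] by auto
qed

lemma bform_mono_neutral:
  assumes "finite S" "U \<subseteq> S" "\<And>i. i \<in> S - U \<Longrightarrow> v i = 0" "\<And>i. i \<in> S - U \<Longrightarrow> w i = 0"
  shows "bform S M v w = bform U M v w"
proof -
  have "bform S M v w = (\<Sum>i\<in>U. \<Sum>j\<in>S. v i * M i j * w j)"
    unfolding bform_def using assms by (intro sum.mono_neutral_right) auto
  also have "\<dots> = bform U M v w"
    unfolding bform_def using assms by (intro sum.cong HOL.refl sum.mono_neutral_right) auto
  finally show ?thesis .
qed

lemma psd_on_subset:
  assumes "finite S" "U \<subseteq> S" "psd_on S M"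
  shows "psd_on U M"
proof (rule psd_onI)
  show "M i j = M j i" if "i \<in> U" "j \<in> U" for i j
    using psd_on_sym[OF assms(3)] that assms(2) by auto
  show "bform U M v v \<ge> 0" for v
  proof -
    let ?v = "\<lambda>i. if i \<in> U then v i else 0"
    have "bform S M ?v ?v = bform U M ?v ?v"
      by (rule bform_mono_neutral) (use assms in auto)
    also have "\<dots> = bform U M v v"
      unfolding bform_def by (intro sum.cong HOL.refl) auto
    finally show ?thesis using psd_on_bform[OF assms(3)] by metis
  qed
qed

lemma bform_add: "bform S (\<lambda>i j. M i j + N i j) v w = bform S M v w + bform S N v w"
  by (simp add: bform_def algebra_simps sum.distrib)

lemma bform_scale: "bform S (\<lambda>i j. c * M i j) v w = c * bform S M v w"
  by (simp add: bform_def sum_distrib_left mult_ac)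

lemma psd_on_add: "psd_on S M \<Longrightarrow> psd_on S N \<Longrightarrow> psd_on S (\<lambda>i j. M i j + N i j)"
  by (rule psd_onI) (auto simp: psd_on_sym bform_add psd_on_bform intro!: add_nonneg_nonneg)

lemma psd_on_scale: "psd_on S M \<Longrightarrow> c \<ge> 0 \<Longrightarrow> psd_on S (\<lambda>i j. c * M i j)"
  by (rule psd_onI) (auto simp: psd_on_sym bform_scale psd_on_bform)

lemma psd_on_rank1: "psd_on S (\<lambda>i j. y i * y j)"
proof (rule psd_onI)
  show "bform S (\<lambda>i j. y i * y j) v v \<ge> 0" for v
  proof -
    have "bform S (\<lambda>i j. y i * y j) v v = (\<Sum>i\<in>S. v i * y i) * (\<Sum>j\<in>S. v j * y j)"
      by (simp add: bform_def sum_product mult_ac)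
    then show ?thesis by simp
  qed
qed auto

lemma psd_on_zero: "psd_on S (\<lambda>i j. 0)"
  using psd_on_rank1[of S "\<lambda>_. 0"] by simp

lemma bform_diag:
  assumes "finite S"
  shows "bform S (\<lambda>i j. if i = j then d i else 0) v w = (\<Sum>i\<in>S. v i * d i * w i)"
  unfolding bform_def
proof (intro sum.cong HOL.refl)
  fix i assume "i \<in> S"
  have "(\<Sum>j\<in>S. v i * (if i = j then d i else 0) * w j) = (\<Sum>j\<in>S. if i = j then v i * d i * w j else 0)"
    by (intro sum.cong) auto
  then show "(\<Sum>j\<in>S. v i * (if i = j then d i else 0) * w j) = v i * d i * w i"
    using assms \<open>i \<in> S\<close> by simp
qed

lemma psd_on_diag:
  assumes "finite S" "\<And>i. i \<in> S \<Longrightarrow> d i \<ge> 0"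
  shows "psd_on S (\<lambda>i j. if i = j then d i else 0)"
proof (rule psd_onI)
  show "bform S (\<lambda>i j. if i = j then d i else 0) v v \<ge> 0" for v
  proof -
    have "(\<Sum>i\<in>S. v i * d i * v i) = (\<Sum>i\<in>S. d i * (v i)\<^sup>2)"
      by (simp add: power2_eq_square mult_ac)
    also have "\<dots> \<ge> 0" using assms(2) by (auto intro!: sum_nonneg)
    finally show ?thesis unfolding bform_diag[OF assms(1)] .
  qed
qed auto

lemma psd_on_add_diag:
  assumes "finite S" "psd_on S M" "\<And>i. i \<in> S \<Longrightarrow> d i \<ge> 0"
  shows "psd_on S (\<lambda>i j. M i j + (if i = j then d i else 0))"
  by (intro psd_on_add assms psd_on_diag) auto

section \<open>Cauchy-Schwarz inequality and Schur complements\<close>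

lemma bform_sym:
  assumes "psd_on S M" shows "bform S M v w = bform S M w v"
  unfolding bform_def
  by (subst sum.swap) (intro sum.cong HOL.refl, simp add: psd_on_sym[OF assms] mult_ac)

lemma bform_comb:
  assumes "psd_on S M"
  shows "bform S M (\<lambda>i. v i + t * w i) (\<lambda>i. v i + t * w i)
    = bform S M v v + 2 * t * bform S M v w + t\<^sup>2 * bform S M w w"
proof -
  have "bform S M (\<lambda>i. v i + t * w i) (\<lambda>i. v i + t * w i)
      = bform S M v v + t * bform S M v w + t * bform S M w v + t\<^sup>2 * bform S M w w"
    by (simp add: bform_def algebra_simps sum.distrib sum_distrib_left power2_eq_square)
  then show ?thesis by (simp add: bform_sym[OF assms, of w v])
qed

lemma bform_cauchy_schwarz:
  assumes "psd_on S M"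
  shows "(bform S M v w)\<^sup>2 \<le> bform S M v v * bform S M w w"
proof -
  have pos: "bform S M v v + 2 * t * bform S M v w + t\<^sup>2 * bform S M w w \<ge> 0" for t
    using psd_on_bform[OF assms] bform_comb[OF assms, of v t w] by metis
  show ?thesis
  proof (cases "bform S M w w = 0")
    case True
    have "bform S M v w = 0"
    proof (rule ccontr)
      assume n: "bform S M v w \<noteq> 0"
      \<comment> \<open>With \<open>bform S M w w = 0\<close> the quadratic is affine in
        \<open>t\<close>; this \<open>t\<close> would give it the value -1.\<close>
      have "bform S M v v + 2 * (- (bform S M v v + 1) / (2 * bform S M v w)) * bform S M v w \<ge> 0"
        using pos[of "- (bform S M v v + 1) / (2 * bform S M v w)"] True by simp
      then show False using n by (simp add: field_simps)
    qed
    then show ?thesis using True by simp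
  next
    case False
    then have q: "bform S M w w > 0" using psd_on_bform[OF assms, of w] by linarith
    have "bform S M v v + 2 * (- bform S M v w / bform S M w w) * bform S M v w
        + (- bform S M v w / bform S M w w)\<^sup>2 * bform S M w w \<ge> 0" by (rule pos)
    also have "bform S M v v + 2 * (- bform S M v w / bform S M w w) * bform S M v w
        + (- bform S M v w / bform S M w w)\<^sup>2 * bform S M w w
        = bform S M v v - (bform S M v w)\<^sup>2 / bform S M w w"
      using q by (simp add: field_simps power2_eq_square)
    finally show ?thesis using q by (simp add: field_simps)
  qed
qed

text \<open>With \<open>u = M w\<close>, the subtraction lowers the form at \<open>v\<close> by
  exactly \<open>(bform S M v w)^2 / bform S M w w\<close>, which Cauchy-Schwarz bounds. If
  \<open>bform S M w w = 0\<close>, division by zero yields 0 and nothing is subtracted.\<close>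

lemma psd_on_schur:
  assumes "psd_on S M"
    and u: "\<And>i. i \<in> S \<Longrightarrow> u i = (\<Sum>j\<in>S. M i j * w j)"
  shows "psd_on S (\<lambda>i j. M i j - u i * u j / bform S M w w)"
proof (rule psd_onI)
  show "M i j - u i * u j / bform S M w w = M j i - u j * u i / bform S M w w" if "i \<in> S" "j \<in> S" for i j
    using psd_on_sym[OF assms(1) that] by (simp add: mult_ac)
  fix v
  have vu: "(\<Sum>i\<in>S. v i * u i) = bform S M v w"
    unfolding bform_def by (intro sum.cong HOL.refl) (simp add: u sum_distrib_left mult_ac)
  have "bform S (\<lambda>i j. M i j - u i * u j / bform S M w w) v v
      = bform S M v v - (\<Sum>i\<in>S. v i * u i) * (\<Sum>j\<in>S. v j * u j) / bform S M w w"
    by (simp add: bform_def sum_product sum_subtractf algebra_simps sum_divide_distrib)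
  also have "\<dots> = bform S M v v - (bform S M v w)\<^sup>2 / bform S M w w"
    by (simp add: vu power2_eq_square)
  also have "\<dots> \<ge> 0"
  proof (cases "bform S M w w = 0")
    case True then show ?thesis using psd_on_bform[OF assms(1)] by simp
  next
    case False
    then have "bform S M w w > 0" using psd_on_bform[OF assms(1), of w] by linarith
    then show ?thesis using bform_cauchy_schwarz[OF assms(1), of v w] by (simp add: field_simps)
  qed
  finally show "bform S (\<lambda>i j. M i j - u i * u j / bform S M w w) v v \<ge> 0" .
qed

lemma bform_indicator:
  assumes "finite S" "a \<in> S" "b \<in> S"
  shows "bform S M (\<lambda>i. if i = a then x else 0) (\<lambda>i. if i = b then y else 0) = x * M a b * y"
proof -
  have "(\<Sum>i\<in>S. \<Sum>j\<in>S. (if i = a then x else 0) * M i j * (if j = b then y else 0))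
      = (\<Sum>i\<in>S. if i = a then (\<Sum>j\<in>S. if j = b then x * M i j * y else 0) else 0)"
    by (intro sum.cong HOL.refl) (auto intro: sum.cong)
  then show ?thesis using assms by (simp add: bform_def)
qed

lemma psd_on_diag_nonneg:
  assumes "finite S" "psd_on S M" "a \<in> S"
  shows "M a a \<ge> 0"
  using psd_on_bform[OF assms(2), of "\<lambda>i. if i = a then 1 else 0"]
    bform_indicator[OF assms(1,3,3), of M 1 1] by simp

lemma psd_on_minor:
  assumes "finite S" "psd_on S M" "a \<in> S" "b \<in> S"
  shows "(M a b)\<^sup>2 \<le> M a a * M b b"
  using bform_cauchy_schwarz[OF assms(2), of "\<lambda>i. if i = a then 1 else 0" "\<lambda>i. if i = b then 1 else 0"]
    bform_indicator[OF assms(1,3,3), of M 1 1] bform_indicator[OF assms(1,4,4), of M 1 1]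
    bform_indicator[OF assms(1,3,4), of M 1 1] by simp

lemma psd_on_pair:
  assumes "a \<noteq> b" "M a b = M b a" "M a a \<ge> 0" "M b b \<ge> 0" "(M a b)\<^sup>2 \<le> M a a * M b b"
  shows "psd_on {a, b} M"
proof (rule psd_onI)
  show "M i j = M j i" if "i \<in> {a, b}" "j \<in> {a, b}" for i j using that assms(2) by auto
  fix v
  have eq: "bform {a, b} M v v = (v a)\<^sup>2 * M a a + 2 * v a * v b * M a b + (v b)\<^sup>2 * M b b"
    using assms(1,2) by (simp add: bform_def power2_eq_square algebra_simps)
  show "bform {a, b} M v v \<ge> 0"
  proof (cases "M a a = 0")
    case True
    then have "M a b = 0" using assms(5) by simp
    then show ?thesis using eq True assms(4) by simp
  next
    case False
    then have p: "M a a > 0" using assms(3) by simp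
    \<comment> \<open>Completing the square, cleared of the denominator
      \<open>M a a\<close>.\<close>
    have "M a a * bform {a, b} M v v = (v a * M a a + v b * M a b)\<^sup>2 + (v b)\<^sup>2 * (M a a * M b b - (M a b)\<^sup>2)"
      unfolding eq by (simp add: power2_eq_square algebra_simps)
    also have "\<dots> \<ge> 0" using assms(5) by (intro add_nonneg_nonneg) auto
    finally show ?thesis using p by (simp add: zero_le_mult_iff)
  qed
qed

lemma psd_on_singleton: "M a a \<ge> 0 \<Longrightarrow> psd_on {a} M"
proof (rule psd_onI)
  show "bform {a} M v v \<ge> 0" if "M a a \<ge> 0" for v
  proof -
    have "bform {a} M v v = M a a * (v a)\<^sup>2" by (simp add: bform_def power2_eq_square)
    then show ?thesis using that by simp
  qed
qed auto

lemma psd_on_extend_zero: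
  assumes "finite S" "psd_on U M" "U \<subseteq> S"
  shows "psd_on S (\<lambda>i j. if i \<in> U \<and> j \<in> U then M i j else 0)" (is "psd_on S ?N")
proof (rule psd_onI)
  show "?N i j = ?N j i" for i j using psd_on_sym[OF assms(2)] by auto
  fix v :: "'a \<Rightarrow> real"
  let ?v = "\<lambda>i. if i \<in> U then v i else 0"
  have "bform S ?N v v = bform S ?N ?v ?v"
    unfolding bform_def by (intro sum.cong HOL.refl) auto
  also have "\<dots> = bform U ?N ?v ?v"
    by (rule bform_mono_neutral) (use assms in auto)
  also have "\<dots> = bform U M v v"
    unfolding bform_def by (intro sum.cong HOL.refl) auto
  finally show "bform S ?N v v \<ge> 0" using psd_on_bform[OF assms(2)] by simp
qed

text \<open>Positive semidefinite matrices are glued by induction on the size of the overlap, splitting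
  off the same rank one matrix on both sides by a Schur complement.\<close>

lemma psd_on_glue:
  assumes "finite S" "finite U" "psd_on S A" "psd_on U B"
    and "\<And>i j. i \<in> S \<inter> U \<Longrightarrow> j \<in> S \<inter> U \<Longrightarrow> A i j = B i j"
  obtains M where "psd_on (S \<union> U) M"
    and "\<And>i j. i \<in> S \<Longrightarrow> j \<in> S \<Longrightarrow> M i j = A i j"
    and "\<And>i j. i \<in> U \<Longrightarrow> j \<in> U \<Longrightarrow> M i j = B i j"
proof -
  have "\<exists>M. psd_on (S \<union> U) M \<and> (\<forall>i\<in>S. \<forall>j\<in>S. M i j = A i j) \<and> (\<forall>i\<in>U. \<forall>j\<in>U. M i j = B i j)"
    using assms
  proof (induction "card (S \<inter> U)" arbitrary: S U A B)
    case 0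
    then have disj: "S \<inter> U = {}" by auto
    let ?M = "\<lambda>i j. (if i \<in> S \<and> j \<in> S then A i j else 0) + (if i \<in> U \<and> j \<in> U then B i j else 0)"
    have "psd_on (S \<union> U) ?M"
      by (intro psd_on_add psd_on_extend_zero) (use 0 in auto)
    moreover have "\<forall>i\<in>S. \<forall>j\<in>S. ?M i j = A i j" "\<forall>i\<in>U. \<forall>j\<in>U. ?M i j = B i j"
      using disj by auto
    ultimately show ?case by blast
  next
    case (Suc n)
    then obtain k where k: "k \<in> S" "k \<in> U" by (metis Int_emptyI card.empty nat.distinct(1))
    let ?q = "A k k"
    have qB: "B k k = ?q" using Suc.prems(5) k by simp
    let ?e = "\<lambda>i. if i = k then 1 else 0 :: real"
    \<comment> \<open>Pivoting on the common index \<open>k\<close>: both complements agree on the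
      overlap and their row of \<open>k\<close> is zero, so \<open>k\<close> can be removed from
      both index sets.\<close>
    have A': "psd_on S (\<lambda>i j. A i j - A i k * A j k / ?q)"
    proof -
      have "psd_on S (\<lambda>i j. A i j - A i k * A j k / bform S A ?e ?e)"
        using Suc.prems k by (intro psd_on_schur) (auto simp: if_distrib cong: if_cong)
      then show ?thesis using bform_indicator[OF Suc.prems(1) k(1) k(1), of A 1 1] by simp
    qed
    have B': "psd_on U (\<lambda>i j. B i j - B i k * B j k / ?q)"
    proof -
      have "psd_on U (\<lambda>i j. B i j - B i k * B j k / bform U B ?e ?e)"
        using Suc.prems k by (intro psd_on_schur) (auto simp: if_distrib cong: if_cong)
      then show ?thesis using bform_indicator[OF Suc.prems(2) k(2) k(2), of B 1 1] qB by simp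
    qed
    \<comment> \<open>If the pivot is 0, the term added back later is 0 as well; the entries of row
      \<open>k\<close> are still right, because the 2x2 minors force them to vanish.\<close>
    have zA: "A i k = 0" if "?q = 0" "i \<in> S" for i
      using psd_on_minor[OF Suc.prems(1,3) that(2) k(1)] that(1) by simp
    have zB: "B i k = 0" if "?q = 0" "i \<in> U" for i
      using psd_on_minor[OF Suc.prems(2,4) that(2) k(2)] that(1) qB by simp
    have cn: "n = card ((S - {k}) \<inter> (U - {k}))"
    proof -
      have "(S - {k}) \<inter> (U - {k}) = S \<inter> U - {k}" by auto
      then show ?thesis using Suc.hyps(2) Suc.prems(1) k by simp
    qed
    have agree: "A i j - A i k * A j k / ?q = B i j - B i k * B j k / ?q"
      if "i \<in> (S - {k}) \<inter> (U - {k})" "j \<in> (S - {k}) \<inter> (U - {k})" for i j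
      using Suc.prems(5) that k by simp
    have "\<exists>M. psd_on ((S - {k}) \<union> (U - {k})) M
       \<and> (\<forall>i\<in>S - {k}. \<forall>j\<in>S - {k}. M i j = A i j - A i k * A j k / ?q)
       \<and> (\<forall>i\<in>U - {k}. \<forall>j\<in>U - {k}. M i j = B i j - B i k * B j k / ?q)"
      using Suc.hyps(1)[OF cn, OF _ _ psd_on_subset[OF _ _ A'] psd_on_subset[OF _ _ B'] agree]
        Suc.prems(1,2) by auto
    then obtain M where M: "psd_on ((S - {k}) \<union> (U - {k})) M"
       "\<And>i j. i \<in> S - {k} \<Longrightarrow> j \<in> S - {k} \<Longrightarrow> M i j = A i j - A i k * A j k / ?q"
       "\<And>i j. i \<in> U - {k} \<Longrightarrow> j \<in> U - {k} \<Longrightarrow> M i j = B i j - B i k * B j k / ?q" by blast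
    let ?D = "(S - {k}) \<union> (U - {k})"
    \<comment> \<open>The column of \<open>k\<close>; on the overlap the two choices coincide, so
      the rank one matrix added back is correct on \<open>S\<close> and on \<open>U\<close>.\<close>
    let ?w = "\<lambda>i. if i \<in> S then A i k else B i k"
    let ?N = "\<lambda>i j. (if i \<in> ?D \<and> j \<in> ?D then M i j else 0) + 1 / ?q * (?w i * ?w j)"
    have q0: "?q \<ge> 0" using psd_on_diag_nonneg[OF Suc.prems(1,3) k(1)] .
    have "psd_on (S \<union> U) ?N"
      by (intro psd_on_add psd_on_extend_zero psd_on_scale psd_on_rank1 M(1)) (use Suc.prems q0 in auto)
    moreover have "?N i j = A i j" if "i \<in> S" "j \<in> S" for i j
    proof (cases "i = k \<or> j = k")
      case True
      have s: "A k j = A j k" using psd_on_sym[OF Suc.prems(3) k(1) that(2)] .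
      show ?thesis
        using True that k zA[of i] zA[of j] s by (cases "?q = 0") auto
    next
      case False
      then show ?thesis using M(2)[of i j] that by simp
    qed
    moreover have wU: "?w i = B i k" if "i \<in> U" for i using that Suc.prems(5) k by auto
    have "?N i j = B i j" if "i \<in> U" "j \<in> U" for i j
    proof (cases "i = k \<or> j = k")
      case True
      have s: "B k j = B j k" using psd_on_sym[OF Suc.prems(4) k(2) that(2)] .
      have "?N i j = 1 / ?q * (B i k * B j k)" using True wU that by auto
      then show ?thesis
        using True that k zB[of i] zB[of j] s qB by (cases "?q = 0") auto
    next
      case False
      then show ?thesis using M(3)[of i j] that wU[OF that(1)] wU[OF that(2)] by simp
    qed
    ultimately show ?case by blast
  qed
  then show thesis using that by blast
qed

lemma psd_on_glue_family:
  assumes "finite F" "\<And>U. U \<in> F \<Longrightarrow> finite U" "\<And>U. U \<in> F \<Longrightarrow> psd_on U (M U)"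
    and "\<And>U V. U \<in> F \<Longrightarrow> V \<in> F \<Longrightarrow> U \<noteq> V \<Longrightarrow> U \<inter> V = {}"
  obtains N where "psd_on (\<Union>F) N" "\<And>U i j. U \<in> F \<Longrightarrow> i \<in> U \<Longrightarrow> j \<in> U \<Longrightarrow> N i j = M U i j"
proof -
  have "\<exists>N. psd_on (\<Union>F) N \<and> (\<forall>U\<in>F. \<forall>i\<in>U. \<forall>j\<in>U. N i j = M U i j)"
    using assms
  proof (induction F rule: finite_induct)
    case empty
    show ?case using psd_on_zero[of "{}"] by auto
  next
    case (insert U F)
    then obtain N where N: "psd_on (\<Union>F) N" "\<forall>U\<in>F. \<forall>i\<in>U. \<forall>j\<in>U. N i j = M U i j"
      by (metis insert_iff)
    have d: "U \<inter> \<Union>F = {}" using insert.prems(3) insert.hyps(2)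
      by blast
    obtain N' where N': "psd_on (U \<union> \<Union>F) N'" "\<And>i j. i \<in> U \<Longrightarrow> j \<in> U \<Longrightarrow> N' i j = M U i j"
      "\<And>i j. i \<in> \<Union>F \<Longrightarrow> j \<in> \<Union>F \<Longrightarrow> N' i j = N i j"
      by (rule psd_on_glue[of U "\<Union>F" "M U" N]) (use insert.prems insert.hyps(1) N(1) d in auto)
    have "N' i j = M V i j" if "V \<in> F" "i \<in> V" "j \<in> V" for V i j
    proof -
      have "i \<in> \<Union>F" "j \<in> \<Union>F" using that by auto
      then show ?thesis using N'(3) N(2) that by simp
    qed
    then show ?case using N' by (intro exI[of _ N']) auto
  qed
  then show thesis using that by blast
qed

section \<open>Cycles as cyclic lists\<close>

definition consec :: "'a list \<Rightarrow> ('a \<times> 'a) set" where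
  "consec xs = set (zip xs (tl xs))"

text \<open>A cycle on at least three distinct vertices is traversed in one direction only. For two
  vertices both directions occur; this digon is the cycle formed by a pair of parallel arcs.\<close>

definition cyc_pairs :: "'a list \<Rightarrow> ('a \<times> 'a) set" where
  "cyc_pairs xs = consec xs \<union> {(last xs, hd xs)}"

lemma consec_Nil [simp]: "consec [] = {}"
  and consec_single [simp]: "consec [x] = {}"
  and consec_Cons_Cons [simp]: "consec (x # y # xs) = insert (x, y) (consec (y # xs))"
  by (simp_all add: consec_def)

lemma consec_Cons: "xs \<noteq> [] \<Longrightarrow> consec (x # xs) = insert (x, hd xs) (consec xs)"
  by (cases xs) auto

lemma consec_append:
  "xs \<noteq> [] \<Longrightarrow> ys \<noteq> [] \<Longrightarrow> consec (xs @ ys) = insert (last xs, hd ys) (consec xs \<union> consec ys)"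
proof (induction xs)
  case (Cons x xs)
  then show ?case by (cases xs) (auto simp: consec_Cons)
qed simp

lemma cyc_pairs_append:
  assumes "xs \<noteq> []" "ys \<noteq> []"
  shows "cyc_pairs (xs @ ys) = cyc_pairs (ys @ xs)"
  using assms by (auto simp: cyc_pairs_def consec_append)

lemma consec_split: "(x, y) \<in> consec xs \<longleftrightarrow> (\<exists>us ws. xs = us @ x # y # ws)"
proof
  assume "(x, y) \<in> consec xs"
  then show "\<exists>us ws. xs = us @ x # y # ws"
  proof (induction xs)
    case (Cons a xs)
    show ?case
    proof (cases xs)
      case (Cons b zs)
      then have "(x, y) = (a, b) \<or> (x, y) \<in> consec xs" using Cons.prems by auto
      then show ?thesis
      proof
        assume "(x, y) = (a, b)"
        then have "a # xs = [] @ x # y # zs" using Cons by simp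
        then show ?thesis by blast
      next
        assume "(x, y) \<in> consec xs"
        then obtain us ws where "xs = us @ x # y # ws" using Cons.IH by blast
        then have "a # xs = (a # us) @ x # y # ws" by simp
        then show ?thesis by blast
      qed
    qed (use Cons.prems in simp)
  qed simp
next
  assume "\<exists>us ws. xs = us @ x # y # ws"
  then obtain us ws where xs: "xs = us @ x # y # ws" by blast
  show "(x, y) \<in> consec xs"
    by (cases "us = []") (auto simp: xs consec_append)
qed

text \<open>Makes a chosen edge of the cycle the closing one, so that the other edges form the path
  \<open>consec ys\<close>.\<close>

lemma cyc_pairs_rotate:
  assumes "(x, y) \<in> cyc_pairs xs" "length xs \<ge> 2"
  obtains ys where "cyc_pairs ys = cyc_pairs xs" "set ys = set xs" "distinct ys = distinct xs"
    "length ys = length xs" "last ys = x" "hd ys = y"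
proof (cases "(x, y) \<in> consec xs")
  case True
  then obtain us ws where xs: "xs = (us @ [x]) @ (y # ws)" by (auto simp: consec_split)
  have "cyc_pairs ((y # ws) @ us @ [x]) = cyc_pairs xs"
    unfolding xs by (rule cyc_pairs_append) auto
  then show thesis by (rule that) (auto simp: xs)
next
  case False
  then have "x = last xs" "y = hd xs" using assms by (auto simp: cyc_pairs_def)
  then show thesis using that[of xs] by simp
qed

lemma cyc_pairs_subset: "xs \<noteq> [] \<Longrightarrow> cyc_pairs xs \<subseteq> set xs \<times> set xs"
  by (auto simp: cyc_pairs_def consec_split)

lemma consec_map: "consec (map f xs) = (\<lambda>(x, y). (f x, f y)) ` consec xs"
proof (induction xs)
  case (Cons x xs)
  then show ?case by (cases xs) auto
qed simp

lemma cyc_pairs_map: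
  "xs \<noteq> [] \<Longrightarrow> cyc_pairs (map f xs) = (\<lambda>(x, y). (f x, f y)) ` cyc_pairs xs"
  by (auto simp: cyc_pairs_def consec_map last_map hd_map)

lemma consec_upt: "consec (map f [m..<n]) = {(f k, f (Suc k)) | k. m \<le> k \<and> Suc k < n}"
proof (induction n)
  case (Suc n)
  show ?case
  proof (cases "m < n")
    case True
    then obtain n' where n': "n = Suc n'" "m \<le> n'" by (cases n) auto
    have "consec (map f [m..<Suc n]) = insert (f n', f n) (consec (map f [m..<n]))"
      using n' consec_append[of "map f [m..<n]" "[f n]"] by simp
    also have "\<dots> = {(f k, f (Suc k)) | k. m \<le> k \<and> Suc k < Suc n}"
      unfolding Suc.IH using n' by (auto simp: less_Suc_eq)
    finally show ?thesis .
  next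
    case False
    then show ?thesis by (cases "m = n") auto
  qed
qed auto

text \<open>Tokens of a closed chain of paths: the path attached to \<open>v\<close> contributes the positions
  \<open>0, \<dots>, d v - 1\<close>, its last position \<open>d v\<close> being the start of the next path.\<close>

definition chain :: "('a \<Rightarrow> nat) \<Rightarrow> 'a list \<Rightarrow> ('a \<times> nat) list" where
  "chain d vs = concat (map (\<lambda>v. map (Pair v) [0..<d v]) vs)"

lemma chain_Nil [simp]: "chain d [] = []"
  and chain_Cons: "chain d (v # vs) = map (Pair v) [0..<d v] @ chain d vs"
  by (simp_all add: chain_def)

lemma set_chain: "set (chain d vs) = {(v, k). v \<in> set vs \<and> k < d v}"
  by (auto simp: chain_def)

lemma length_chain: "length (chain d vs) = sum_list (map d vs)"
  by (induction vs) (auto simp: chain_Cons)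

lemma distinct_chain: "distinct vs \<Longrightarrow> distinct (chain d vs)"
  by (induction vs) (auto simp: chain_Cons distinct_map set_chain inj_on_def)

lemma chain_hd_last:
  assumes "vs \<noteq> []" "\<forall>v\<in>set vs. d v > 0"
  shows "chain d vs \<noteq> [] \<and> hd (chain d vs) = (hd vs, 0)
    \<and> last (chain d vs) = (last vs, d (last vs) - 1)"
  using assms
proof (induction vs)
  case (Cons v vs)
  then show ?case by (cases "vs = []") (auto simp: chain_Cons hd_append hd_map last_map)
qed simp

lemma consec_chain:
  assumes "\<forall>v\<in>set vs. d v > 0"
  shows "consec (chain d vs) = {((v, k), (v, Suc k)) | v k. v \<in> set vs \<and> Suc k < d v}
    \<union> {((v, d v - 1), (w, 0)) | v w. (v, w) \<in> consec vs}"
  using assms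
proof (induction vs)
  case (Cons v vs)
  show ?case
  proof (cases "vs = []")
    case True
    then show ?thesis by (auto simp: chain_Cons consec_upt)
  next
    case False
    have "consec (chain d (v # vs))
        = insert ((v, d v - 1), (hd vs, 0)) (consec (map (Pair v) [0..<d v]) \<union> consec (chain d vs))"
      unfolding chain_Cons using Cons.prems False chain_hd_last[of vs d]
      by (subst consec_append) (auto simp: last_map)
    then show ?thesis using Cons False by (auto simp: consec_upt consec_Cons)
  qed
qed simp

lemma cyc_pairs_chain:
  assumes "vs \<noteq> []" "\<forall>v\<in>set vs. d v > 0"
  shows "cyc_pairs (chain d vs) = {((v, k), (v, Suc k)) | v k. v \<in> set vs \<and> Suc k < d v}
    \<union> {((v, d v - 1), (w, 0)) | v w. (v, w) \<in> cyc_pairs vs}"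
  using chain_hd_last[OF assms] consec_chain[OF assms(2)] by (auto simp: cyc_pairs_def)

lemma consec_nth: "consec xs = {(xs ! i, xs ! Suc i) | i. Suc i < length xs}"
  by (auto simp: consec_def set_zip nth_tl)

lemma cyc_pairs_nth:
  assumes "xs \<noteq> []"
  shows "cyc_pairs xs = {(xs ! i, xs ! (Suc i mod length xs)) | i. i < length xs}"
proof (intro equalityI subrelI)
  fix x y assume "(x, y) \<in> cyc_pairs xs"
  then consider i where "Suc i < length xs" "x = xs ! i" "y = xs ! Suc i"
    | "x = xs ! (length xs - 1)" "y = xs ! 0"
    using assms by (auto simp: cyc_pairs_def consec_nth last_conv_nth hd_conv_nth)
  then show "(x, y) \<in> {(xs ! i, xs ! (Suc i mod length xs)) | i. i < length xs}"
  proof cases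
    case 1 then show ?thesis by (auto intro!: exI[of _ i])
  next
    case 2 then show ?thesis using assms by (auto intro!: exI[of _ "length xs - 1"])
  qed
next
  fix x y assume "(x, y) \<in> {(xs ! i, xs ! (Suc i mod length xs)) | i. i < length xs}"
  then obtain i where i: "i < length xs" "x = xs ! i" "y = xs ! (Suc i mod length xs)" by auto
  show "(x, y) \<in> cyc_pairs xs"
  proof (cases "Suc i = length xs")
    case True
    then have "i = length xs - 1" by simp
    then have "x = last xs" "y = hd xs" using i assms True
      by (simp_all add: last_conv_nth hd_conv_nth)
    then show ?thesis by (simp add: cyc_pairs_def)
  next
    case False
    then show ?thesis using i by (auto simp: cyc_pairs_def consec_nth)
  qed
qed

section \<open>Shortening cycles to induced cycles\<close>

definition cycle_in :: "('a \<times> 'a) set \<Rightarrow> 'a list \<Rightarrow> bool" where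
  "cycle_in E xs \<longleftrightarrow> distinct xs \<and> length xs \<ge> 3 \<and> cyc_pairs xs \<subseteq> E"

text \<open>A chord splits off a shorter cycle; a cycle of length 3 would be a triangle.\<close>

lemma has_induced_cycle_if_cycle:
  assumes sym: "sym (parcs G)" and irr: "irrefl (parcs G)"
    and "cycle_in (parcs G) xs" "set xs \<subseteq> pverts G"
    and "\<And>S. triangle G S \<Longrightarrow> \<not> S \<subseteq> set xs"
  obtains m where "4 \<le> m" "m \<le> length xs" "has_induced_cycle G m"
proof -
  have "\<exists>m\<ge>4. m \<le> length xs \<and> has_induced_cycle G m"
    using assms(3-5)
  proof (induction "length xs" arbitrary: xs rule: less_induct)
    case less
    let ?n = "length xs"
    have n3: "?n \<ge> 3" and dist: "distinct xs" and cyc: "cyc_pairs xs \<subseteq> parcs G"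
      using less.prems(1) by (auto simp: cycle_in_def)
    have edge: "(xs ! i, xs ! (Suc i mod ?n)) \<in> parcs G" if "i < ?n" for i
      using cyc cyc_pairs_nth[of xs] that by fastforce
    have edge': "(xs ! i, xs ! j) \<in> parcs G" if "(i, j) \<in> parcs (cycle_graph ?n)" for i j
      using that edge[of i] edge[of j] symD[OF sym] by (auto simp: cycle_graph_def)
    have inj: "inj_on ((!) xs) {..<?n}" using dist by (simp add: inj_on_nth)
    show ?case
    proof (cases "\<forall>i<?n. \<forall>j<?n. (xs ! i, xs ! j) \<in> parcs G \<longrightarrow> (i, j) \<in> parcs (cycle_graph ?n)")
      case True
      have "has_induced_cycle G ?n"
        unfolding has_induced_cycle_def
      proof (intro exI[of _ "(!) xs"] conjI allI impI inj)
        show "(!) xs ` {..<?n} \<subseteq> pverts G" using less.prems(2) by (auto simp: subset_iff)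
        show "(xs ! i, xs ! j) \<in> parcs G \<longleftrightarrow> (i, j) \<in> parcs (cycle_graph ?n)"
          if "i < ?n" "j < ?n" for i j using True edge' that by blast
      qed
      moreover have "?n \<noteq> 3"
      proof
        assume 3: "?n = 3"
        have "clique G (set xs)"
          unfolding clique_def
        proof (intro conjI ballI impI less.prems(2))
          fix x y assume "x \<in> set xs" "y \<in> set xs" "x \<noteq> y"
          then obtain i j where ij: "i < 3" "j < 3" "x = xs ! i" "y = xs ! j" "i \<noteq> j"
            using 3 by (metis in_set_conv_nth)
          have "(i, j) \<in> parcs (cycle_graph ?n)"
          proof -
            have "i = 0 \<or> i = 1 \<or> i = 2" "j = 0 \<or> j = 1 \<or> j = 2" using ij(1,2) by arith+
            then show ?thesis using ij(5) unfolding 3 cycle_graph_def by auto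
          qed
          then show "(x, y) \<in> parcs G" using edge' ij by blast
        qed
        then have "triangle G (set xs)" using 3 dist by (simp add: triangle_def distinct_card)
        then show False using less.prems(3) by blast
      qed
      ultimately show ?thesis using n3 by (intro exI[of _ ?n]) auto
    next
      case False
      then obtain i0 j0 where ij0: "i0 < ?n" "j0 < ?n" "(xs ! i0, xs ! j0) \<in> parcs G"
        "(i0, j0) \<notin> parcs (cycle_graph ?n)" by blast
      obtain i j where ij: "i < j" "j < ?n" "(xs ! i, xs ! j) \<in> parcs G"
        "(i, j) \<notin> parcs (cycle_graph ?n)"
      proof -
        have "i0 \<noteq> j0" using ij0(3) irr by (auto simp: irrefl_def)
        moreover have "(xs ! j0, xs ! i0) \<in> parcs G" using symD[OF sym ij0(3)] .
        moreover have "(j0, i0) \<notin> parcs (cycle_graph ?n)" using ij0(4) by (auto simp: cycle_graph_def)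
        ultimately show thesis using that[of i0 j0] that[of j0 i0] ij0 by (cases "i0 < j0") auto
      qed
      have nadj: "Suc i \<noteq> j" "\<not> (i = 0 \<and> Suc j = ?n)"
        using ij by (auto simp: cycle_graph_def)
      \<comment> \<open>The stretch from \<open>i\<close> to \<open>j\<close>, closed by the chord.
        It has at least 3 vertices because \<open>j\<close> is not \<open>Suc i\<close>, and fewer
        than \<open>?n\<close> because the chord does not join the last vertex to the first.\<close>
      let ?ys = "take (Suc j - i) (drop i xs)"
      have len: "length ?ys = Suc j - i" using ij by simp
      have nth: "?ys ! k = xs ! (i + k)" if "k < Suc j - i" for k using that ij by simp
      have lt: "length ?ys < ?n" using len ij nadj by auto
      have ge: "length ?ys \<ge> 3" using len ij nadj by auto
      have sub: "set ?ys \<subseteq> set xs" by (meson order_trans set_drop_subset set_take_subset)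
      have "consec ?ys \<subseteq> consec xs"
      proof
        fix p assume "p \<in> consec ?ys"
        then obtain k where "Suc k < Suc j - i" "p = (xs ! (i + k), xs ! Suc (i + k))"
          using len nth by (auto simp: consec_nth)
        then show "p \<in> consec xs" using ij by (auto simp: consec_nth intro!: exI[of _ "i + k"])
      qed
      moreover have "(last ?ys, hd ?ys) \<in> parcs G"
      proof -
        have "?ys \<noteq> []" using ge by (metis list.size(3) not_numeral_le_zero)
        then have "last ?ys = xs ! j" "hd ?ys = xs ! i"
          using nth[of 0] nth[of "j - i"] ij len by (simp_all add: last_conv_nth hd_conv_nth)
        then show ?thesis using symD[OF sym ij(3)] by simp
      qed
      ultimately have "cycle_in (parcs G) ?ys"
        using dist ge cyc by (auto simp: cycle_in_def cyc_pairs_def)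
      then obtain m where "m \<ge> 4" "m \<le> length ?ys" "has_induced_cycle G m"
        using less.hyps[OF lt] less.prems(2,3) sub by (meson order_trans)
      then show ?thesis using lt by (meson less_imp_le order_trans)
    qed
  qed
  then show thesis using that by blast
qed

text \<open>Serves both for two paths on the two sides of a separator and for paths through the
  blocks of a necklace. Vertices are compared only at positions below \<open>d v\<close>, since
  position \<open>d v\<close> is position 0 of the next path.\<close>

lemma has_induced_cycle_if_chain:
  assumes "sym (parcs G)" "irrefl (parcs G)"
    and vs: "distinct vs" "vs \<noteq> []" "\<forall>v\<in>set vs. d v > 0" and len: "sum_list (map d vs) \<ge> 3"
    and step: "\<And>v k. v \<in> set vs \<Longrightarrow> k < d v \<Longrightarrow> (\<pi> v k, \<pi> v (Suc k)) \<in> parcs G"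
    and close: "\<And>v w. (v, w) \<in> cyc_pairs vs \<Longrightarrow> \<pi> v (d v) = \<pi> w 0"
    and inj: "\<And>v w k l. v \<in> set vs \<Longrightarrow> w \<in> set vs \<Longrightarrow> k < d v \<Longrightarrow> l < d w \<Longrightarrow> \<pi> v k = \<pi> w l
      \<Longrightarrow> v = w \<and> k = l"
    and verts: "\<And>v k. v \<in> set vs \<Longrightarrow> k < d v \<Longrightarrow> \<pi> v k \<in> pverts G"
    and tri: "\<And>S. triangle G S \<Longrightarrow> \<not> S \<subseteq> {\<pi> v k | v k. v \<in> set vs \<and> k < d v}"
  obtains m where "4 \<le> m" "m \<le> sum_list (map d vs)" "has_induced_cycle G m"
proof -
  let ?xs = "map (\<lambda>(v, k). \<pi> v k) (chain d vs)"
  have ne: "chain d vs \<noteq> []" using chain_hd_last[OF vs(2,3)] by blast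
  have l: "length ?xs = sum_list (map d vs)" by (simp add: length_chain)
  have s: "set ?xs = {\<pi> v k | v k. v \<in> set vs \<and> k < d v}" by (auto simp: set_chain)
  have "cycle_in (parcs G) ?xs"
    unfolding cycle_in_def
  proof (intro conjI)
    show "distinct ?xs" using distinct_chain[OF vs(1)] inj
      by (auto simp: distinct_map inj_on_def set_chain)
    show "length ?xs \<ge> 3" using len l by simp
    show "cyc_pairs ?xs \<subseteq> parcs G"
    proof
      fix p assume "p \<in> cyc_pairs ?xs"
      then consider v k where "v \<in> set vs" "Suc k < d v" "p = (\<pi> v k, \<pi> v (Suc k))"
        | v w where "(v, w) \<in> cyc_pairs vs" "p = (\<pi> v (d v - 1), \<pi> w 0)"
        unfolding cyc_pairs_map[OF ne] cyc_pairs_chain[OF vs(2,3)] by auto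
      then show "p \<in> parcs G"
      proof cases
        case 1 then show ?thesis using step[of v k] by simp
      next
        case 2
        then have "v \<in> set vs" using cyc_pairs_subset[OF vs(2)] by auto
        then show ?thesis using 2 step[of v "d v - 1"] close[OF 2(1)] vs(3) by auto
      qed
    qed
  qed
  then show thesis
  proof (rule has_induced_cycle_if_cycle[OF assms(1,2)])
    show "set ?xs \<subseteq> pverts G" using s verts by auto
    show "\<not> S \<subseteq> set ?xs" if "triangle G S" for S using tri[OF that] s by simp
    show thesis if "4 \<le> m" "m \<le> length ?xs" "has_induced_cycle G m" for m
      using that(1,2,3) \<open>\<And>m. 4 \<le> m \<Longrightarrow> m \<le> sum_list (map d vs) \<Longrightarrow> has_induced_cycle G m \<Longrightarrow> thesis\<close> l by simp
  qed
qed

section \<open>Shortest paths and chordal completion\<close>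

text \<open>Graph distance. For \<open>x\<close> not reachable from \<open>s\<close> the
  \<open>LEAST\<close> is unspecified, hence the reachability premises below.\<close>

definition bfs :: "('a \<times> 'a) set \<Rightarrow> 'a \<Rightarrow> 'a \<Rightarrow> nat" where
  "bfs E s x = (LEAST n. (s, x) \<in> E ^^ n)"

lemma bfs_relpow: "(s, x) \<in> E\<^sup>* \<Longrightarrow> (s, x) \<in> E ^^ bfs E s x"
  unfolding bfs_def by (rule LeastI_ex) (auto simp: rtrancl_power)

lemma bfs_le: "(s, x) \<in> E ^^ n \<Longrightarrow> bfs E s x \<le> n"
  unfolding bfs_def by (rule Least_le)

lemma bfs_self [simp]: "bfs E s s = 0"
  using bfs_le[where n = 0 and s = s and x = s and E = E] by simp

lemma bfs_eq_0: "(s, x) \<in> E\<^sup>* \<Longrightarrow> bfs E s x = 0 \<longleftrightarrow> x = s"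
  using bfs_relpow[of s x E] by auto

lemma bfs_step: "(s, x) \<in> E\<^sup>* \<Longrightarrow> (x, y) \<in> E \<Longrightarrow> bfs E s y \<le> Suc (bfs E s x)"
  by (rule bfs_le) (use bfs_relpow in fastforce)

lemma shortest_path:
  assumes "(s, t) \<in> E\<^sup>*"
  obtains \<pi> where "\<pi> 0 = s" "\<pi> (bfs E s t) = t"
    "\<And>k. k < bfs E s t \<Longrightarrow> (\<pi> k, \<pi> (Suc k)) \<in> E"
    "\<And>k. k \<le> bfs E s t \<Longrightarrow> bfs E s (\<pi> k) = k"
    "\<And>k. k \<le> bfs E s t \<Longrightarrow> (s, \<pi> k) \<in> E\<^sup>*"
proof -
  let ?n = "bfs E s t"
  obtain \<pi> where \<pi>: "\<pi> 0 = s" "\<pi> ?n = t" "\<And>k. k < ?n \<Longrightarrow> (\<pi> k, \<pi> (Suc k)) \<in> E"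
    using bfs_relpow[OF assms] by (auto simp: relpow_fun_conv)
  have to: "(s, \<pi> k) \<in> E ^^ k" if "k \<le> ?n" for k
    unfolding relpow_fun_conv using \<pi> that by (intro exI[of _ \<pi>]) auto
  have "(\<pi> k, t) \<in> E ^^ (?n - k)" if "k \<le> ?n" for k
    unfolding relpow_fun_conv using \<pi> that by (intro exI[of _ "\<lambda>i. \<pi> (k + i)"]) auto
  \<comment> \<open>A shortest way to \<open>\<pi> k\<close> followed by the rest of the path leads
    from \<open>s\<close> to \<open>t\<close>, so together they take at least \<open>?n\<close>
    steps.\<close>
  then have "?n \<le> bfs E s (\<pi> k) + (?n - k)" if "k \<le> ?n" for k
    using that bfs_relpow[OF relpow_imp_rtrancl[OF to[OF that]]]
    by (intro bfs_le, unfold relpow_add, intro relcompI) auto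
  then have "bfs E s (\<pi> k) = k" if "k \<le> ?n" for k
    using that bfs_le[OF to[OF that]] by fastforce
  then show thesis using that \<pi> relpow_imp_rtrancl[OF to] by blast
qed

text \<open>The levels of a clique lie between the minimum and its successor, so injectivity leaves
  at most two vertices. With distances from the start of a shortest path as levels, this excludes
  triangles among the vertices of the path.\<close>

lemma no_triangle_if_levels:
  assumes "inj_on g S" "\<And>x y. (x, y) \<in> parcs G \<Longrightarrow> x \<in> S \<Longrightarrow> y \<in> S \<Longrightarrow> g y \<le> Suc (g x)"
  shows "\<not> triangle G S"
proof
  assume tri: "triangle G S"
  then have c: "clique G S" "card (g ` S) = 3" using assms(1) by (auto simp: triangle_def card_image)
  then have "finite (g ` S)" "g ` S \<noteq> {}" using card_ge_0_finite[of "g ` S"] by auto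
  then obtain x where x: "x \<in> S" "g x = Min (g ` S)" using Min_in[of "g ` S"] by (metis imageE)
  have "g y \<in> {g x, Suc (g x)}" if "y \<in> S" for y
  proof -
    have "g x \<le> g y" using x that \<open>finite (g ` S)\<close> by simp
    moreover have "x = y \<or> g y \<le> Suc (g x)"
      using c(1) x(1) that assms(2)[of x y] by (auto simp: clique_def)
    ultimately show ?thesis by auto
  qed
  then have "card (g ` S) \<le> card {g x, Suc (g x)}" by (intro card_mono) auto
  also have "\<dots> \<le> 2" by (simp add: card_insert_if)
  finally show False using c(2) by simp
qed

text \<open>Dirac's argument for minimal separators. If \<open>x\<close> and \<open>y\<close> were
  not adjacent, shortest paths between them through \<open>A\<close> and through \<open>B\<close>
  would form a cycle. As no edge joins \<open>A\<close> and \<open>B\<close>, a triangle on it would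
  lie on one of the two paths, which are shortest. So an induced cycle on at least 4 vertices would
  remain.\<close>

lemma chordal_separator_clique:
  assumes sym: "sym E" and irr: "irrefl E" and E: "E = parcs G" and ch: "chordal G"
    and sub: "A \<subseteq> pverts G" "B \<subseteq> pverts G" "x \<in> pverts G" "y \<in> pverts G"
    and disj: "A \<inter> B = {}" "x \<notin> A" "y \<notin> A" "x \<notin> B" "y \<notin> B" and xy: "x \<noteq> y"
    and noAB: "\<And>p q. p \<in> A \<Longrightarrow> q \<in> B \<Longrightarrow> (p, q) \<notin> E"
    and conA: "(x, y) \<in> (E \<inter> (A \<union> {x, y}) \<times> (A \<union> {x, y}))\<^sup>*"
    and conB: "(y, x) \<in> (E \<inter> (B \<union> {x, y}) \<times> (B \<union> {x, y}))\<^sup>*"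
  shows "(x, y) \<in> E"
proof (rule ccontr)
  assume nadj: "(x, y) \<notin> E"
  then have nadj': "(y, x) \<notin> E" using symD[OF sym] by blast
  define EA where "EA = E \<inter> (A \<union> {x, y}) \<times> (A \<union> {x, y})"
  define EB where "EB = E \<inter> (B \<union> {x, y}) \<times> (B \<union> {x, y})"
  define m where "m = bfs EA x y"
  define n where "n = bfs EB y x"
  obtain p where p: "p 0 = x" "p m = y" "\<And>k. k < m \<Longrightarrow> (p k, p (Suc k)) \<in> EA"
    "\<And>k. k \<le> m \<Longrightarrow> bfs EA x (p k) = k" "\<And>k. k \<le> m \<Longrightarrow> (x, p k) \<in> EA\<^sup>*"
    using shortest_path[OF conA] unfolding EA_def m_def by blast
  obtain q where q: "q 0 = y" "q n = x" "\<And>k. k < n \<Longrightarrow> (q k, q (Suc k)) \<in> EB"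
    "\<And>k. k \<le> n \<Longrightarrow> bfs EB y (q k) = k" "\<And>k. k \<le> n \<Longrightarrow> (y, q k) \<in> EB\<^sup>*"
    using shortest_path[OF conB] unfolding EB_def n_def by blast
  have m2: "m \<ge> 2"
  proof -
    have "m \<noteq> 0" using p(1,2) xy by metis
    moreover have "m \<noteq> 1" using p(1,2) p(3)[of 0] nadj by (auto simp: EA_def)
    ultimately show ?thesis by simp
  qed
  have n2: "n \<ge> 2"
  proof -
    have "n \<noteq> 0" using q(1,2) xy by metis
    moreover have "n \<noteq> 1" using q(1,2) q(3)[of 0] nadj' by (auto simp: EB_def)
    ultimately show ?thesis by simp
  qed
  have pA: "p k \<in> A" if "0 < k" "k < m" for k
  proof -
    have "p k \<noteq> x" "p k \<noteq> y" using p(1,2) p(4)[of k] p(4)[of 0] p(4)[of m] that by auto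
    then show ?thesis using p(3)[of k] that by (auto simp: EA_def)
  qed
  have qB: "q k \<in> B" if "0 < k" "k < n" for k
  proof -
    have "q k \<noteq> x" "q k \<noteq> y" using q(1,2) q(4)[of k] q(4)[of 0] q(4)[of n] that by auto
    then show ?thesis using q(3)[of k] that by (auto simp: EB_def)
  qed
  have pA': "p k \<in> insert x A" if "k < m" for k using pA[of k] that p(1) by (cases "k = 0") auto
  have qB': "q k \<in> insert y B" if "k < n" for k using qB[of k] that q(1) by (cases "k = 0") auto
  \<comment> \<open>The two paths are indexed by truth values: \<open>False\<close> is the way from
    \<open>x\<close> to \<open>y\<close>, \<open>True\<close> the way back.\<close>
  define \<pi> where "\<pi> = (\<lambda>b. if b then q else p)"
  define d where "d = (\<lambda>b. if b then n else m)"
  have cyc: "cyc_pairs [False, True] = {(False, True), (True, False)}"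
    by (auto simp: cyc_pairs_def)
  show False
  proof (rule has_induced_cycle_if_chain[of G "[False, True]" d \<pi>])
    show "sym (parcs G)" "irrefl (parcs G)" using sym irr E by auto
    show "(\<pi> v k, \<pi> v (Suc k)) \<in> parcs G" if "k < d v" for v k
      using p(3)[of k] q(3)[of k] that E by (auto simp: \<pi>_def d_def EA_def EB_def split: if_splits)
    show "\<pi> v (d v) = \<pi> w 0" if "(v, w) \<in> cyc_pairs [False, True]" for v w
      using that p(1,2) q(1,2) unfolding cyc by (auto simp: \<pi>_def d_def)
    show "\<pi> v k \<in> pverts G" if "k < d v" for v k
      using that pA'[of k] qB'[of k] sub by (auto simp: \<pi>_def d_def split: if_splits)
    show "v = w \<and> k = l" if "k < d v" "l < d w" "\<pi> v k = \<pi> w l" for v w k l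
    proof -
      have "p i \<noteq> q j" if "i < m" "j < n" for i j
      proof -
        have "insert x A \<inter> insert y B = {}" using disj xy by blast
        then show ?thesis using pA'[OF that(1)] qB'[OF that(2)] by (metis disjoint_iff)
      qed
      moreover have "i = j" if "i < m" "j < m" "p i = p j" for i j
        using p(4)[of i] p(4)[of j] that by (metis less_imp_le)
      moreover have "i = j" if "i < n" "j < n" "q i = q j" for i j
        using q(4)[of i] q(4)[of j] that by (metis less_imp_le)
      ultimately show ?thesis using that unfolding \<pi>_def d_def
        by (smt (verit, ccfv_threshold))
    qed
    show "\<not> S \<subseteq> {\<pi> v k | v k. v \<in> set [False, True] \<and> k < d v}" if tri: "triangle G S" for S
    proof
      assume S: "S \<subseteq> {\<pi> v k | v k. v \<in> set [False, True] \<and> k < d v}"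
      have adj: "(u, v) \<in> E" if "u \<in> S" "v \<in> S" "u \<noteq> v" for u v
        using tri that E by (auto simp: triangle_def clique_def)
      have S': "S \<subseteq> {p k | k. k < m} \<union> {q k | k. k < n}"
        using S by (auto simp: \<pi>_def d_def split: if_splits)
      show False
      proof (cases "S \<inter> A = {}")
        case False
        then have nB: "S \<inter> B = {}" using adj noAB disj(1) by blast
        \<comment> \<open>Of the other path only its start \<open>q 0 = y\<close> can lie in
          \<open>S\<close>, and this is the end \<open>p m\<close>.\<close>
        have "S \<subseteq> {p k | k. k \<le> m}"
        proof
          fix z assume z: "z \<in> S"
          then consider k where "k < m" "z = p k" | k where "k < n" "z = q k" using S' by auto
          then show "z \<in> {p k | k. k \<le> m}"
          proof cases
            case 2
            then have "k = 0" using qB[of k] nB z by auto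
            then show ?thesis using 2 p(2) q(1) by auto
          qed auto
        qed
        then have lev: "\<And>z. z \<in> S \<Longrightarrow> \<exists>k\<le>m. z = p k" by auto
        have "inj_on (bfs EA x) S"
          by (rule inj_onI) (metis lev p(4))
        moreover have "bfs EA x v \<le> Suc (bfs EA x u)" if "(u, v) \<in> parcs G" "u \<in> S" "v \<in> S" for u v
        proof (rule bfs_step)
          show "(x, u) \<in> EA\<^sup>*" using lev[OF that(2)] p(5) by auto
          have "w \<in> A \<union> {x, y}" if "w \<in> S" for w
            using lev[OF that] pA' p(2) by (metis UnCI UnI2 insertCI insertE le_neq_implies_less)
          then show "(u, v) \<in> EA" using that E by (auto simp: EA_def)
        qed
        ultimately show False using no_triangle_if_levels tri by blast
      next
        case True
        have "S \<subseteq> {q k | k. k \<le> n}"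
        proof
          fix z assume z: "z \<in> S"
          then consider k where "k < n" "z = q k" | k where "k < m" "z = p k" using S' by auto
          then show "z \<in> {q k | k. k \<le> n}"
          proof cases
            case 2
            then have "k = 0" using pA[of k] True z by auto
            then show ?thesis using 2 q(2) p(1) by auto
          qed auto
        qed
        then have lev: "\<And>z. z \<in> S \<Longrightarrow> \<exists>k\<le>n. z = q k" by auto
        have "inj_on (bfs EB y) S"
          by (rule inj_onI) (metis lev q(4))
        moreover have "bfs EB y v \<le> Suc (bfs EB y u)" if "(u, v) \<in> parcs G" "u \<in> S" "v \<in> S" for u v
        proof (rule bfs_step)
          show "(y, u) \<in> EB\<^sup>*" using lev[OF that(2)] q(5) by auto
          have "w \<in> B \<union> {x, y}" if "w \<in> S" for w
            using lev[OF that] qB' q(2) by (metis UnCI UnI2 insertCI insertE le_neq_implies_less)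
          then show "(u, v) \<in> EB" using that E by (auto simp: EB_def)
        qed
        ultimately show False using no_triangle_if_levels tri by blast
      qed
    qed
    show False if "4 \<le> l" "has_induced_cycle G l" for l
      using ch that by (auto simp: chordal_def)
    show "distinct [False, True]" "[False, True] \<noteq> []" by auto
    show "\<forall>v\<in>set [False, True]. 0 < d v" "3 \<le> sum_list (map d [False, True])"
      using m2 n2 by (auto simp: d_def)
  qed
qed

text \<open>The theorem of Grone, Johnson, Sa and Wolkowicz. A minimal separator of two nonadjacent
  vertices is a clique, so completions of the two sides agree on it and can be glued. The induction
  runs over vertex sets \<open>U\<close> of a fixed graph, so that chordality of \<open>G\<close>
  can be used as it stands.\<close>

theorem chordal_psd_completion:
  assumes sym: "sym (parcs G)" and irr: "irrefl (parcs G)" and ch: "chordal G"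
    and "finite U" "U \<subseteq> pverts G" and "\<And>S. S \<subseteq> U \<Longrightarrow> clique G S \<Longrightarrow> psd_on S X"
  obtains M where "psd_on U M"
    "\<And>i j. i \<in> U \<Longrightarrow> j \<in> U \<Longrightarrow> i = j \<or> (i, j) \<in> parcs G \<Longrightarrow> M i j = X i j"
proof -
  let ?E = "parcs G"
  have "\<exists>M. psd_on U M \<and> (\<forall>i\<in>U. \<forall>j\<in>U. i = j \<or> (i, j) \<in> ?E \<longrightarrow> M i j = X i j)"
    using assms(4-6)
  proof (induction "card U" arbitrary: U rule: less_induct)
    case less
    show ?case
    proof (cases "clique G U")
      case True
      then show ?thesis using less.prems by blast
    next
      case False
      then obtain a b where ab: "a \<in> U" "b \<in> U" "a \<noteq> b" "(a, b) \<notin> ?E"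
        using less.prems(2) by (auto simp: clique_def)
      define R where "R S = (?E \<inter> (U - S) \<times> (U - S))\<^sup>*" for S
      define sep where "sep S \<longleftrightarrow> S \<subseteq> U - {a, b} \<and> (a, b) \<notin> R S" for S
      have Rsym: "(v, u) \<in> R S" if "(u, v) \<in> R S" for u v S
      proof -
        have "sym (?E \<inter> (U - S) \<times> (U - S))" using sym by (auto simp: sym_def)
        then show ?thesis using that sym_rtrancl unfolding R_def by (metis symD)
      qed
      have "sep (U - {a, b})"
      proof -
        have "?E \<inter> (U - (U - {a, b})) \<times> (U - (U - {a, b})) = {}"
          using ab irr symD[OF sym, of b a] by (auto simp: irrefl_def)
        then show ?thesis using ab(3) unfolding sep_def R_def by auto
      qed
      then obtain S where S: "sep S" and min: "\<And>S'. sep S' \<Longrightarrow> card S \<le> card S'"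
        using ex_has_least_nat[of sep "U - {a, b}" card] by blast
      have finS: "finite S" and SU: "S \<subseteq> U" "a \<notin> S" "b \<notin> S"
        using S less.prems(1) by (auto simp: sep_def intro: finite_subset)
      define A where "A = {x. (a, x) \<in> R S}"
      define B where "B = {x. (b, x) \<in> R S}"
      have comp: "{x. (c, x) \<in> R S} \<subseteq> U - S" if "c \<in> U - S" for c
      proof
        fix x assume "x \<in> {x. (c, x) \<in> R S}"
        then have "(c, x) \<in> R S" by simp
        then show "x \<in> U - S" unfolding R_def using that by (induction rule: rtrancl_induct) auto
      qed
      have AU: "A \<subseteq> U - S" "B \<subseteq> U - S" using comp[of a] comp[of b] ab SU by (auto simp: A_def B_def)
      have clos: "(c, z) \<in> R S" if "(c, y) \<in> R S" "(y, z) \<in> ?E" "y \<in> U - S" "z \<in> U - S" for c y z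
        using that unfolding R_def by (auto intro: rtrancl_into_rtrancl)
      have bA: "b \<notin> A" using S by (auto simp: A_def sep_def)
      have disj: "A \<inter> B = {}"
      proof -
        have False if "(a, z) \<in> R S" "(b, z) \<in> R S" for z
          using that Rsym[OF that(2)] S unfolding sep_def R_def by (meson rtrancl_trans)
        then show ?thesis by (auto simp: A_def B_def)
      qed
      have noAB: "(p, q) \<notin> ?E" if "p \<in> A" "q \<in> B" for p q
        using clos[of a p q] that AU disj by (auto simp: A_def)
      \<comment> \<open>Minimality of \<open>S\<close>: if the side of \<open>c\<close> had no edge
        to \<open>x\<close>, then \<open>S - {x}\<close> would still separate \<open>a\<close> from
        \<open>b\<close>.\<close>
      have nb: "\<exists>y. (c, y) \<in> R S \<and> (y, x) \<in> ?E"
        if x: "x \<in> S" and c: "c = a \<and> c' = b \<or> c = b \<and> c' = a" for x c c'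
      proof (rule ccontr)
        assume no: "\<nexists>y. (c, y) \<in> R S \<and> (y, x) \<in> ?E"
        have "card (S - {x}) < card S" using card_Diff1_less[OF finS x] .
        then have "\<not> sep (S - {x})" using min[of "S - {x}"] by linarith
        then have "(a, b) \<in> R (S - {x})" using S by (auto simp: sep_def)
        then have "(c, c') \<in> R (S - {x})" using c Rsym by auto
        then have "(c, c') \<in> R S"
          unfolding R_def[of "S - {x}"]
        proof (induction rule: rtrancl_induct)
          case base then show ?case by (simp add: R_def)
        next
          case (step y z)
          then have "z \<noteq> x" using no by auto
          moreover have "y \<in> U - S" using comp[of c] step(3) c ab SU by auto
          ultimately show ?case using clos[of c y z] step by auto
        qed
        then show False using c S Rsym by (auto simp: sep_def)
      qed
      have inC: "(c, z) \<in> (?E \<inter> (C \<union> W) \<times> (C \<union> W))\<^sup>*"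
        if C: "C = {x. (c, x) \<in> R S}" and "(c, z) \<in> R S" for c z C W
        using that(2) unfolding R_def
      proof (induction rule: rtrancl_induct)
        case (step y z)
        then have "y \<in> C" "z \<in> C" unfolding C R_def by (auto intro: rtrancl_into_rtrancl)
        then show ?case using step by (auto intro: rtrancl_into_rtrancl)
      qed simp
      have con: "(x, y) \<in> (?E \<inter> (C \<union> {x, y}) \<times> (C \<union> {x, y}))\<^sup>*"
        if C: "C = {x. (c, x) \<in> R S}" and xy: "x \<in> S" "y \<in> S" and c: "c = a \<or> c = b" for c C x y
      proof -
        let ?F = "?E \<inter> (C \<union> {x, y}) \<times> (C \<union> {x, y})"
        have sF: "sym ?F" using sym by (auto simp: sym_def)
        obtain p where p: "(c, p) \<in> R S" "(p, x) \<in> ?E" using nb[OF xy(1)] c by blast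
        obtain q where q: "(c, q) \<in> R S" "(q, y) \<in> ?E" using nb[OF xy(2)] c by blast
        have "(p, x) \<in> ?F" using p C by simp
        then have cx: "(c, x) \<in> ?F\<^sup>*"
          using inC[OF C p(1), of "{x, y}"] by (rule rtrancl_into_rtrancl[rotated])
        have "(q, y) \<in> ?F" using q C by simp
        then have "(c, y) \<in> ?F\<^sup>*"
          using inC[OF C q(1), of "{x, y}"] by (rule rtrancl_into_rtrancl[rotated])
        with symD[OF sym_rtrancl[OF sF] cx] show ?thesis by (rule rtrancl_trans)
      qed
      have clS: "clique G S"
        unfolding clique_def
      proof (intro conjI ballI impI)
        show "S \<subseteq> pverts G" using SU less.prems(2) by auto
        fix x y assume xy: "x \<in> S" "y \<in> S" "x \<noteq> y"
        show "(x, y) \<in> ?E"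
        proof (rule chordal_separator_clique[OF sym irr HOL.refl ch, of A B])
          show "A \<subseteq> pverts G" "B \<subseteq> pverts G" "x \<in> pverts G" "y \<in> pverts G"
            using AU SU xy less.prems(2) by auto
          show "A \<inter> B = {}" "x \<notin> A" "y \<notin> A" "x \<notin> B" "y \<notin> B" "x \<noteq> y" using disj AU xy by auto
          show "(p, q) \<notin> ?E" if "p \<in> A" "q \<in> B" for p q using noAB that .
          show "(x, y) \<in> (?E \<inter> (A \<union> {x, y}) \<times> (A \<union> {x, y}))\<^sup>*" using con[OF A_def xy(1,2)] by simp
          show "(y, x) \<in> (?E \<inter> (B \<union> {x, y}) \<times> (B \<union> {x, y}))\<^sup>*"
            using con[OF B_def xy(2,1)] by (simp add: insert_commute)
        qed
      qed
      have aA: "a \<in> A" by (simp add: A_def R_def)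
      have ex: "\<exists>M. psd_on W M \<and> (\<forall>i\<in>W. \<forall>j\<in>W. i = j \<or> (i, j) \<in> ?E \<longrightarrow> M i j = X i j)"
        if "W \<subset> U" for W
      proof (rule less.hyps)
        show "card W < card U" by (rule psubset_card_mono[OF less.prems(1) that])
        have "W \<subseteq> U" using that by simp
        then show "finite W" "W \<subseteq> pverts G" using less.prems(1,2) by (auto intro: finite_subset)
        show "psd_on S X" if "S \<subseteq> W" "clique G S" for S
          using less.prems(3) that \<open>W \<subseteq> U\<close> by simp
      qed
      obtain M1 where M1: "psd_on (A \<union> S) M1"
        "\<And>i j. i \<in> A \<union> S \<Longrightarrow> j \<in> A \<union> S \<Longrightarrow> i = j \<or> (i, j) \<in> ?E \<Longrightarrow> M1 i j = X i j"
        using ex[of "A \<union> S"] AU SU ab(2) bA by blast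
      obtain M2 where M2: "psd_on (U - A) M2"
        "\<And>i j. i \<in> U - A \<Longrightarrow> j \<in> U - A \<Longrightarrow> i = j \<or> (i, j) \<in> ?E \<Longrightarrow> M2 i j = X i j"
        using ex[of "U - A"] ab(1) aA by blast
      have "A \<union> S \<subseteq> U" using AU SU by auto
      then have fin: "finite (A \<union> S)" "finite (U - A)" using less.prems(1) by (auto intro: finite_subset)
      \<comment> \<open>The overlap is \<open>S\<close>; as it is a clique, all its entries are
        prescribed by \<open>X\<close>.\<close>
      have agree: "M1 i j = M2 i j" if "i \<in> (A \<union> S) \<inter> (U - A)" "j \<in> (A \<union> S) \<inter> (U - A)" for i j
      proof -
        have "i \<in> S" "j \<in> S" using that by auto
        then have "i = j \<or> (i, j) \<in> ?E" using clS by (auto simp: clique_def)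
        then show ?thesis using M1(2)[of i j] M2(2)[of i j] that by auto
      qed
      obtain M where M: "psd_on ((A \<union> S) \<union> (U - A)) M"
        "\<And>i j. i \<in> A \<union> S \<Longrightarrow> j \<in> A \<union> S \<Longrightarrow> M i j = M1 i j"
        "\<And>i j. i \<in> U - A \<Longrightarrow> j \<in> U - A \<Longrightarrow> M i j = M2 i j"
        using psd_on_glue[OF fin M1(1) M2(1) agree] by blast
      have U: "(A \<union> S) \<union> (U - A) = U" using AU SU by auto
      have AS: "j \<in> A \<union> S" if "i \<in> A" "j \<in> U" "(i, j) \<in> ?E" for i j
        using clos[of a i j] that AU by (auto simp: A_def)
      have "M i j = X i j" if ij: "i \<in> U" "j \<in> U" "i = j \<or> (i, j) \<in> ?E" for i j
      proof (cases "i \<in> A \<or> j \<in> A")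
        case True
        then have "i \<in> A \<union> S \<and> j \<in> A \<union> S" using AS[of i j] AS[of j i] ij symD[OF sym] by blast
        then show ?thesis using M(2) M1(2) ij by simp
      next
        case False
        then show ?thesis using M(3) M2(2) ij by simp
      qed
      then show ?thesis using M(1) U by auto
    qed
  qed
  then show thesis using that by blast
qed

section \<open>Collapsing layers and cycle bounds\<close>

text \<open>The matrix is \<open>P M P^T\<close>, where row \<open>i\<close> of \<open>P\<close> has
  the single entry \<open>u i\<close> in column \<open>f i\<close>; the map \<open>f\<close> may
  identify indices.\<close>

lemma psd_on_congruence:
  assumes "finite B" "psd_on (f ` B) M"
  shows "psd_on B (\<lambda>i j. u i * M (f i) (f j) * u j)" (is "psd_on B ?N")
proof (rule psd_onI)
  show "?N i j = ?N j i" if "i \<in> B" "j \<in> B" for i j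
    using psd_on_sym[OF assms(2), of "f i" "f j"] that by simp
  fix v :: "'a \<Rightarrow> real"
  define V where "V k = (\<Sum>i\<in>{i \<in> B. f i = k}. v i * u i)" for k
  have inner: "(\<Sum>j\<in>B. g (f j) * (v j * u j)) = (\<Sum>l\<in>f ` B. g l * V l)" for g
    unfolding V_def sum_distrib_left
    by (subst sum.image_gen[OF assms(1), of _ f]) (auto intro!: sum.cong)
  have "bform B ?N v v = (\<Sum>i\<in>B. (\<Sum>j\<in>B. M (f i) (f j) * (v j * u j)) * (v i * u i))"
    by (simp add: bform_def sum_distrib_right sum_distrib_left mult_ac)
  also have "\<dots> = (\<Sum>i\<in>B. (\<Sum>l\<in>f ` B. M (f i) l * V l) * (v i * u i))"
    by (simp add: inner)
  also have "\<dots> = (\<Sum>k\<in>f ` B. (\<Sum>l\<in>f ` B. M k l * V l) * V k)"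
    by (rule inner)
  also have "\<dots> = bform (f ` B) M V V"
    by (simp add: bform_def sum_distrib_right sum_distrib_left mult_ac)
  finally show "bform B ?N v v \<ge> 0" using psd_on_bform[OF assms(2)] by simp
qed

lemma psd_on_reindex:
  assumes "finite B" "psd_on U M" "f ` B \<subseteq> U" "finite U"
  shows "psd_on B (\<lambda>i j. M (f i) (f j))"
  using psd_on_congruence[OF assms(1) psd_on_subset[OF assms(4,3,2)], of "\<lambda>_. 1"] by simp

text \<open>This is \<open>I - P P^T\<close> for the \<open>P\<close> of
  \<open>psd_on_congruence\<close>: its columns have disjoint supports and norm at most 1. In the
  collapse of layers it turns a shift of the small matrix by a multiple of the identity into the
  same shift of the large one.\<close>

lemma psd_on_id_minus_fibres:
  assumes "finite B" and u: "\<And>k. (\<Sum>i\<in>{i \<in> B. f i = k}. (u i)\<^sup>2) \<le> 1"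
  shows "psd_on B (\<lambda>i j. (if i = j then 1 else 0) - (if f i = f j then u i * u j else 0 :: real))"
    (is "psd_on B ?N")
proof (rule psd_onI)
  show "?N i j = ?N j i" for i j by simp
  fix v :: "'a \<Rightarrow> real"
  define V where "V k = (\<Sum>i\<in>{i \<in> B. f i = k}. v i * u i)" for k
  have fib: "(\<Sum>j\<in>B. if f i = f j then u i * u j * v j else 0) = u i * V (f i)" for i
  proof -
    have "(\<Sum>j\<in>B. if f i = f j then u i * u j * v j else 0)
        = (\<Sum>j\<in>{j \<in> B. f j = f i}. u i * u j * v j)"
      using assms(1) by (intro sum.mono_neutral_cong_right) auto
    then show ?thesis by (simp add: V_def sum_distrib_left mult_ac)
  qed
  have "bform B ?N v v = bform B (\<lambda>i j. if i = j then 1 else 0) v v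
      - (\<Sum>i\<in>B. v i * (\<Sum>j\<in>B. if f i = f j then u i * u j * v j else 0))"
    unfolding bform_def sum_subtractf[symmetric] sum_distrib_left
    by (intro sum.cong HOL.refl) (auto simp: algebra_simps)
  also have "\<dots> = (\<Sum>i\<in>B. (v i)\<^sup>2) - (\<Sum>i\<in>B. v i * (u i * V (f i)))"
    by (simp add: bform_diag[OF assms(1)] fib power2_eq_square)
  also have "\<dots> = (\<Sum>k\<in>f ` B. (\<Sum>i\<in>{i \<in> B. f i = k}. (v i)\<^sup>2) - (V k)\<^sup>2)"
  proof -
    have "(\<Sum>i\<in>B. v i * (u i * V (f i))) = (\<Sum>k\<in>f ` B. (V k)\<^sup>2)"
      by (subst sum.image_gen[OF assms(1), of _ f])
        (auto intro!: sum.cong simp: V_def power2_eq_square sum_distrib_right mult_ac)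
    moreover have "(\<Sum>i\<in>B. (v i)\<^sup>2) = (\<Sum>k\<in>f ` B. \<Sum>i\<in>{i \<in> B. f i = k}. (v i)\<^sup>2)"
      by (rule sum.image_gen[OF assms(1)])
    ultimately show ?thesis by (simp add: sum_subtractf)
  qed
  also have "\<dots> \<ge> 0"
  proof (rule sum_nonneg)
    fix k
    have "(V k)\<^sup>2 \<le> (\<Sum>i\<in>{i \<in> B. f i = k}. (v i)\<^sup>2) * (\<Sum>i\<in>{i \<in> B. f i = k}. (u i)\<^sup>2)"
      unfolding V_def by (rule Cauchy_Schwarz_ineq_sum)
    also have "\<dots> \<le> (\<Sum>i\<in>{i \<in> B. f i = k}. (v i)\<^sup>2) * 1"
      by (intro mult_left_mono u sum_nonneg) auto
    finally show "0 \<le> (\<Sum>i\<in>{i \<in> B. f i = k}. (v i)\<^sup>2) - (V k)\<^sup>2" by simp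
  qed
  finally show "bform B ?N v v \<ge> 0" .
qed

text \<open>The outer layers are the single terminals and edges join equal or consecutive layers, so
  the quotient by \<open>f\<close> is a path. For \<open>d = 1\<close> there is no room for vertices
  other than the terminals; uses of the notion therefore offer \<open>d = 1\<close> as an
  alternative.\<close>

definition layering :: "'b set \<Rightarrow> ('b \<times> 'b) set \<Rightarrow> 'b \<Rightarrow> 'b \<Rightarrow> ('b \<Rightarrow> nat) \<Rightarrow> nat \<Rightarrow> bool" where
  "layering B A s t f d \<longleftrightarrow> (\<forall>i\<in>B. f i \<le> d \<and> (f i = 0 \<longleftrightarrow> i = s) \<and> (f i = d \<longleftrightarrow> i = t)) \<and>
     (\<forall>i\<in>B. \<forall>j\<in>B. (i, j) \<in> A \<longrightarrow> f i \<le> Suc (f j) \<and> f j \<le> Suc (f i))"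

text \<open>Inner layers are represented by their Euclidean norm, so the sum of squares is kept. At
  the terminals the signed value of \<open>y\<close> is kept, so that pulling back leaves these two
  coordinates unchanged.\<close>

definition layer_entry ::
  "'b set \<Rightarrow> 'b \<Rightarrow> 'b \<Rightarrow> ('b \<Rightarrow> nat) \<Rightarrow> nat \<Rightarrow> ('b \<Rightarrow> real) \<Rightarrow> nat \<Rightarrow> real" where
  "layer_entry B s t f d y k =
     (if k = 0 then y s else if k = d then y t else sqrt (\<Sum>i\<in>{i \<in> B. f i = k}. (y i)\<^sup>2))"

text \<open>A completion of the path data obtained by collapsing the layers of a rank one matrix pulls
  back to a completion of the matrix itself; when \<open>d = 1\<close> nothing has to be collapsed.\<close>

lemma psd_on_uncollapse:
  assumes fin: "finite B" and st: "s \<in> B" "t \<in> B" "s \<noteq> t" and d: "d > 0"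
    and lay: "d = 1 \<or> layering B A s t f d" and \<eta>: "\<eta> \<ge> 0"
    and M: "psd_on {0..d} M" "\<And>k. k \<le> d \<Longrightarrow> M k k = (layer_entry B s t f d y k)\<^sup>2 + \<eta>"
      "\<And>k. k < d \<Longrightarrow> M k (Suc k) = layer_entry B s t f d y k * layer_entry B s t f d y (Suc k)"
  obtains K where "psd_on B K" "K s t = M 0 d"
    "\<And>i j. i \<in> B \<Longrightarrow> j \<in> B \<Longrightarrow> i = j \<or> (i, j) \<in> A \<Longrightarrow> K i j = y i * y j + (if i = j then \<eta> else 0)"
proof (cases "d = 1")
  case True
  let ?K = "\<lambda>i j. y i * y j + (if i = j then \<eta> else 0)"
  have "psd_on B ?K" using psd_on_add_diag[OF fin psd_on_rank1[of B y], of "\<lambda>_. \<eta>"] \<eta> by simp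
  moreover have "?K s t = M 0 d" using M(3)[of 0] True st by (simp add: layer_entry_def)
  ultimately show thesis using that by blast
next
  case False
  then have lay: "layering B A s t f d" using lay by simp
  let ?x = "layer_entry B s t f d y"
  \<comment> \<open>The coordinates of \<open>y\<close> relative to the layer norms, so that
    \<open>u i * ?x (f i) = y i\<close>. On a layer where \<open>y\<close> vanishes, division by
    zero gives 0, which is right.\<close>
  define u where "u i = (if i = s \<or> i = t then 1 else y i / ?x (f i))" for i
  have f: "f i \<le> d" "f i = 0 \<longleftrightarrow> i = s" "f i = d \<longleftrightarrow> i = t" if "i \<in> B" for i
    using lay that by (auto simp: layering_def)
  have xk: "(?x k)\<^sup>2 = (\<Sum>i\<in>{i \<in> B. f i = k}. (y i)\<^sup>2)" if "k \<noteq> 0" "k \<noteq> d" for k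
    using that by (auto simp: layer_entry_def intro!: real_sqrt_pow2 sum_nonneg)
  have ux: "u i * ?x (f i) = y i" if "i \<in> B" for i
  proof (cases "i = s \<or> i = t")
    case True
    then show ?thesis using f[OF that] d by (auto simp: u_def layer_entry_def)
  next
    case False
    then have k: "f i \<noteq> 0" "f i \<noteq> d" using f[OF that] by auto
    have "y i = 0" if "?x (f i) = 0"
    proof -
      have "(\<Sum>j\<in>{j \<in> B. f j = f i}. (y j)\<^sup>2) = 0" using xk[OF k] that by simp
      then have "(y i)\<^sup>2 = 0"
        using \<open>i \<in> B\<close> fin by (subst (asm) sum_nonneg_eq_0_iff) auto
      then show ?thesis by simp
    qed
    then show ?thesis using False by (auto simp: u_def)
  qed
  have usum: "(\<Sum>i\<in>{i \<in> B. f i = k}. (u i)\<^sup>2) \<le> 1" for k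
  proof -
    consider "k = 0" | "k = d" | "k \<noteq> 0" "k \<noteq> d" by blast
    then show ?thesis
    proof cases
      case 1
      then have "{i \<in> B. f i = k} = {s}" using f st by auto
      then show ?thesis by (simp add: u_def)
    next
      case 2
      then have "{i \<in> B. f i = k} = {t}" using f st by auto
      then show ?thesis by (simp add: u_def)
    next
      case 3
      have "(\<Sum>i\<in>{i \<in> B. f i = k}. (u i)\<^sup>2) = (\<Sum>i\<in>{i \<in> B. f i = k}. (y i)\<^sup>2 / (?x k)\<^sup>2)"
      proof (intro sum.cong HOL.refl)
        fix i assume i: "i \<in> {i \<in> B. f i = k}"
        then have "i \<noteq> s" "i \<noteq> t" using f[of i] 3 by auto
        then show "(u i)\<^sup>2 = (y i)\<^sup>2 / (?x k)\<^sup>2" using i by (simp add: u_def power_divide)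
      qed
      also have "\<dots> = (?x k)\<^sup>2 / (?x k)\<^sup>2" by (simp only: sum_divide_distrib[symmetric] xk[OF 3])
      also have "\<dots> \<le> 1" by simp
      finally show ?thesis .
    qed
  qed
  \<comment> \<open>With the matrix \<open>P\<close> that has entry \<open>u i\<close> in column
    \<open>f i\<close>, this is \<open>P M P^T + \<eta> (I - P P^T)\<close>. Within a layer, the
    \<open>\<eta>\<close> on the diagonal of \<open>M\<close> contributes
    \<open>\<eta> P P^T\<close>, and the second summand completes this to
    \<open>\<eta> I\<close>.\<close>
  define K where "K i j = u i * M (f i) (f j) * u j
    + \<eta> * ((if i = j then 1 else 0) - (if f i = f j then u i * u j else 0))" for i j
  have "f ` B \<subseteq> {0..d}" using f by auto
  then have "psd_on (f ` B) M" using psd_on_subset[OF _ _ M(1)] by auto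
  then have "psd_on B K" unfolding K_def
    by (intro psd_on_add psd_on_scale psd_on_congruence psd_on_id_minus_fibres fin usum \<eta>)
  moreover have "K s t = M 0 d"
    using f[OF st(1)] f[OF st(2)] st d by (auto simp: K_def u_def)
  moreover have "K i j = y i * y j + (if i = j then \<eta> else 0)"
    if ij: "i \<in> B" "j \<in> B" "i = j \<or> (i, j) \<in> A" for i j
  proof -
    have "f i \<le> Suc (f j)" "f j \<le> Suc (f i)" using ij lay by (auto simp: layering_def)
    then consider "f i = f j" | "f j = Suc (f i)" | "f i = Suc (f j)" by linarith
    then show ?thesis
    proof cases
      case 1
      have "K i j = (u i * ?x (f i)) * (u j * ?x (f j)) + (if i = j then \<eta> else 0)"
        using M(2)[of "f j"] f[OF ij(2)] 1 by (simp add: K_def power2_eq_square algebra_simps)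
      then show ?thesis using ux ij by simp
    next
      case 2
      then have "K i j = (u i * ?x (f i)) * (u j * ?x (f j))" "i \<noteq> j"
        using M(3)[of "f i"] f[OF ij(2)] by (auto simp: K_def)
      then show ?thesis using ux ij by simp
    next
      case 3
      have "M (f i) (f j) = M (f j) (f i)"
        using psd_on_sym[OF M(1)] f[OF ij(1)] f[OF ij(2)] by auto
      then have "K i j = (u i * ?x (f i)) * (u j * ?x (f j))" "i \<noteq> j"
        using M(3)[of "f j"] f[OF ij(1)] 3 by (auto simp: K_def)
      then show ?thesis using ux ij by simp
    qed
  qed
  ultimately show thesis using that by blast
qed

lemma psd_on_zero_row:
  assumes "finite B" "psd_on B R" "s \<in> B" "R s s = 0" "i \<in> B"
  shows "R i s = 0" "R s i = 0"
  using psd_on_minor[OF assms(1,2,5,3)] psd_on_minor[OF assms(1,2,3,5)] assms(4) by auto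

text \<open>The degenerate case: with zero diagonal at \<open>s\<close> there is no correlation
  between the terminals, and the Schur complement at \<open>t\<close> alone splits off everything on
  the terminal diagonal.\<close>

lemma psd_on_split_one:
  assumes fin: "finite B" and st: "s \<in> B" "t \<in> B" and M: "psd_on B M" and 0: "M s s = 0"
  obtains y R where "psd_on B R" "R s s = 0" "R t t = 0" "(y s)\<^sup>2 = M s s" "(y t)\<^sup>2 = M t t"
    "\<And>i j. M i j = y i * y j + R i j"
proof -
  define y where "y i = M i t / sqrt (M t t)" for i
  define R where "R i j = M i j - y i * y j" for i j
  have tt: "M t t \<ge> 0" using psd_on_diag_nonneg[OF fin M st(2)] .
  let ?e = "\<lambda>i. if i = t then 1 else 0 :: real"
  have "psd_on B (\<lambda>i j. M i j - M i t * M j t / bform B M ?e ?e)"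
    using fin st by (intro psd_on_schur[OF M]) (auto simp: if_distrib cong: if_cong)
  moreover have "M i t * M j t / bform B M ?e ?e = y i * y j" for i j
    using bform_indicator[OF fin st(2) st(2), of M 1 1] tt by (simp add: y_def)
  ultimately have "psd_on B R" by (simp add: R_def[abs_def])
  moreover have ys: "y s = 0" using psd_on_zero_row[OF fin M st(1) 0 st(2)] by (simp add: y_def)
  moreover have yt: "y t * y t = M t t" using tt by (simp add: y_def)
  ultimately show thesis using 0 by (intro that[of R y]) (auto simp: R_def power2_eq_square)
qed

text \<open>Split off the two rank one matrices which restrict to \<open>{s, t}\<close> with the diagonal of \<open>M\<close>
  and entry \<open>\<plusminus> sqrt (M s s * M t t)\<close>; their weights are \<open>(1 \<plusminus> c) / 2\<close> for the correlation \<open>c\<close>.\<close>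

lemma psd_on_split:
  assumes fin: "finite B" and st: "s \<in> B" "t \<in> B" "s \<noteq> t" and M: "psd_on B M"
  obtains p q y z R where "p \<ge> 0" "q \<ge> 0" "p + q = 1" "psd_on B R" "R s s = 0" "R t t = 0"
    "(y s)\<^sup>2 = M s s" "(y t)\<^sup>2 = M t t" "(z s)\<^sup>2 = M s s" "(z t)\<^sup>2 = M t t"
    "\<And>i j. M i j = p * (y i * y j) + q * (z i * z j) + R i j"
proof (cases "M s s = 0 \<or> M t t = 0")
  case True
  then obtain y R where "psd_on B R" "R s s = 0" "R t t = 0" "(y s)\<^sup>2 = M s s" "(y t)\<^sup>2 = M t t"
    "\<And>i j. M i j = y i * y j + R i j"
    using psd_on_split_one[OF fin st(1,2) M] psd_on_split_one[OF fin st(2,1) M] by metis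
  then show thesis by (intro that[of 1 0 R y y]) auto
next
  case False
  then have pos: "M s s > 0" "M t t > 0"
    using psd_on_diag_nonneg[OF fin M] st by (metis less_eq_real_def)+
  define a where "a = sqrt (M s s)"
  define b where "b = sqrt (M t t)"
  have ab: "a > 0" "b > 0" "a * a = M s s" "b * b = M t t" using pos by (auto simp: a_def b_def)
  define c where "c = M s t / (a * b)"
  have cab: "M s t = c * a * b" "M t s = c * a * b"
    using ab psd_on_sym[OF M st(1,2)] by (auto simp: c_def)
  have "c\<^sup>2 \<le> 1"
  proof -
    have "(M s t)\<^sup>2 \<le> M s s * M t t" by (rule psd_on_minor[OF fin M st(1,2)])
    then have "c\<^sup>2 * (a * b)\<^sup>2 \<le> 1 * (a * b)\<^sup>2"
      unfolding cab ab(3,4)[symmetric] by (simp add: power2_eq_square mult_ac)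
    then show ?thesis using ab(1,2) by (simp only: mult_le_cancel_right) simp
  qed
  then have c1: "\<bar>c\<bar> \<le> 1" by (simp add: abs_square_le_1)
  \<comment> \<open>\<open>w \<sigma>\<close> is \<open>e_s / a + \<sigma> * e_t / b\<close>, and
    \<open>u \<sigma>\<close> below is its image under \<open>M\<close>. For \<open>\<sigma>\<close>
    equal to 1 or -1, this image restricts to \<open>s\<close>, \<open>t\<close> as
    \<open>1 + \<sigma> * c\<close> times the vector \<open>(a, \<sigma> * b)\<close>.\<close>
  define w where "w \<sigma> i = (if i = s then 1 / a else if i = t then \<sigma> / b else 0)" for \<sigma> :: real and i
  define u where "u \<sigma> i = M i s / a + \<sigma> * M i t / b" for \<sigma> :: real and i
  have sumw: "(\<Sum>j\<in>B. g j * w \<sigma> j) = g s / a + \<sigma> * g t / b" for g \<sigma>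
  proof -
    have "(\<Sum>j\<in>B. g j * w \<sigma> j) = (\<Sum>j\<in>{s, t}. g j * w \<sigma> j)"
      by (rule sum.mono_neutral_right) (use fin st in \<open>auto simp: w_def\<close>)
    then show ?thesis using st(3) by (simp add: w_def)
  qed
  have bw: "bform B N (w \<sigma>) (w \<sigma>) = N s s / (a * a) + \<sigma> * N s t / (a * b) + \<sigma> * N t s / (a * b)
      + \<sigma> * \<sigma> * N t t / (b * b)" for N \<sigma>
  proof -
    have "bform B N (w \<sigma>) (w \<sigma>) = (\<Sum>i\<in>B. (\<Sum>j\<in>B. N i j * w \<sigma> j) * w \<sigma> i)"
      by (simp add: bform_def sum_distrib_left sum_distrib_right mult_ac)
    also have "\<dots> = (N s s / a + \<sigma> * N s t / b) / a + \<sigma> * (N t s / a + \<sigma> * N t t / b) / b"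
      unfolding sumw by simp
    finally show ?thesis by (simp add: add_divide_distrib algebra_simps)
  qed
  have us: "u \<sigma> s = a * (1 + \<sigma> * c)" for \<sigma>
    using ab cab by (simp add: u_def ab(3)[symmetric] algebra_simps)
  have ut: "u \<sigma> t = b * (c + \<sigma>)" for \<sigma>
    using ab cab by (simp add: u_def ab(4)[symmetric] algebra_simps)
  define R1 where "R1 i j = M i j - u 1 i * u 1 j / (2 + 2 * c)" for i j
  define R where "R i j = R1 i j - u (-1) i * u (-1) j / (2 - 2 * c)" for i j
  have "bform B M (w 1) (w 1) = 2 + 2 * c"
    unfolding bw using ab cab by (simp add: ab(3,4)[symmetric])
  moreover have "psd_on B (\<lambda>i j. M i j - u 1 i * u 1 j / bform B M (w 1) (w 1))"
    by (rule psd_on_schur[OF M]) (simp add: sumw u_def)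
  ultimately have R1: "psd_on B R1" by (simp add: R1_def[abs_def])
  \<comment> \<open>\<open>w 1\<close> and \<open>w (-1)\<close> are orthogonal for
    \<open>M\<close>, so the first complement leaves the image of \<open>w (-1)\<close> unchanged,
    and the second one can be taken with the same vector \<open>u (-1)\<close>.\<close>
  have z1: "u 1 s / a - u 1 t / b = 0" using us[of 1] ut[of 1] ab by simp
  have R1w: "R1 i s / a + (-1) * R1 i t / b = u (-1) i" for i
  proof -
    have "R1 i s / a + (-1) * R1 i t / b = u (-1) i - u 1 i / (2 + 2 * c) * (u 1 s / a - u 1 t / b)"
      by (simp add: R1_def u_def diff_divide_distrib right_diff_distrib)
    then show ?thesis using z1 by simp
  qed
  have "psd_on B (\<lambda>i j. R1 i j - u (-1) i * u (-1) j / bform B R1 (w (-1)) (w (-1)))"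
    by (rule psd_on_schur[OF R1]) (use sumw R1w in simp)
  moreover have "bform B R1 (w (-1)) (w (-1)) = 2 - 2 * c"
  proof -
    have "bform B R1 (w (-1)) (w (-1)) = (\<Sum>i\<in>B. (\<Sum>j\<in>B. R1 i j * w (-1) j) * w (-1) i)"
      by (simp add: bform_def sum_distrib_left sum_distrib_right mult_ac)
    also have "\<dots> = u (-1) s / a - u (-1) t / b" unfolding sumw R1w by simp
    also have "\<dots> = 2 - 2 * c" using us[of "-1"] ut[of "-1"] ab by simp
    finally show ?thesis .
  qed
  ultimately have "psd_on B R" by (simp add: R_def[abs_def])
  \<comment> \<open>For \<open>c = -1\<close> the weight \<open>(1 + c) / 2\<close> is 0, and any
    vector with the right squares at the terminals serves; likewise for \<open>z\<close> at
    \<open>c = 1\<close>.\<close>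
  define y where "y i = (if c = -1 then if i = s then a else if i = t then b else 0 else u 1 i / (1 + c))" for i
  define z where "z i = (if c = 1 then if i = s then a else if i = t then b else 0 else u (-1) i / (1 - c))" for i
  have gen: "x * w / (2 * e) = e / 2 * (x / e * (w / e))" if "e \<noteq> 0" for x w e :: real
    using that by (simp add: field_simps)
  have y: "u 1 i * u 1 j / (2 + 2 * c) = (1 + c) / 2 * (y i * y j)" for i j
    using gen[of "1 + c" "u 1 i" "u 1 j"] by (cases "c = -1") (simp_all add: y_def)
  have z: "u (-1) i * u (-1) j / (2 - 2 * c) = (1 - c) / 2 * (z i * z j)" for i j
    using gen[of "1 - c" "u (-1) i" "u (-1) j"] by (cases "c = 1") (simp_all add: z_def)
  have sq: "(y s)\<^sup>2 = M s s" "(y t)\<^sup>2 = M t t"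
  proof -
    have "y s = a" "y t = b" using us[of 1] ut[of 1] st(3) by (auto simp: y_def add.commute)
    then show "(y s)\<^sup>2 = M s s" "(y t)\<^sup>2 = M t t" using ab by (auto simp: power2_eq_square)
  qed
  have sq': "(z s)\<^sup>2 = M s s" "(z t)\<^sup>2 = M t t"
  proof -
    have "z s = a" "z t = b \<or> z t = - b"
      using us[of "-1"] ut[of "-1"] st(3) by (auto simp: z_def field_simps)
    then show "(z s)\<^sup>2 = M s s" "(z t)\<^sup>2 = M t t" using ab by (auto simp: power2_eq_square)
  qed
  have eq: "M i j = (1 + c) / 2 * (y i * y j) + (1 - c) / 2 * (z i * z j) + R i j" for i j
    using y[of i j] z[of i j] by (simp add: R_def R1_def)
  show thesis
  proof (rule that[OF _ _ _ \<open>psd_on B R\<close> _ _ sq sq' eq])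
    show "(1 + c) / 2 \<ge> 0" "(1 - c) / 2 \<ge> 0" "(1 + c) / 2 + (1 - c) / 2 = 1"
      using c1 by (auto simp: field_simps)
    show "R s s = 0" using eq[of s s] sq sq' by (simp add: power2_eq_square[symmetric] field_simps)
    show "R t t = 0" using eq[of t t] sq sq' by (simp add: power2_eq_square[symmetric] field_simps)
  qed
qed

text \<open>A bound on the additive distance of the cycle without normalised trace: the shift is
  \<open>\<epsilon>\<close> times the sum of the diagonal. Being homogeneous, it applies to the part
  of a larger trace that lies on one cycle.\<close>

definition cycle_bound :: "nat \<Rightarrow> real \<Rightarrow> bool" where
  "cycle_bound n \<epsilon> \<longleftrightarrow> (\<forall>\<delta> a. (\<forall>i<n. \<delta> i \<ge> 0) \<longrightarrow> (\<forall>i<n. (a i)\<^sup>2 \<le> \<delta> i * \<delta> (Suc i mod n)) \<longrightarrow>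
     (\<exists>M. psd_on {..<n} M \<and> (\<forall>i<n. M i i = \<delta> i + \<epsilon> * sum \<delta> {..<n} \<and> M i (Suc i mod n) = a i)))"

text \<open>The triangle on \<open>n - 1\<close>, \<open>n\<close>, \<open>0\<close> is completed
  without any shift. Its third entry \<open>b\<close> closes a cycle on the first \<open>n\<close>
  vertices, whose trace is smaller by \<open>\<delta> n\<close>. Raising the diagonals of both parts
  to the shift for the full trace makes them agree on the chord, along which they are glued.\<close>

lemma cycle_bound_Suc:
  assumes n: "n \<ge> 3" and \<epsilon>: "\<epsilon> \<ge> 0" and cb: "cycle_bound n \<epsilon>"
  shows "cycle_bound (Suc n) \<epsilon>"
  unfolding cycle_bound_def
proof (intro allI impI)
  fix \<delta> a :: "nat \<Rightarrow> real"
  assume \<delta>: "\<forall>i<Suc n. \<delta> i \<ge> 0" and a: "\<forall>i<Suc n. (a i)\<^sup>2 \<le> \<delta> i * \<delta> (Suc i mod Suc n)"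
  let ?m = "n - 1"
  let ?P = "\<lambda>i j :: nat. if i = j then \<delta> i else a (min i j)"
  let ?Q = "\<lambda>i j :: nat. if i = j then \<delta> i else a n"
  have P: "psd_on {?m, n} ?P"
    by (rule psd_on_pair) (use n \<delta> a[rule_format, of ?m] in auto)
  have Q: "psd_on {n, 0} ?Q"
    by (rule psd_on_pair) (use n \<delta> a[rule_format, of n] in auto)
  have int: "{?m, n} \<inter> {n, 0} = {n}" using n by auto
  obtain Tm where T: "psd_on ({?m, n} \<union> {n, 0}) Tm"
    "\<And>i j. i \<in> {?m, n} \<Longrightarrow> j \<in> {?m, n} \<Longrightarrow> Tm i j = ?P i j"
    "\<And>i j. i \<in> {n, 0} \<Longrightarrow> j \<in> {n, 0} \<Longrightarrow> Tm i j = ?Q i j"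
    by (rule psd_on_glue[OF _ _ P Q]) (use int in auto)
  define b where "b = Tm ?m 0"
  have b: "b\<^sup>2 \<le> \<delta> ?m * \<delta> 0"
    using psd_on_minor[OF _ T(1), of ?m 0] T(2)[of ?m ?m] T(3)[of 0 0] by (simp add: b_def)
  let ?a = "\<lambda>i. if i = ?m then b else a i"
  let ?t = "sum \<delta> {..<n}"
  have "\<exists>M. psd_on {..<n} M \<and> (\<forall>i<n. M i i = \<delta> i + \<epsilon> * ?t \<and> M i (Suc i mod n) = ?a i)"
  proof (rule cb[unfolded cycle_bound_def, rule_format])
    show "0 \<le> \<delta> i" if "i < n" for i using \<delta> that by simp
    show "(?a i)\<^sup>2 \<le> \<delta> i * \<delta> (Suc i mod n)" if "i < n" for i
    proof (cases "i = ?m")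
      case True then show ?thesis using b n by simp
    next
      case False
      then have "Suc i < n" using that by simp
      then show ?thesis using a[rule_format, of i] False that by simp
    qed
  qed
  then obtain M where M: "psd_on {..<n} M" "\<And>i. i < n \<Longrightarrow> M i i = \<delta> i + \<epsilon> * ?t"
    "\<And>i. i < n \<Longrightarrow> M i (Suc i mod n) = ?a i" by blast
  let ?M = "\<lambda>i j. M i j + (if i = j then \<epsilon> * \<delta> n else 0)"
  let ?T = "\<lambda>i j. Tm i j + (if i = j then \<epsilon> * (?t + \<delta> n) else 0)"
  have M': "psd_on {..<n} ?M" by (intro psd_on_add_diag M(1)) (use \<epsilon> \<delta> in auto)
  have T': "psd_on ({?m, n} \<union> {n, 0}) ?T"
    by (intro psd_on_add_diag T(1)) (use \<epsilon> \<delta> in \<open>auto intro!: mult_nonneg_nonneg add_nonneg_nonneg sum_nonneg\<close>)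
  have m0: "M ?m 0 = b" using M(3)[of ?m] n by simp
  have agree: "?M i j = ?T i j" if "i \<in> {..<n} \<inter> ({?m, n} \<union> {n, 0})" "j \<in> {..<n} \<inter> ({?m, n} \<union> {n, 0})" for i j
  proof -
    have ij: "i = ?m \<or> i = 0" "j = ?m \<or> j = 0" using that by auto
    have "M 0 ?m = b" using psd_on_sym[OF M(1), of 0 ?m] m0 n by simp
    moreover have "Tm 0 ?m = b" using psd_on_sym[OF T(1), of 0 ?m] by (simp add: b_def)
    moreover have "Tm ?m ?m = \<delta> ?m" "Tm 0 0 = \<delta> 0" using T(2)[of ?m ?m] T(3)[of 0 0] by auto
    moreover have "M ?m ?m = \<delta> ?m + \<epsilon> * ?t" "M 0 0 = \<delta> 0 + \<epsilon> * ?t" using M(2) n by auto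
    ultimately show ?thesis using ij m0 n by (auto simp: b_def algebra_simps)
  qed
  obtain K where K: "psd_on ({..<n} \<union> ({?m, n} \<union> {n, 0})) K"
    "\<And>i j. i \<in> {..<n} \<Longrightarrow> j \<in> {..<n} \<Longrightarrow> K i j = ?M i j"
    "\<And>i j. i \<in> {?m, n} \<union> {n, 0} \<Longrightarrow> j \<in> {?m, n} \<union> {n, 0} \<Longrightarrow> K i j = ?T i j"
    using psd_on_glue[OF _ _ M' T' agree] by auto
  have "{..<n} \<union> ({?m, n} \<union> {n, 0}) = {..<Suc n}" using n by auto
  then have "psd_on {..<Suc n} K" using K(1) by simp
  moreover have "K i i = \<delta> i + \<epsilon> * sum \<delta> {..<Suc n} \<and> K i (Suc i mod Suc n) = a i" if iSn: "i < Suc n" for i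
  proof -
    consider "i = n" | "i = ?m" | "Suc i < n" using iSn by linarith
    then show ?thesis
    proof cases
      case 1
      then show ?thesis using K(3)[of n n] K(3)[of n 0] T(3)[of n n] T(3)[of n 0] n
        by (simp add: algebra_simps)
    next
      case 2
      then have "Suc i mod Suc n = n" "i \<noteq> n" "min i n = i" using n by auto
      then show ?thesis using 2 n K(3)[of i i] K(3)[of i n] T(2)[of i i] T(2)[of i n]
        by (simp add: algebra_simps)
    next
      case 3
      then have "i \<noteq> ?m" by linarith
      then show ?thesis using 3 K(2)[of i i] K(2)[of i "Suc i"] M(2)[of i] M(3)[of i]
        by (simp add: algebra_simps)
    qed
  qed
  ultimately show "\<exists>M. psd_on {..<Suc n} M \<and>
      (\<forall>i<Suc n. M i i = \<delta> i + \<epsilon> * sum \<delta> {..<Suc n} \<and> M i (Suc i mod Suc n) = a i)" by blast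
qed

lemma cycle_bound_mono:
  assumes "n \<ge> 3" "\<epsilon> \<ge> 0" "cycle_bound n \<epsilon>" "n \<le> m"
  shows "cycle_bound m \<epsilon>"
  using assms(4) by (induction m rule: dec_induct) (use assms cycle_bound_Suc in auto)

lemma cycle_bound_list:
  assumes cb: "cycle_bound (length xs) \<epsilon>" and xs: "distinct xs" "xs \<noteq> []"
    and \<delta>: "\<And>x. x \<in> set xs \<Longrightarrow> \<delta> x \<ge> 0"
    and a: "\<And>x y. (x, y) \<in> cyc_pairs xs \<Longrightarrow> (a x y)\<^sup>2 \<le> \<delta> x * \<delta> y"
  obtains M where "psd_on (set xs) M" "\<And>x. x \<in> set xs \<Longrightarrow> M x x = \<delta> x + \<epsilon> * sum \<delta> (set xs)"
    "\<And>x y. (x, y) \<in> cyc_pairs xs \<Longrightarrow> M x y = a x y"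
proof -
  let ?n = "length xs"
  let ?x = "\<lambda>i. xs ! i"
  have bij: "bij_betw ?x {..<?n} (set xs)" using xs(1) by (simp add: bij_betw_nth)
  have cp: "(?x i, ?x (Suc i mod ?n)) \<in> cyc_pairs xs" if "i < ?n" for i
    using cyc_pairs_nth[OF xs(2)] that by auto
  have sum: "(\<Sum>i<?n. \<delta> (?x i)) = sum \<delta> (set xs)" using sum.reindex_bij_betw[OF bij] .
  have "\<exists>M. psd_on {..<?n} M \<and> (\<forall>i<?n. M i i = \<delta> (?x i) + \<epsilon> * (\<Sum>i<?n. \<delta> (?x i))
      \<and> M i (Suc i mod ?n) = a (?x i) (?x (Suc i mod ?n)))"
    by (rule cb[unfolded cycle_bound_def, rule_format]) (use \<delta> a[OF cp] in auto)
  then obtain M where M: "psd_on {..<?n} M" "\<And>i. i < ?n \<Longrightarrow> M i i = \<delta> (?x i) + \<epsilon> * sum \<delta> (set xs)"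
    "\<And>i. i < ?n \<Longrightarrow> M i (Suc i mod ?n) = a (?x i) (?x (Suc i mod ?n))"
    unfolding sum by blast
  define r where "r = inv_into {..<?n} ?x"
  have r: "r (?x i) = i" if "i < ?n" for i
    using inv_into_f_f[OF bij_betw_imp_inj_on[OF bij], of i] that by (simp add: r_def)
  have rset: "r ` set xs \<subseteq> {..<?n}" using r by (auto simp: in_set_conv_nth)
  show thesis
  proof (rule that)
    show "psd_on (set xs) (\<lambda>x y. M (r x) (r y))" by (rule psd_on_reindex[OF _ M(1) rset]) auto
    show "M (r x) (r x) = \<delta> x + \<epsilon> * sum \<delta> (set xs)" if "x \<in> set xs" for x
      using that M(2) r by (auto simp: in_set_conv_nth)
    show "M (r x) (r y) = a x y" if xy: "(x, y) \<in> cyc_pairs xs" for x y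
    proof -
      obtain i where i: "i < ?n" "x = ?x i" "y = ?x (Suc i mod ?n)"
        using xy cyc_pairs_nth[OF xs(2)] by auto
      have "Suc i mod ?n < ?n" using xs(2) by simp
      then show ?thesis using i M(3)[OF i(1)] r by simp
    qed
  qed
qed

section \<open>Necklaces of blocks\<close>

lemma cyc_pairs_mem:
  assumes "distinct vs" "length vs \<ge> 2" "(v, w) \<in> cyc_pairs vs"
  shows "v \<in> set vs \<and> w \<in> set vs \<and> v \<noteq> w"
proof -
  have ne: "vs \<noteq> []" using assms(2) by auto
  obtain i where i: "i < length vs" "v = vs ! i" "w = vs ! (Suc i mod length vs)"
    using assms(3) cyc_pairs_nth[OF ne] by auto
  have "Suc i mod length vs < length vs" "Suc i mod length vs \<noteq> i"
    using assms(2) i(1) by (auto simp: mod_Suc)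
  then show ?thesis using i assms(1) by (simp add: nth_eq_iff_index_eq)
qed

lemma cyc_pairs_fun:
  assumes "distinct vs" "length vs \<ge> 2" "(v, w) \<in> cyc_pairs vs" "(v, w') \<in> cyc_pairs vs"
  shows "w = w'"
proof -
  have ne: "vs \<noteq> []" using assms(2) by auto
  show ?thesis using assms by (auto simp: cyc_pairs_nth[OF ne] nth_eq_iff_index_eq)
qed

lemma cyc_pairs_ex:
  assumes "length vs \<ge> 2" "v \<in> set vs"
  shows "\<exists>w. (v, w) \<in> cyc_pairs vs"
proof -
  have ne: "vs \<noteq> []" using assms(1) by auto
  show ?thesis using assms by (auto simp: cyc_pairs_nth[OF ne] in_set_conv_nth)
qed

text \<open>Blocks are named by the vertex of the cycle at which they start. The matrix
  \<open>N\<close> on the cycle records the terminal entries of the completions \<open>K v\<close>.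
  Terminals of consecutive blocks are not identified; compatibility of their diagonals is a premise
  where it is needed.\<close>

definition necklace_completion ::
  "'v list \<Rightarrow> ('v \<Rightarrow> 'b set) \<Rightarrow> ('v \<Rightarrow> ('b \<times> 'b) set) \<Rightarrow> ('v \<Rightarrow> 'b) \<Rightarrow> ('v \<Rightarrow> 'b) \<Rightarrow>
    ('v \<Rightarrow> 'b \<Rightarrow> 'b \<Rightarrow> real) \<Rightarrow> real \<Rightarrow> ('v \<Rightarrow> 'v \<Rightarrow> real) \<Rightarrow> ('v \<Rightarrow> 'b \<Rightarrow> 'b \<Rightarrow> real) \<Rightarrow> bool" where
  "necklace_completion vs B A s t M \<eta> N K \<longleftrightarrow> psd_on (set vs) N \<and>
     (\<forall>v\<in>set vs. N v v = M v (s v) (s v) + \<eta> \<and> psd_on (B v) (K v) \<and>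
        (\<forall>i\<in>B v. \<forall>j\<in>B v. i = j \<or> (i, j) \<in> A v \<longrightarrow> K v i j = M v i j + (if i = j then \<eta> else 0))) \<and>
     (\<forall>(v, w)\<in>cyc_pairs vs. N v w = K v (s v) (t v))"

context
  fixes vs :: "'v list" and B :: "'v \<Rightarrow> 'b set" and A :: "'v \<Rightarrow> ('b \<times> 'b) set"
    and s t :: "'v \<Rightarrow> 'b" and d :: "'v \<Rightarrow> nat" and f :: "'v \<Rightarrow> 'b \<Rightarrow> nat" and \<epsilon> :: real
  assumes vs: "distinct vs" "length vs \<ge> 2" and \<epsilon>: "\<epsilon> \<ge> 0"
    and fin: "\<And>v. v \<in> set vs \<Longrightarrow> finite (B v)"
    and st: "\<And>v. v \<in> set vs \<Longrightarrow> s v \<in> B v" "\<And>v. v \<in> set vs \<Longrightarrow> t v \<in> B v"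
      "\<And>v. v \<in> set vs \<Longrightarrow> s v \<noteq> t v"
begin

lemma vs_ne: "vs \<noteq> []" using vs by auto

lemmas vs_mem = cyc_pairs_mem[OF vs]
  and vs_fun = cyc_pairs_fun[OF vs]
  and vs_ex = cyc_pairs_ex[OF vs(2)]

lemma necklace_completion_mono:
  assumes "necklace_completion vs B A s t M \<eta> N K" "\<eta> \<le> \<eta>'"
  shows "\<exists>N K. necklace_completion vs B A s t M \<eta>' N K"
proof -
  have "necklace_completion vs B A s t M \<eta>' (\<lambda>i j. N i j + (if i = j then \<eta>' - \<eta> else 0))
      (\<lambda>v i j. K v i j + (if i = j then \<eta>' - \<eta> else 0))"
    using assms st(3) vs_mem fin unfolding necklace_completion_def
    by (auto intro!: psd_on_add_diag)
  then show ?thesis by blast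
qed

lemma necklace_completion_convex:
  assumes "necklace_completion vs B A s t M1 \<eta>1 N1 K1" "necklace_completion vs B A s t M2 \<eta>2 N2 K2"
    and pq: "p \<ge> 0" "q \<ge> 0"
  shows "necklace_completion vs B A s t (\<lambda>v i j. p * M1 v i j + q * M2 v i j) (p * \<eta>1 + q * \<eta>2)
    (\<lambda>i j. p * N1 i j + q * N2 i j) (\<lambda>v i j. p * K1 v i j + q * K2 v i j)"
  using assms unfolding necklace_completion_def
  by (auto intro!: psd_on_add psd_on_scale simp: algebra_simps split: prod.splits)

text \<open>The remainder of a split can be put back at the end: it is zero in the entries that
  \<open>N\<close> reads, so the matrix on the cycle and the shift stay the same.\<close>

lemma necklace_completion_add:
  assumes "necklace_completion vs B A s t M \<eta> N K"
    and R: "\<And>v. v \<in> set vs \<Longrightarrow> psd_on (B v) (R v)" "\<And>v. v \<in> set vs \<Longrightarrow> R v (s v) (s v) = 0"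
      "\<And>v. v \<in> set vs \<Longrightarrow> R v (s v) (t v) = 0"
  shows "necklace_completion vs B A s t (\<lambda>v i j. M v i j + R v i j) \<eta> N (\<lambda>v i j. K v i j + R v i j)"
  using assms unfolding necklace_completion_def
  by (auto intro!: psd_on_add dest: vs_mem split: prod.splits)

lemma necklace_completion_cong:
  assumes "necklace_completion vs B A s t M \<eta> N K"
    and "\<And>v i j. v \<in> set vs \<Longrightarrow> i \<in> B v \<Longrightarrow> j \<in> B v \<Longrightarrow> M v i j = M' v i j"
  shows "necklace_completion vs B A s t M' \<eta> N K"
  using assms st(1) unfolding necklace_completion_def by auto

context
  assumes d: "\<And>v. v \<in> set vs \<Longrightarrow> d v > 0"
    and lay: "\<And>v. v \<in> set vs \<Longrightarrow> d v = 1 \<or> layering (B v) (A v) (s v) (t v) (f v) (d v)"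
    and cb: "cycle_bound (sum_list (map d vs)) \<epsilon>"
begin

text \<open>The collapsed blocks form one long cycle of tokens, to which \<open>cycle_bound\<close>
  applies. The part of the resulting matrix on the tokens of a block is pulled back through the
  layers; the part on the tokens \<open>(v, 0)\<close> is \<open>N\<close>.\<close>

lemma necklace_completion_rank1:
  assumes y: "\<And>v w. (v, w) \<in> cyc_pairs vs \<Longrightarrow> (y v (t v))\<^sup>2 = (y w (s w))\<^sup>2"
    and \<eta>: "\<epsilon> * (\<Sum>v\<in>set vs. \<Sum>b\<in>B v - {t v}. (y v b)\<^sup>2) \<le> \<eta>"
  shows "\<exists>N K. necklace_completion vs B A s t (\<lambda>v i j. y v i * y v j) \<eta> N K"
proof -
  let ?c = "chain d vs"
  define x where "x v = layer_entry (B v) (s v) (t v) (f v) (d v) (y v)" for v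
  define \<delta> where "\<delta> = (\<lambda>(v, k). (x v k)\<^sup>2)"
  \<comment> \<open>At the passage to the next block the last entry of the present path is used: the
    hypothesis equates only squares, so \<open>x w 0\<close> may have the opposite sign.\<close>
  define a where "a = (\<lambda>(v, k) (w, l :: nat). x v k * (if l = 0 then y v (t v) else x w l))"
  have d': "\<forall>v\<in>set vs. d v > 0" using d by blast
  have ne: "?c \<noteq> []" using chain_hd_last[OF vs_ne d'] by blast
  have \<delta>0: "\<delta> p \<ge> 0" for p by (simp add: \<delta>_def split: prod.splits)
  have x0: "x v 0 = y v (s v)" for v by (simp add: x_def layer_entry_def)
  have xd: "x v (d v) = y v (t v)" if "v \<in> set vs" for v
    using d[OF that] by (simp add: x_def layer_entry_def)
  have ahyp: "(a p q)\<^sup>2 \<le> \<delta> p * \<delta> q" if "(p, q) \<in> cyc_pairs ?c" for p q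
    using that y unfolding cyc_pairs_chain[OF vs_ne d']
    by (auto simp: a_def \<delta>_def power_mult_distrib x0)
  have cbc: "cycle_bound (length ?c) \<epsilon>" using cb by (simp add: length_chain)
  obtain Mt where Mt: "psd_on (set ?c) Mt"
    "\<And>p. p \<in> set ?c \<Longrightarrow> Mt p p = \<delta> p + \<epsilon> * sum \<delta> (set ?c)"
    "\<And>p q. (p, q) \<in> cyc_pairs ?c \<Longrightarrow> Mt p q = a p q"
    using cycle_bound_list[where \<delta> = \<delta> and a = a, OF cbc distinct_chain[OF vs(1)] ne \<delta>0 ahyp] by blast
  \<comment> \<open>Each layer contributes the squares of its vertices. The terminal
    \<open>t v\<close> is left out, since its position belongs to the next block. For
    \<open>d v = 1\<close> only \<open>s v\<close> is counted, whence an inequality.\<close>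
  have sum_le: "(\<Sum>k<d v. (x v k)\<^sup>2) \<le> (\<Sum>b\<in>B v - {t v}. (y v b)\<^sup>2)" if v: "v \<in> set vs" for v
  proof (cases "d v = 1")
    case True
    have "(\<Sum>b\<in>{s v}. (y v b)\<^sup>2) \<le> (\<Sum>b\<in>B v - {t v}. (y v b)\<^sup>2)"
      by (rule sum_mono2) (use fin st v in auto)
    then show ?thesis using True x0 by simp
  next
    case False
    then have L: "\<And>i. i \<in> B v \<Longrightarrow> f v i \<le> d v \<and> (f v i = 0 \<longleftrightarrow> i = s v) \<and> (f v i = d v \<longleftrightarrow> i = t v)"
      using lay[OF v] by (auto simp: layering_def)
    have "(x v k)\<^sup>2 = (\<Sum>b\<in>{b \<in> B v - {t v}. f v b = k}. (y v b)\<^sup>2)" if k: "k < d v" for k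
    proof (cases "k = 0")
      case True
      have "{b \<in> B v - {t v}. f v b = k} = {s v}" using L True st[OF v] by auto
      then show ?thesis using True x0 by simp
    next
      case False
      have "f v (t v) = d v" using L[OF st(2)[OF v]] by blast
      then have "{b \<in> B v - {t v}. f v b = k} = {b \<in> B v. f v b = k}" using k by auto
      then show ?thesis using False k by (simp add: x_def layer_entry_def sum_nonneg)
    qed
    then have "(\<Sum>k<d v. (x v k)\<^sup>2) = (\<Sum>k<d v. \<Sum>b\<in>{b \<in> B v - {t v}. f v b = k}. (y v b)\<^sup>2)"
      by simp
    also have "\<dots> = (\<Sum>b\<in>B v - {t v}. (y v b)\<^sup>2)"
    proof (rule sum.group)
      show "f v ` (B v - {t v}) \<subseteq> {..<d v}" using L by (auto simp: less_le)
    qed (use fin v in auto)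
    finally show ?thesis by simp
  qed
  have "set ?c = (SIGMA v:set vs. {..<d v})" by (auto simp: set_chain)
  then have "sum \<delta> (set ?c) = (\<Sum>v\<in>set vs. \<Sum>k<d v. (x v k)\<^sup>2)"
    by (simp add: sum.Sigma \<delta>_def)
  also have "\<dots> \<le> (\<Sum>v\<in>set vs. \<Sum>b\<in>B v - {t v}. (y v b)\<^sup>2)" by (intro sum_mono sum_le)
  finally have "\<epsilon> * sum \<delta> (set ?c) \<le> \<epsilon> * (\<Sum>v\<in>set vs. \<Sum>b\<in>B v - {t v}. (y v b)\<^sup>2)"
    using \<epsilon> by (rule mult_left_mono)
  then have sl: "\<epsilon> * sum \<delta> (set ?c) \<le> \<eta>" using \<eta> by linarith
  have \<eta>0: "\<eta> \<ge> 0" using sl \<epsilon> \<delta>0 by (meson mult_nonneg_nonneg order_trans sum_nonneg)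
  \<comment> \<open>The cycle bound shifts by \<open>\<epsilon>\<close> times the trace on the
    tokens; the diagonal is raised to the prescribed \<open>\<eta>\<close>.\<close>
  define M where "M p q = Mt p q + (if p = q then \<eta> - \<epsilon> * sum \<delta> (set ?c) else 0)" for p q
  have M: "psd_on (set ?c) M" unfolding M_def[abs_def] using sl by (intro psd_on_add_diag Mt(1)) auto
  have Md: "M p p = \<delta> p + \<eta>" if "p \<in> set ?c" for p using Mt(2)[OF that] by (simp add: M_def)
  have Mo: "M p q = a p q" if "(p, q) \<in> cyc_pairs ?c" "p \<noteq> q" for p q
    using Mt(3)[OF that(1)] that(2) by (simp add: M_def)
  define nxt where "nxt v = (SOME w. (v, w) \<in> cyc_pairs vs)" for v
  have nxt: "(v, nxt v) \<in> cyc_pairs vs" if "v \<in> set vs" for v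
    unfolding nxt_def using vs_ex[OF that] by (rule someI_ex)
  \<comment> \<open>Position \<open>d v\<close> of the path through block \<open>v\<close> is the
    token \<open>(nxt v, 0)\<close>; reading \<open>M\<close> along these tokens gives the collapsed
    matrix of the block.\<close>
  define tok where "tok v k = (if k < d v then (v, k) else (nxt v, 0))" for v k
  have tok: "tok v k \<in> set ?c" if "v \<in> set vs" for v k
    using that nxt[OF that] vs_mem d by (auto simp: tok_def set_chain)
  have "\<exists>K. psd_on (B v) K \<and> K (s v) (t v) = M (v, 0) (nxt v, 0) \<and>
      (\<forall>i\<in>B v. \<forall>j\<in>B v. i = j \<or> (i, j) \<in> A v \<longrightarrow> K i j = y v i * y v j + (if i = j then \<eta> else 0))"
    if v: "v \<in> set vs" for v
  proof -
    let ?M = "\<lambda>k l. M (tok v k) (tok v l)"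
    have P: "psd_on {0..d v} ?M" by (rule psd_on_reindex[OF _ M]) (use tok[OF v] in auto)
    have D: "?M k k = (layer_entry (B v) (s v) (t v) (f v) (d v) (y v) k)\<^sup>2 + \<eta>" if "k \<le> d v" for k
    proof (cases "k < d v")
      case True
      then show ?thesis using Md[OF tok[OF v, of k]] by (simp add: tok_def \<delta>_def x_def)
    next
      case False
      then show ?thesis using Md[OF tok[OF v, of k]] that xd[OF v] x0 y[OF nxt[OF v]]
        by (simp add: tok_def \<delta>_def x_def[symmetric])
    qed
    have O: "?M k (Suc k) = layer_entry (B v) (s v) (t v) (f v) (d v) (y v) k
        * layer_entry (B v) (s v) (t v) (f v) (d v) (y v) (Suc k)" if "k < d v" for k
    proof -
      have cp: "(tok v k, tok v (Suc k)) \<in> cyc_pairs ?c"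
      proof (cases "Suc k < d v")
        case False
        then have "k = d v - 1" using that by simp
        then show ?thesis unfolding cyc_pairs_chain[OF vs_ne d'] using nxt[OF v] that
          by (auto simp: tok_def)
      qed (use v that in \<open>auto simp: cyc_pairs_chain[OF vs_ne d'] tok_def\<close>)
      have "nxt v \<noteq> v" using vs_mem[OF nxt[OF v]] by auto
      then have "tok v k \<noteq> tok v (Suc k)" using that by (auto simp: tok_def)
      then have eq: "?M k (Suc k) = a (tok v k) (tok v (Suc k))" using Mo[OF cp] by simp
      show ?thesis
      proof (cases "Suc k < d v")
        case True
        then show ?thesis using that unfolding eq by (simp add: tok_def a_def x_def[symmetric])
      next
        case False
        then have "d v = Suc k" using that by simp
        then have "x v (Suc k) = y v (t v)" using xd[OF v] by simp
        then show ?thesis using that False unfolding eq by (simp add: tok_def a_def x_def[symmetric])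
      qed
    qed
    obtain K where "psd_on (B v) K" "K (s v) (t v) = ?M 0 (d v)"
      "\<And>i j. i \<in> B v \<Longrightarrow> j \<in> B v \<Longrightarrow> i = j \<or> (i, j) \<in> A v
        \<Longrightarrow> K i j = y v i * y v j + (if i = j then \<eta> else 0)"
      using psd_on_uncollapse[OF fin[OF v] st[OF v] d[OF v] lay[OF v] \<eta>0 P D O] by blast
    then show ?thesis using d[OF v] by (intro exI[of _ K]) (simp add: tok_def)
  qed
  then obtain K where K: "\<And>v. v \<in> set vs \<Longrightarrow> psd_on (B v) (K v)"
    "\<And>v. v \<in> set vs \<Longrightarrow> K v (s v) (t v) = M (v, 0) (nxt v, 0)"
    "\<And>v i j. v \<in> set vs \<Longrightarrow> i \<in> B v \<Longrightarrow> j \<in> B v \<Longrightarrow> i = j \<or> (i, j) \<in> A v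
      \<Longrightarrow> K v i j = y v i * y v j + (if i = j then \<eta> else 0)"
    by metis
  have "psd_on (set vs) (\<lambda>v w. M (v, 0) (w, 0))"
    by (rule psd_on_reindex[OF finite_set M _ finite_set]) (use d in \<open>auto simp: set_chain\<close>)
  moreover have "M (v, 0) (v, 0) = y v (s v) * y v (s v) + \<eta>" if "v \<in> set vs" for v
    using Md[of "(v, 0)"] d[OF that] that by (simp add: set_chain \<delta>_def x0 power2_eq_square)
  moreover have "M (v, 0) (w, 0) = K v (s v) (t v)" if "(v, w) \<in> cyc_pairs vs" for v w
    using K(2)[of v] vs_mem[OF that] vs_fun[OF that nxt] by simp
  ultimately have "necklace_completion vs B A s t (\<lambda>v i j. y v i * y v j) \<eta> (\<lambda>v w. M (v, 0) (w, 0)) K"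
    unfolding necklace_completion_def using K by auto
  then show ?thesis by blast
qed

text \<open>Both sides are compatible with convex combinations of matrices with a fixed diagonal at the
  terminals, so one block after the other can be replaced by a matrix of rank one.\<close>

lemma necklace_completion_exists:
  assumes M: "\<And>v. v \<in> set vs \<Longrightarrow> psd_on (B v) (M v)"
    and comp: "\<And>v w. (v, w) \<in> cyc_pairs vs \<Longrightarrow> M v (t v) (t v) = M w (s w) (s w)"
    and \<eta>: "\<epsilon> * (\<Sum>v\<in>set vs. \<Sum>b\<in>B v - {t v}. M v b b) \<le> \<eta>"
  shows "\<exists>N K. necklace_completion vs B A s t M \<eta> N K"
proof -
  \<comment> \<open>Induction on a set \<open>F\<close> of blocks outside which all matrices already
    have rank one.\<close>
  have "\<exists>N K. necklace_completion vs B A s t M \<eta> N K"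
    if "finite F" "F \<subseteq> set vs"
      "\<And>v. v \<in> set vs - F \<Longrightarrow> \<exists>y. \<forall>i\<in>B v. \<forall>j\<in>B v. M v i j = y i * y j"
      "\<And>v. v \<in> set vs \<Longrightarrow> psd_on (B v) (M v)"
      "\<And>v w. (v, w) \<in> cyc_pairs vs \<Longrightarrow> M v (t v) (t v) = M w (s w) (s w)"
      "\<epsilon> * (\<Sum>v\<in>set vs. \<Sum>b\<in>B v - {t v}. M v b b) \<le> \<eta>" for F M \<eta>
    using that
  proof (induction F arbitrary: M \<eta> rule: finite_induct)
    case empty
    then obtain y where y: "\<And>v i j. v \<in> set vs \<Longrightarrow> i \<in> B v \<Longrightarrow> j \<in> B v \<Longrightarrow> M v i j = y v i * y v j"
      by (metis Diff_empty)
    have sq: "(y v (t v))\<^sup>2 = (y w (s w))\<^sup>2" if "(v, w) \<in> cyc_pairs vs" for v w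
      using empty.prems(4)[OF that] y[of v "t v" "t v"] y[of w "s w" "s w"] vs_mem[OF that] st
      by (simp add: power2_eq_square)
    have "(\<Sum>v\<in>set vs. \<Sum>b\<in>B v - {t v}. (y v b)\<^sup>2) = (\<Sum>v\<in>set vs. \<Sum>b\<in>B v - {t v}. M v b b)"
      by (intro sum.cong HOL.refl) (simp add: y power2_eq_square)
    then have le: "\<epsilon> * (\<Sum>v\<in>set vs. \<Sum>b\<in>B v - {t v}. (y v b)\<^sup>2) \<le> \<eta>"
      using empty.prems(5) by simp
    obtain N K where "necklace_completion vs B A s t (\<lambda>v i j. y v i * y v j) \<eta> N K"
      using necklace_completion_rank1[where y = y, OF sq le] by blast
    then have "necklace_completion vs B A s t M \<eta> N K"
      by (rule necklace_completion_cong) (simp add: y)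
    then show ?case by blast
  next
    case (insert u F)
    have u: "u \<in> set vs" using insert.prems(1) by simp
    obtain p q y z R where S: "p \<ge> 0" "q \<ge> 0" "p + q = 1" "psd_on (B u) R" "R (s u) (s u) = 0"
      "R (t u) (t u) = 0" "(y (s u))\<^sup>2 = M u (s u) (s u)" "(y (t u))\<^sup>2 = M u (t u) (t u)"
      "(z (s u))\<^sup>2 = M u (s u) (s u)" "(z (t u))\<^sup>2 = M u (t u) (t u)"
      "\<And>i j. M u i j = p * (y i * y j) + q * (z i * z j) + R i j"
      by (rule psd_on_split[OF fin[OF u] st[OF u] insert.prems(3)[OF u]]; rule that; (assumption | blast))
    define M' where "M' y = M(u := \<lambda>i j. y i * y j)" for y
    define \<tau> where "\<tau> M = (\<Sum>v\<in>set vs. \<Sum>b\<in>B v - {t v}. M v b b)" for M :: "'v \<Rightarrow> 'b \<Rightarrow> 'b \<Rightarrow> real"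
    have IH: "\<exists>N K. necklace_completion vs B A s t (M' y) (\<epsilon> * \<tau> (M' y)) N K"
      if y: "(y (s u))\<^sup>2 = M u (s u) (s u)" "(y (t u))\<^sup>2 = M u (t u) (t u)" for y
    proof (rule insert.IH)
      show "F \<subseteq> set vs" using insert.prems by simp
      show "\<exists>y'. \<forall>i\<in>B v. \<forall>j\<in>B v. M' y v i j = y' i * y' j" if "v \<in> set vs - F" for v
        using insert.prems(2)[of v] that by (cases "v = u") (auto simp: M'_def)
      show "psd_on (B v) (M' y v)" if "v \<in> set vs" for v
        using insert.prems(3)[OF that] psd_on_rank1[of "B u" y] by (simp add: M'_def)
      show "M' y v (t v) (t v) = M' y w (s w) (s w)" if "(v, w) \<in> cyc_pairs vs" for v w
        using insert.prems(4)[OF that] y by (auto simp: M'_def power2_eq_square)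
      show "\<epsilon> * (\<Sum>v\<in>set vs. \<Sum>b\<in>B v - {t v}. M' y v b b) \<le> \<epsilon> * \<tau> (M' y)"
        by (simp add: \<tau>_def)
    qed
    obtain N1 K1 where 1: "necklace_completion vs B A s t (M' y) (\<epsilon> * \<tau> (M' y)) N1 K1"
      using IH[OF S(7,8)] by blast
    obtain N2 K2 where 2: "necklace_completion vs B A s t (M' z) (\<epsilon> * \<tau> (M' z)) N2 K2"
      using IH[OF S(9,10)] by blast
    define R' where "R' v = (if v = u then R else (\<lambda>i j. 0))" for v
    have R0: "R' v (s v) (s v) = 0" "R' v (s v) (t v) = 0" if "v \<in> set vs" for v
      using S(5) psd_on_zero_row(2)[OF fin[OF u] S(4) st(1)[OF u] S(5) st(2)[OF u]] by (auto simp: R'_def)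
    have R': "psd_on (B v) (R' v)" for v using S(4) psd_on_zero[of "B v"] by (simp add: R'_def)
    let ?M = "\<lambda>v i j. p * M' y v i j + q * M' z v i j + R' v i j"
    have Meq: "?M = M"
    proof (intro ext)
      fix v i j
      have "p * c + q * c = c" for c using S(3) by (metis distrib_right mult_1)
      then show "?M v i j = M v i j" using S(11) by (simp add: M'_def R'_def)
    qed
    have "necklace_completion vs B A s t ?M (p * (\<epsilon> * \<tau> (M' y)) + q * (\<epsilon> * \<tau> (M' z)))
        (\<lambda>i j. p * N1 i j + q * N2 i j) (\<lambda>v i j. p * K1 v i j + q * K2 v i j + R' v i j)"
      by (intro necklace_completion_add necklace_completion_convex 1 2 S(1,2) R' R0)
    \<comment> \<open>The shifts are averaged with the weights of the split. The trace is additive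
      and the remainder has nonnegative trace, so the average is at most
      \<open>\<epsilon> * \<tau> M\<close>.\<close>
    moreover have "p * (\<epsilon> * \<tau> (M' y)) + q * (\<epsilon> * \<tau> (M' z)) \<le> \<eta>"
    proof -
      have "\<tau> M = \<tau> ?M" by (simp only: Meq)
      also have "\<dots> = p * \<tau> (M' y) + q * \<tau> (M' z) + \<tau> R'"
        by (simp add: \<tau>_def sum.distrib sum_distrib_left)
      finally have "\<tau> M = p * \<tau> (M' y) + q * \<tau> (M' z) + \<tau> R'" .
      moreover have "\<tau> R' \<ge> 0" unfolding \<tau>_def
        using psd_on_diag_nonneg[OF fin R'] by (auto intro!: sum_nonneg)
      ultimately have "\<epsilon> * (p * \<tau> (M' y) + q * \<tau> (M' z)) \<le> \<epsilon> * \<tau> M"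
        using \<epsilon> by (intro mult_left_mono) auto
      also have "\<dots> \<le> \<eta>" using insert.prems(5) by (simp add: \<tau>_def)
      finally show ?thesis by (simp add: algebra_simps)
    qed
    ultimately show ?case unfolding Meq by (rule necklace_completion_mono)
  qed
  from this[of "set vs" M \<eta>] show ?thesis using assms by auto
qed

end

end

section \<open>Graphs without a complete minor on four vertices\<close>

lemma pair_graphD:
  assumes "pair_graph G"
  shows "finite (pverts G)" "parcs G \<subseteq> pverts G \<times> pverts G" "sym (parcs G)" "irrefl (parcs G)"
proof -
  interpret pair_graph G by fact
  show "finite (pverts G)" by simp
  show "parcs G \<subseteq> pverts G \<times> pverts G" by (auto intro: in_arcsD1 in_arcsD2)
  show "sym (parcs G)" using pair_sym_arcs by (simp add: symmetric_def)
  show "irrefl (parcs G)" using pair_no_loops by (fastforce simp: irrefl_def)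
qed

lemma pair_graph_sym: "pair_graph G \<Longrightarrow> (x, y) \<in> parcs G \<longleftrightarrow> (y, x) \<in> parcs G"
  using pair_graphD(3) by (auto simp: sym_def)

lemma pair_graphI:
  assumes "finite (pverts G)" "parcs G \<subseteq> pverts G \<times> pverts G" "sym (parcs G)" "irrefl (parcs G)"
  shows "pair_graph G"
proof unfold_locales
  show "finite (parcs G)" using assms(1,2) finite_subset by blast
  show "symmetric (with_proj G)" using assms(3) by (simp add: symmetric_def)
  show "fst e \<noteq> snd e" if "e \<in> parcs G" for e
    using assms(4) that by (cases e) (auto simp: irrefl_def)
qed (use assms(1,2) in auto)

definition linked :: "'a pair_pre_digraph \<Rightarrow> bool" where
  "linked G \<longleftrightarrow> (\<forall>x\<in>pverts G. \<forall>y\<in>pverts G. (x, y) \<in> (parcs G)\<^sup>*)"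

definition restrict_to :: "'a pair_pre_digraph \<Rightarrow> 'a set \<Rightarrow> 'a pair_pre_digraph" where
  "restrict_to G P = \<lparr> pverts = P, parcs = parcs G \<inter> P \<times> P \<rparr>"

lemma restrict_to_simps [simp]:
  "pverts (restrict_to G P) = P" "parcs (restrict_to G P) = parcs G \<inter> P \<times> P"
  by (simp_all add: restrict_to_def)

lemma pair_graph_restrict_to:
  assumes "pair_graph G" "P \<subseteq> pverts G" shows "pair_graph (restrict_to G P)"
  by (rule pair_graphI) (use pair_graphD[OF assms(1)] assms(2) in
    \<open>auto simp: sym_def irrefl_def intro: finite_subset\<close>)

lemma linked_boundary:
  assumes "linked G" "x \<in> A" "y \<notin> A" "x \<in> pverts G" "y \<in> pverts G"
  obtains p q where "(p, q) \<in> parcs G" "p \<in> A" "q \<notin> A"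
proof -
  have "(x, y) \<in> (parcs G)\<^sup>*" using assms by (auto simp: linked_def)
  then have "y \<notin> A \<longrightarrow> (\<exists>p q. (p, q) \<in> parcs G \<and> p \<in> A \<and> q \<notin> A)"
    by (induction rule: rtrancl_induct) (use assms(2) in auto)
  then show thesis using assms(3) that by blast
qed

section \<open>Contraction of an edge\<close>

lemma pverts_contract_edge:
  assumes "pair_graph G" "(u, v) \<in> parcs G"
  shows "pverts (contract_edge u v G) = pverts G - {v}"
  using pair_graphD[OF assms(1)] assms(2)
  by (auto simp: contract_edge_def Let_def irrefl_def image_def)

lemma parcs_contract_edge:
  assumes "pair_graph G" "(u, v) \<in> parcs G"
  shows "(x, y) \<in> parcs (contract_edge u v G) \<longleftrightarrow> x \<noteq> v \<and> y \<noteq> v \<and> x \<noteq> y \<and>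
    ((x, y) \<in> parcs G \<or> x = u \<and> (v, y) \<in> parcs G \<or> y = u \<and> (v, x) \<in> parcs G)"
proof -
  note G = pair_graphD[OF assms(1)]
  have nvv: "(v, v) \<notin> parcs G" "u \<noteq> v" and s: "(a, b) \<in> parcs G \<longleftrightarrow> (b, a) \<in> parcs G" for a b
    using G(3,4) assms(2) by (auto simp: irrefl_def sym_def)
  have "(x, y) \<in> parcs (contract_edge u v G) \<longleftrightarrow> (\<exists>a b. (a, b) \<in> parcs G \<and>
      x = (if a = v then u else a) \<and> y = (if b = v then u else b) \<and> x \<noteq> y)"
    by (auto simp: contract_edge_def Let_def)
  also have "\<dots> \<longleftrightarrow> x \<noteq> v \<and> y \<noteq> v \<and> x \<noteq> y \<and>
    ((x, y) \<in> parcs G \<or> x = u \<and> (v, y) \<in> parcs G \<or> y = u \<and> (v, x) \<in> parcs G)" (is "?L \<longleftrightarrow> ?R")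
  proof
    assume ?L then show ?R using nvv s by (auto split: if_splits)
  next
    assume r: ?R
    then consider "(x, y) \<in> parcs G" | "x = u" "(v, y) \<in> parcs G" | "y = u" "(x, v) \<in> parcs G"
      using s by blast
    then show ?L
      by cases (use r nvv in \<open>auto intro: exI[of _ x] exI[of _ y] exI[of _ v]\<close>)
  qed
  finally show ?thesis .
qed

lemma pair_graph_contract_edge:
  assumes "pair_graph G" "(u, v) \<in> parcs G"
  shows "pair_graph (contract_edge u v G)"
proof (rule pair_graphI)
  note G = pair_graphD[OF assms(1)]
  show "finite (pverts (contract_edge u v G))" using G(1) by (simp add: pverts_contract_edge[OF assms])
  show "parcs (contract_edge u v G) \<subseteq> pverts (contract_edge u v G) \<times> pverts (contract_edge u v G)"
    using G(2) assms(2) by (auto simp: pverts_contract_edge[OF assms] parcs_contract_edge[OF assms])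
  show "sym (parcs (contract_edge u v G))"
    using symD[OF G(3)] by (auto simp: sym_def parcs_contract_edge[OF assms])
  show "irrefl (parcs (contract_edge u v G))"
    by (auto simp: irrefl_def parcs_contract_edge[OF assms])
qed

lemma linked_contract_edge:
  assumes "pair_graph G" "(u, v) \<in> parcs G" "linked G"
  shows "linked (contract_edge u v G)"
  unfolding linked_def
proof (intro ballI)
  fix x y assume xy: "x \<in> pverts (contract_edge u v G)" "y \<in> pverts (contract_edge u v G)"
  let ?f = "\<lambda>x. if x = v then u else x"
  have uv: "u \<noteq> v" using pair_graphD(4)[OF assms(1)] assms(2) by (auto simp: irrefl_def)
  have "(x, y) \<in> (parcs G)\<^sup>*"
    using assms(3) xy by (auto simp: linked_def pverts_contract_edge[OF assms(1,2)])
  then have "(?f x, ?f y) \<in> (parcs (contract_edge u v G))\<^sup>*"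
  proof (induction rule: rtrancl_induct)
    case (step y z)
    have e: "(a, b) \<in> parcs (contract_edge u v G)" if "a \<noteq> v" "b \<noteq> v" "a \<noteq> b"
      "(a, b) \<in> parcs G \<or> a = u \<and> (v, b) \<in> parcs G \<or> b = u \<and> (v, a) \<in> parcs G" for a b
      unfolding parcs_contract_edge[OF assms(1,2)] using that by blast
    have zy: "(z, y) \<in> parcs G" using step(2) pair_graph_sym[OF assms(1)] by blast
    consider "?f y = ?f z" | "?f y \<noteq> ?f z" "y = v" | "?f y \<noteq> ?f z" "z = v"
      | "?f y \<noteq> ?f z" "y \<noteq> v" "z \<noteq> v" by blast
    then show ?case
    proof cases
      case 1
      then show ?thesis using step.IH by simp
    next
      case 2
      then have "(?f y, ?f z) \<in> parcs (contract_edge u v G)" using e[of u z] step(2) uv by auto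
      then show ?thesis using step.IH by (rule rtrancl_into_rtrancl[rotated])
    next
      case 3
      then have "(?f y, ?f z) \<in> parcs (contract_edge u v G)" using e[of y u] zy uv by auto
      then show ?thesis using step.IH by (rule rtrancl_into_rtrancl[rotated])
    next
      case 4
      then have "(?f y, ?f z) \<in> parcs (contract_edge u v G)" using e[of y z] step(2) by auto
      then show ?thesis using step.IH by (rule rtrancl_into_rtrancl[rotated])
    qed
  qed simp
  then show "(x, y) \<in> (parcs (contract_edge u v G))\<^sup>*"
    using xy by (simp add: pverts_contract_edge[OF assms(1,2)])
qed

text \<open>Only contractions are allowed, not deletions. A part of the graph that contracts to the
  complete graph therefore does not settle the whole graph; connectedness is used to absorb the
  remaining vertices.\<close>

definition has_K4 :: "'a pair_pre_digraph \<Rightarrow> bool" where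
  "has_K4 G \<longleftrightarrow> (\<exists>K. contracts_to G K \<and> complete_digraph 4 (with_proj K))"

lemma contracts_to_trans: "contracts_to K L \<Longrightarrow> contracts_to G K \<Longrightarrow> contracts_to G L"
  by (induction rule: contracts_to.induct) (auto intro: contracts_to.step)

lemma has_K4_contract_edge:
  assumes "(u, v) \<in> parcs G" "has_K4 (contract_edge u v G)"
  shows "has_K4 G"
  using assms contracts_to_trans contracts_to.step[OF contracts_to.refl, of u v G]
  unfolding has_K4_def by blast

lemma card_pverts_contract_edge:
  assumes "pair_graph G" "(u, v) \<in> parcs G"
  shows "card (pverts G) = Suc (card (pverts (contract_edge u v G)))"
proof -
  have "v \<in> pverts G" using pair_graphD(2)[OF assms(1)] assms(2) by blast
  then show ?thesis
    unfolding pverts_contract_edge[OF assms] using card.remove[OF pair_graphD(1)[OF assms(1)]] by blast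
qed

text \<open>Everything outside \<open>P\<close> can be contracted into the cut vertex \<open>p\<close>.\<close>

lemma has_K4_if_restrict_to:
  assumes "pair_graph G" "linked G" "P \<subseteq> pverts G" "p \<in> P"
    and "\<And>x y. (x, y) \<in> parcs G \<Longrightarrow> x \<in> P \<Longrightarrow> y \<notin> P \<Longrightarrow> x = p"
    and "has_K4 (restrict_to G P)"
  shows "has_K4 G"
  using assms
proof (induction "card (pverts G)" arbitrary: G rule: less_induct)
  case less
  note G = pair_graphD[OF less.prems(1)]
  show ?case
  proof (cases "P = pverts G")
    case True
    then have "restrict_to G P = G" using G(2) by (auto simp: restrict_to_def Int_absorb2)
    then show ?thesis using less.prems(6) by simp
  next
    case False
    then obtain z where z: "z \<in> pverts G" "z \<notin> P" using less.prems(3) by blast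
    obtain p' q where q: "(p', q) \<in> parcs G" "p' \<in> P" "q \<notin> P"
      using linked_boundary[OF less.prems(2,4) z(2)] z(1) less.prems(3,4) by blast
    then have pq: "(p, q) \<in> parcs G" using less.prems(5) by blast
    let ?G = "contract_edge p q G"
    have "has_K4 ?G"
    proof (rule less.hyps)
      show "card (pverts ?G) < card (pverts G)"
        using card_pverts_contract_edge[OF less.prems(1) pq] by simp
      show "pair_graph ?G" "linked ?G"
        by (rule pair_graph_contract_edge[OF less.prems(1) pq])
          (rule linked_contract_edge[OF less.prems(1) pq less.prems(2)])
      show "P \<subseteq> pverts ?G" using less.prems(3) q(3)
        by (auto simp: pverts_contract_edge[OF less.prems(1) pq])
      show "x = p" if "(x, y) \<in> parcs ?G" "x \<in> P" "y \<notin> P" for x y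
        using that less.prems(4,5) q(3) by (auto simp: parcs_contract_edge[OF less.prems(1) pq])
      have "(x, y) \<in> parcs ?G \<longleftrightarrow> (x, y) \<in> parcs G" if "x \<in> P" "y \<in> P" for x y
      proof -
        have "x = p" if "(q, x) \<in> parcs G" "x \<in> P" for x
          using less.prems(5)[of x q] that q(3) symD[OF G(3)] by blast
        then show ?thesis using that q(3) G(4)
          by (auto simp: parcs_contract_edge[OF less.prems(1) pq] irrefl_def)
      qed
      then have "restrict_to ?G P = restrict_to G P" by (auto simp: restrict_to_def)
      then show "has_K4 (restrict_to ?G P)" using less.prems(6) by simp
    qed (rule less.prems(4))
    then show ?thesis by (rule has_K4_contract_edge[OF pq])
  qed
qed

text \<open>All vertices other than \<open>x\<close>, \<open>p\<close>, \<open>b\<close>,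
  \<open>c\<close> are contracted into \<open>x\<close> or \<open>p\<close>, which leaves the
  neighbourhoods of \<open>b\<close> and \<open>c\<close> alone. Connectedness outside
  \<open>{b, c}\<close> supplies the edges to contract and, at the end, the edge between
  \<open>x\<close> and \<open>p\<close>; the twins give the other five.\<close>

lemma has_K4_if_twins:
  assumes "pair_graph G" "linked (restrict_to G (pverts G - {b, c}))"
    and "x \<in> pverts G" "p \<in> pverts G" "x \<noteq> p" "b \<noteq> c" "x \<notin> {b, c}" "p \<notin> {b, c}"
    and "parcs G `` {b} = {x, c, p}" "parcs G `` {c} = {x, b, p}"
  shows "has_K4 G"
  using assms
proof (induction "card (pverts G)" arbitrary: G rule: less_induct)
  case less
  note G = pair_graphD[OF less.prems(1)]
  note ne = less.prems(5-8)
  have s: "(i, j) \<in> parcs G \<longleftrightarrow> (j, i) \<in> parcs G" for i j using symD[OF G(3)] by blast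
  have nb: "(b, i) \<in> parcs G \<longleftrightarrow> i \<in> {x, c, p}" and nc: "(c, i) \<in> parcs G \<longleftrightarrow> i \<in> {x, b, p}" for i
    using less.prems(9,10) by auto
  have bc: "b \<in> pverts G" "c \<in> pverts G" using nb[of c] G(2) by auto
  let ?H = "restrict_to G (pverts G - {b, c})"
  show ?case
  proof (cases "pverts G = {x, p, b, c}")
    case True
    obtain i j where "(i, j) \<in> parcs ?H" "i \<in> {x}" "j \<notin> {x}"
      by (rule linked_boundary[OF less.prems(2), of x "{x}" p]) (use less.prems(3-8) in auto)
    then have xp: "(x, p) \<in> parcs G" using True by auto
    have "parcs G = {(i, j). (i, j) \<in> pverts G \<times> pverts G \<and> i \<noteq> j}"
    proof (intro equalityI subrelI)
      fix i j assume "(i, j) \<in> parcs G"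
      then show "(i, j) \<in> {(i, j). (i, j) \<in> pverts G \<times> pverts G \<and> i \<noteq> j}"
        using G(2,4) by (auto simp: irrefl_def)
    next
      fix i j assume "(i, j) \<in> {(i, j). (i, j) \<in> pverts G \<times> pverts G \<and> i \<noteq> j}"
      then have "i \<in> {x, p, b, c}" "j \<in> {x, p, b, c}" "i \<noteq> j" using True by auto
      then show "(i, j) \<in> parcs G" using nb[of i] nb[of j] nc[of i] nc[of j] xp s by auto
    qed
    moreover have "card (pverts G) = 4" using True ne by auto
    ultimately have "complete_digraph 4 (with_proj G)"
      using G(1) by (simp add: complete_digraph_pair_def)
    then show ?thesis unfolding has_K4_def using contracts_to.refl by blast
  next
    case False
    then obtain z where z: "z \<in> pverts G" "z \<notin> {x, p, b, c}"
      using less.prems(3,4) bc by blast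
    obtain y r where yr: "(y, r) \<in> parcs ?H" "y \<in> {x, p}" "r \<notin> {x, p}"
      by (rule linked_boundary[OF less.prems(2), of x "{x, p}" z]) (use less.prems(3-8) z in auto)
    then have yrE: "(y, r) \<in> parcs G" and r: "r \<in> pverts G" "r \<notin> {x, p, b, c}" by auto
    let ?G = "contract_edge y r G"
    have e: "(i, j) \<in> parcs ?G \<longleftrightarrow> i \<noteq> r \<and> j \<noteq> r \<and> i \<noteq> j \<and>
      ((i, j) \<in> parcs G \<or> i = y \<and> (r, j) \<in> parcs G \<or> j = y \<and> (r, i) \<in> parcs G)" for i j
      by (rule parcs_contract_edge[OF less.prems(1) yrE])
    have rb: "(r, b) \<notin> parcs G" "(r, c) \<notin> parcs G" using s nb nc r by auto
    have ybc: "y \<noteq> b" "y \<noteq> c" using yr(2) ne by auto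
    have "has_K4 ?G"
    proof (rule less.hyps)
      show "card (pverts ?G) < card (pverts G)"
        using card_pverts_contract_edge[OF less.prems(1) yrE] by simp
      show "pair_graph ?G" by (rule pair_graph_contract_edge[OF less.prems(1) yrE])
      show "x \<in> pverts ?G" "p \<in> pverts ?G" using less.prems(3,4) r
        by (auto simp: pverts_contract_edge[OF less.prems(1) yrE])
      show "parcs ?G `` {b} = {x, c, p}"
        using e[of b] nb rb ybc r ne by auto
      show "parcs ?G `` {c} = {x, b, p}"
        using e[of c] nc rb ybc r ne by auto
      have H: "pair_graph ?H" by (rule pair_graph_restrict_to[OF less.prems(1)]) auto
      have "linked (contract_edge y r ?H)" by (rule linked_contract_edge[OF H yr(1) less.prems(2)])
      moreover have "contract_edge y r ?H = restrict_to ?G (pverts ?G - {b, c})"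
      proof -
        have "pverts (contract_edge y r ?H) = pverts ?G - {b, c}"
          by (auto simp: pverts_contract_edge[OF H yr(1)] pverts_contract_edge[OF less.prems(1) yrE])
        moreover have "(i, j) \<in> parcs (contract_edge y r ?H)
            \<longleftrightarrow> (i, j) \<in> parcs (restrict_to ?G (pverts ?G - {b, c}))" for i j
          using G(2) ybc r yrE unfolding parcs_contract_edge[OF H yr(1)]
          by (auto simp: e pverts_contract_edge[OF less.prems(1) yrE])
        ultimately show ?thesis by (intro pair_pre_digraph.equality) (auto simp: restrict_to_def)
      qed
      ultimately show "linked (restrict_to ?G (pverts ?G - {b, c}))" by simp
    qed (use ne in auto)
    then show ?thesis by (rule has_K4_contract_edge[OF yrE])
  qed
qed

text \<open>Contracting an edge at the exempt vertex \<open>x\<close> lowers the degree only of common neighbours.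
  If every such contraction spoils the degree condition, there are adjacent neighbours \<open>b\<close>, \<open>c\<close>
  of \<open>x\<close> of degree 3, and either \<open>bc\<close> can be contracted or \<open>b\<close>, \<open>c\<close> are twins.\<close>

theorem has_K4_if_degree_ge_3:
  assumes "pair_graph G" "linked G" "x \<in> pverts G" "card (pverts G) \<ge> 2"
    and "\<And>v. v \<in> pverts G \<Longrightarrow> v \<noteq> x \<Longrightarrow> card (parcs G `` {v}) \<ge> 3"
  shows "has_K4 G"
  using assms
proof (induction "card (pverts G)" arbitrary: G x rule: less_induct)
  case less
  note G = pair_graphD[OF less.prems(1)]
  have s: "(i, j) \<in> parcs G \<longleftrightarrow> (j, i) \<in> parcs G" for i j using symD[OF G(3)] by blast
  have irr: "(i, i) \<notin> parcs G" for i using G(4) by (auto simp: irrefl_def)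
  have vert: "i \<in> pverts G" "j \<in> pverts G" if "(i, j) \<in> parcs G" for i j using that G(2) by auto
  have fin: "finite (parcs G `` {v})" for v
    by (rule finite_subset[OF _ G(1)]) (use G(2) in auto)
  have "\<exists>z. z \<in> pverts G \<and> z \<noteq> x"
  proof (rule ccontr)
    assume "\<not> ?thesis"
    then have "pverts G \<subseteq> {x}" by auto
    then have "card (pverts G) \<le> card {x}" by (intro card_mono) auto
    then show False using less.prems(4) by simp
  qed
  then obtain z where z: "z \<in> pverts G" "z \<noteq> x" by blast
  obtain a where a: "(x, a) \<in> parcs G"
    by (rule linked_boundary[OF less.prems(2), of x "{x}" z]) (use less.prems(3) z in auto)
  have big: "card (pverts G) \<ge> 3"
  proof -
    have "card (parcs G `` {z}) \<le> card (pverts G)" by (rule card_mono[OF G(1)]) (use G(2) in auto)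
    then show ?thesis using less.prems(5)[OF z] by linarith
  qed
  show ?case
  proof (cases "\<exists>a. (x, a) \<in> parcs G \<and> (\<forall>b. (x, b) \<in> parcs G \<and> (a, b) \<in> parcs G \<longrightarrow> card (parcs G `` {b}) \<noteq> 3)")
    case True
    then obtain a where a: "(x, a) \<in> parcs G"
      and no: "\<And>b. (x, b) \<in> parcs G \<Longrightarrow> (a, b) \<in> parcs G \<Longrightarrow> card (parcs G `` {b}) \<noteq> 3" by blast
    let ?G = "contract_edge x a G"
    note e = parcs_contract_edge[OF less.prems(1) a]
    note vs = pverts_contract_edge[OF less.prems(1) a]
    note c = card_pverts_contract_edge[OF less.prems(1) a]
    have "has_K4 ?G"
    proof (rule less.hyps[of ?G x])
      show "card (pverts ?G) < card (pverts G)" "card (pverts ?G) \<ge> 2" using c big by auto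
      show "pair_graph ?G" "linked ?G"
        by (rule pair_graph_contract_edge[OF less.prems(1) a])
          (rule linked_contract_edge[OF less.prems(1) a less.prems(2)])
      show "x \<in> pverts ?G" using less.prems(3) irr a by (auto simp: vs)
      fix v assume v: "v \<in> pverts ?G" "v \<noteq> x"
      then have v': "v \<in> pverts G" "v \<noteq> a" by (auto simp: vs)
      have d: "card (parcs G `` {v}) \<ge> 3" using less.prems(5) v' v(2) by blast
      \<comment> \<open>Only a common neighbour of \<open>x\<close> and \<open>a\<close> loses a
        neighbour, and by the choice of \<open>a\<close> it has degree at least 4. A vertex adjacent
        to \<open>a\<close> but not to \<open>x\<close> merely exchanges \<open>a\<close> for
        \<open>x\<close>.\<close>
      have N: "parcs ?G `` {v} = (if (v, a) \<in> parcs G then insert x (parcs G `` {v} - {a}) else parcs G `` {v})"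
        using v v' irr s a by (auto simp: e)
      show "card (parcs ?G `` {v}) \<ge> 3"
      proof (cases "(v, a) \<in> parcs G")
        case va: True
        show ?thesis
        proof (cases "(v, x) \<in> parcs G")
          case True
          then have "card (parcs G `` {v}) \<noteq> 3" using no[of v] va s by blast
          moreover have "insert x (parcs G `` {v} - {a}) = parcs G `` {v} - {a}"
            using True irr a by auto
          ultimately show ?thesis using d N va fin[of v] by (simp add: card_Diff_singleton)
        next
          case False
          then show ?thesis using d N va fin[of v] by (simp add: card_Diff_singleton)
        qed
      qed (use N d in simp)
    qed
    then show ?thesis by (rule has_K4_contract_edge[OF a])
  next
    case False
    then have step: "\<exists>b. (x, b) \<in> parcs G \<and> (a, b) \<in> parcs G \<and> card (parcs G `` {b}) = 3"
      if "(x, a) \<in> parcs G" for a using that by blast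
    obtain b where b: "(x, b) \<in> parcs G" "card (parcs G `` {b}) = 3" using step[OF a] by blast
    obtain c where c: "(x, c) \<in> parcs G" "(b, c) \<in> parcs G" "card (parcs G `` {c}) = 3"
      using step[OF b(1)] by blast
    have ne: "b \<noteq> c" "x \<noteq> b" "x \<noteq> c" using irr b c by auto
    have third: "\<exists>p. N = {i, j, p} \<and> p \<noteq> i \<and> p \<noteq> j"
      if "card N = 3" "i \<in> N" "j \<in> N" "i \<noteq> j" for N and i j :: 'a
    proof -
      have "finite N" using that(1) card_ge_0_finite[of N] by simp
      then have "card (N - {i, j}) = 1" using that by (simp add: card_Diff_subset)
      then obtain p where "N - {i, j} = {p}" by (auto simp: card_1_singleton_iff)
      then show ?thesis using that(2,3) by (intro exI[of _ p]) auto
    qed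
    obtain p where p: "parcs G `` {b} = {x, c, p}" "p \<noteq> x" "p \<noteq> c"
      using third[of "parcs G `` {b}" x c] b c s ne by auto
    obtain q where q: "parcs G `` {c} = {x, b, q}" "q \<noteq> x" "q \<noteq> b"
      using third[of "parcs G `` {c}" x b] c s ne by auto
    have nb: "(b, i) \<in> parcs G \<longleftrightarrow> i \<in> {x, c, p}" and nc: "(c, i) \<in> parcs G \<longleftrightarrow> i \<in> {x, b, q}" for i
      using p(1) q(1) by auto
    have pb: "p \<noteq> b" "q \<noteq> c" using nb[of p] nc[of q] irr by auto
    have V: "b \<in> pverts G" "c \<in> pverts G" "p \<in> pverts G" "q \<in> pverts G"
      using nb[of p] nc[of q] vert by auto
    show ?thesis
    proof (cases "p = q")
      case False
      \<comment> \<open>The only common neighbour of \<open>b\<close> and \<open>c\<close> is the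
        exempt vertex \<open>x\<close>, so this contraction lowers no other degree below 3; the
        merged vertex keeps the neighbours \<open>x\<close>, \<open>p\<close>,
        \<open>q\<close>.\<close>
      let ?G = "contract_edge b c G"
      note e = parcs_contract_edge[OF less.prems(1) c(2)]
      note vs = pverts_contract_edge[OF less.prems(1) c(2)]
      note cd = card_pverts_contract_edge[OF less.prems(1) c(2)]
      have "has_K4 ?G"
      proof (rule less.hyps[of ?G x])
        show "card (pverts ?G) < card (pverts G)" "card (pverts ?G) \<ge> 2" using cd big by auto
        show "pair_graph ?G" "linked ?G"
          by (rule pair_graph_contract_edge[OF less.prems(1) c(2)])
            (rule linked_contract_edge[OF less.prems(1) c(2) less.prems(2)])
        show "x \<in> pverts ?G" using less.prems(3) ne by (auto simp: vs)
        fix v assume v: "v \<in> pverts ?G" "v \<noteq> x"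
        then have v': "v \<in> pverts G" "v \<noteq> c" by (auto simp: vs)
        have d: "card (parcs G `` {v}) \<ge> 3" using less.prems(5) v' v(2) by blast
        consider "v = b" | "v = q" | "v \<noteq> b" "v \<noteq> q" by blast
        then show "card (parcs ?G `` {v}) \<ge> 3"
        proof cases
          case 1
          have "parcs ?G `` {v} = {x, p, q}" using 1 nb nc ne p q pb s by (auto simp: e)
          then show ?thesis using False p q by simp
        next
          case 2
          have "(q, b) \<notin> parcs G" using nb[of q] s False q pb by auto
          have "(q, c) \<in> parcs G" using nc[of q] s by auto
          have "parcs ?G `` {v} = insert b (parcs G `` {q} - {c})"
            using 2 nc[of q] \<open>(q, b) \<notin> parcs G\<close> q pb s ne irr by (auto simp: e)
          moreover have "b \<notin> parcs G `` {q} - {c}" "c \<in> parcs G `` {q}"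
            using \<open>(q, b) \<notin> parcs G\<close> \<open>(q, c) \<in> parcs G\<close> by auto
          ultimately show ?thesis using d 2 fin[of q] by (simp add: card_Diff_singleton)
        next
          case 3
          have "(v, c) \<notin> parcs G" using nc[of v] 3 v s by auto
          then have "parcs ?G `` {v} = parcs G `` {v}"
            using 3 v' irr s by (auto simp: e)
          then show ?thesis using d by simp
        qed
      qed
      then show ?thesis by (rule has_K4_contract_edge[OF c(2)])
    next
      case True
      let ?H = "restrict_to G (pverts G - {b, c})"
      let ?P = "{v. (p, v) \<in> (parcs ?H)\<^sup>*}"
      have pH: "p \<in> pverts G - {b, c}" using V pb p by auto
      have symH: "(j, i) \<in> (parcs ?H)\<^sup>*" if "(i, j) \<in> (parcs ?H)\<^sup>*" for i j
      proof -
        have "sym (parcs ?H)" using G(3) by (auto simp: sym_def)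
        then show ?thesis using that sym_rtrancl by (metis symD)
      qed
      \<comment> \<open>A path from \<open>x\<close> that visits \<open>{b, c}\<close> leaves it
        through \<open>x\<close> or \<open>p\<close>, so every other vertex can be reached from one
        of these two without using \<open>b\<close> or \<open>c\<close>.\<close>
      have reach: "(x, v) \<in> (parcs ?H)\<^sup>* \<or> (p, v) \<in> (parcs ?H)\<^sup>*" if v: "v \<in> pverts G - {b, c}" for v
      proof -
        have "(x, v) \<in> (parcs G)\<^sup>*" using less.prems(2,3) v by (auto simp: linked_def)
        then have "v \<notin> {b, c} \<longrightarrow> (x, v) \<in> (parcs ?H)\<^sup>* \<or> (p, v) \<in> (parcs ?H)\<^sup>*"
        proof (induction rule: rtrancl_induct)
          case (step y z)
          show ?case
          proof
            assume z: "z \<notin> {b, c}"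
            show "(x, z) \<in> (parcs ?H)\<^sup>* \<or> (p, z) \<in> (parcs ?H)\<^sup>*"
            proof (cases "y \<in> {b, c}")
              case True
              then have "z = x \<or> z = p" using step(2) nb nc z \<open>p = q\<close> by auto
              then show ?thesis by auto
            next
              case False
              then have "(y, z) \<in> parcs ?H" using step(2) z vert by auto
              then show ?thesis using step.IH False by (meson rtrancl.rtrancl_into_rtrancl)
            qed
          qed
        qed simp
        then show ?thesis using v by blast
      qed
      show ?thesis
      proof (cases "x \<in> ?P")
        case xP: True
        have "linked ?H"
          unfolding linked_def
        proof (intro ballI)
          fix i j assume ij: "i \<in> pverts ?H" "j \<in> pverts ?H"
          have "(p, x) \<in> (parcs ?H)\<^sup>*" using xP by (rule CollectD)
          then have pv: "(p, v) \<in> (parcs ?H)\<^sup>*" if "v \<in> pverts G - {b, c}" for v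
            using reach[OF that] rtrancl_trans by metis
          have "i \<in> pverts G - {b, c}" "j \<in> pverts G - {b, c}" using ij by auto
          then show "(i, j) \<in> (parcs ?H)\<^sup>*" using rtrancl_trans[OF symH[OF pv] pv] by blast
        qed
        then show ?thesis
          by (rule has_K4_if_twins[OF less.prems(1)]) (use V less.prems(3) ne p q pb True in auto)
      next
        case xP: False
        have PV: "?P \<subseteq> pverts G - {b, c}"
        proof
          fix v assume "v \<in> ?P"
          then have "(p, v) \<in> (parcs ?H)\<^sup>*" by simp
          then show "v \<in> pverts G - {b, c}" by (induction rule: rtrancl_induct) (use pH in auto)
        qed
        have clos: "v \<in> ?P" if "u \<in> ?P" "(u, v) \<in> parcs G" "v \<notin> {b, c}" for u v
        proof -
          have "(u, v) \<in> parcs ?H" using that PV vert by auto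
          with CollectD[OF that(1)] have "(p, v) \<in> (parcs ?H)\<^sup>*" by (rule rtrancl_into_rtrancl)
          then show ?thesis by (rule CollectI)
        qed
        have bd: "u = p" if "(u, v) \<in> parcs G" "u \<in> ?P" "v \<notin> ?P" for u v
        proof -
          have "v \<in> {b, c}" using clos that by blast
          then have "u \<in> {x, c, p} \<union> {x, b, p}" using nb[of u] nc[of u] s that(1) True by auto
          then show ?thesis using xP PV that(2) by auto
        qed
        \<comment> \<open>All edges leaving the component \<open>?P\<close> start at
          \<open>p\<close>. Only \<open>p\<close> loses neighbours by the restriction, namely
          \<open>b\<close> and \<open>c\<close>, and it becomes the exempt vertex.\<close>
        have "has_K4 (restrict_to G ?P)"
        proof (rule less.hyps[of _ p])
          have "?P \<subset> pverts G" using PV V by auto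
          then show "card (pverts (restrict_to G ?P)) < card (pverts G)"
            using G(1) by (simp add: psubset_card_mono)
          show "pair_graph (restrict_to G ?P)"
            by (rule pair_graph_restrict_to[OF less.prems(1)]) (use PV in auto)
          show "p \<in> pverts (restrict_to G ?P)" by simp
          have inP: "(p, v) \<in> (parcs (restrict_to G ?P))\<^sup>*" if "v \<in> ?P" for v
          proof -
            from that have "(p, v) \<in> (parcs ?H)\<^sup>*" by simp
            then show ?thesis
            proof (induction rule: rtrancl_induct)
              case (step y z)
              then have "y \<in> ?P" "z \<in> ?P" using rtrancl_into_rtrancl[OF step(1,2)] by blast+
              then have "(y, z) \<in> parcs (restrict_to G ?P)" using step(2) by simp
              then show ?case using step.IH by (meson rtrancl.rtrancl_into_rtrancl)
            qed simp
          qed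
          have "sym (parcs (restrict_to G ?P))" using G(3) by (auto simp: sym_def)
          then have "sym ((parcs (restrict_to G ?P))\<^sup>*)" by (rule sym_rtrancl)
          then show "linked (restrict_to G ?P)"
            unfolding linked_def restrict_to_simps(1)[of G ?P]
            by (intro ballI) (rule rtrancl_trans[OF symD[OF _ inP] inP])
          have "\<exists>r. (p, r) \<in> parcs G \<and> r \<notin> {b, c}"
          proof (rule ccontr)
            assume "\<not> ?thesis"
            then have "parcs G `` {p} \<subseteq> {b, c}" by auto
            then have "card (parcs G `` {p}) \<le> card {b, c}" by (intro card_mono) auto
            also have "\<dots> = 2" using ne by simp
            finally show False using less.prems(5)[OF V(3) p(2)] by simp
          qed
          then obtain r where r: "(p, r) \<in> parcs G" "r \<notin> {b, c}" by blast
          then have "r \<in> ?P" using clos[of p r] by simp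
          then have "{p, r} \<subseteq> ?P" by simp
          moreover have "finite ?P" using PV G(1) by (meson finite_Diff finite_subset)
          ultimately have "card {p, r} \<le> card ?P" by (intro card_mono)
          moreover have "p \<noteq> r" using r irr by auto
          ultimately show "2 \<le> card (pverts (restrict_to G ?P))" by simp
          fix v assume v: "v \<in> pverts (restrict_to G ?P)" "v \<noteq> p"
          then have vP: "v \<in> ?P" by simp
          have "w \<in> ?P" if "(v, w) \<in> parcs G" for w using bd[OF that vP] v(2) by blast
          then have "parcs (restrict_to G ?P) `` {v} = parcs G `` {v}" using vP by auto
          moreover have "v \<noteq> x" "v \<in> pverts G" using vP xP PV by auto
          ultimately show "3 \<le> card (parcs (restrict_to G ?P) `` {v})" using less.prems(5) by simp
        qed
        then show ?thesis
          by (intro has_K4_if_restrict_to[OF less.prems(1,2), of ?P p]) (use PV bd in auto)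
      qed
    qed
  qed
qed

section \<open>Interval constraints on the edges of a graph\<close>

lemma convex_real_between:
  fixes S :: "real set"
  assumes "convex S" "a \<in> S" "b \<in> S" "a \<le> c" "c \<le> b"
  shows "c \<in> S"
proof (cases "a = b")
  case False
  then have ab: "b - a > 0" using assms by simp
  let ?u = "(c - a) / (b - a)"
  have "(1 - ?u) *\<^sub>R a + ?u *\<^sub>R b \<in> S"
    using assms ab by (intro convexD_alt) (auto simp: field_simps)
  moreover have "(1 - x) *\<^sub>R a + x *\<^sub>R b = a + x * (b - a)" for x by (simp add: algebra_simps)
  ultimately have "a + ?u * (b - a) \<in> S" by metis
  then show ?thesis using ab by simp
qed (use assms in simp)

text \<open>Of three points chosen in the pairwise intersections, the middle one also lies in the
  remaining set.\<close>

lemma convex_real_Int3: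
  fixes A B C :: "real set"
  assumes conv: "convex A" "convex B" "convex C"
    and ne: "A \<inter> B \<noteq> {}" "B \<inter> C \<noteq> {}" "A \<inter> C \<noteq> {}"
  shows "A \<inter> B \<inter> C \<noteq> {}"
proof -
  obtain x y z where xyz: "x \<in> A" "x \<in> B" "y \<in> B" "y \<in> C" "z \<in> A" "z \<in> C" using ne by blast
  have btw: "c \<in> S" if "convex S" "a \<in> S" "b \<in> S" "a \<le> c \<and> c \<le> b \<or> b \<le> c \<and> c \<le> a" for S :: "real set" and a b c
    using that convex_real_between by blast
  consider "y \<le> x \<and> x \<le> z \<or> z \<le> x \<and> x \<le> y" | "x \<le> y \<and> y \<le> z \<or> z \<le> y \<and> y \<le> x"
    | "x \<le> z \<and> z \<le> y \<or> y \<le> z \<and> z \<le> x" by linarith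
  then show ?thesis
  proof cases
    case 1 then have "x \<in> C" by (rule btw[OF conv(3) xyz(4,6)]) then show ?thesis using xyz by blast
  next
    case 2 then have "y \<in> A" by (rule btw[OF conv(1) xyz(1,5)]) then show ?thesis using xyz by blast
  next
    case 3 then have "z \<in> B" by (rule btw[OF conv(2) xyz(2,3)]) then show ?thesis using xyz by blast
  qed
qed

text \<open>Intersecting all members with a fixed one keeps the pairwise intersections nonempty, by
  the case of three sets.\<close>

lemma convex_real_Inter:
  fixes F :: "real set set"
  assumes "finite F" "F \<noteq> {}" "\<And>A. A \<in> F \<Longrightarrow> convex A"
    and "\<And>A B. A \<in> F \<Longrightarrow> B \<in> F \<Longrightarrow> A \<inter> B \<noteq> {}"
  shows "\<Inter>F \<noteq> {}"
  using assms
proof (induction "card F" arbitrary: F rule: less_induct)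
  case less
  obtain A where A: "A \<in> F" using less.prems by blast
  show ?case
  proof (cases "F = {A}")
    case True then show ?thesis using less.prems(4)[OF A A] by simp
  next
    case False
    let ?F = "(\<lambda>B. A \<inter> B) ` (F - {A})"
    have "card ?F \<le> card (F - {A})" using less.prems(1) by (intro card_image_le) auto
    also have "\<dots> < card F" using less.prems(1) A by (rule card_Diff1_less)
    finally have "\<Inter>?F \<noteq> {}"
    proof (rule less.hyps)
      show "finite ?F" using less.prems(1) by simp
      show "?F \<noteq> {}" using False A by blast
      show "convex S" if "S \<in> ?F" for S using that less.prems(3) A by (auto intro: convex_Int)
      fix S S' assume "S \<in> ?F" "S' \<in> ?F"
      then obtain B B' where B: "B \<in> F" "B' \<in> F" "S = A \<inter> B" "S' = A \<inter> B'" by blast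
      have "A \<inter> B \<inter> B' \<noteq> {}"
        by (intro convex_real_Int3) (use less.prems(3,4) A B in auto)
      then show "S \<inter> S' \<noteq> {}" using B by blast
    qed
    moreover have "\<Inter>?F \<subseteq> \<Inter>F" using False A by blast
    ultimately show ?thesis by blast
  qed
qed

section \<open>Completion with edge entries in prescribed intervals\<close>

definition realizes ::
  "('a \<Rightarrow> real) \<Rightarrow> ('a \<Rightarrow> 'a \<Rightarrow> real set) \<Rightarrow> 'a set \<Rightarrow> ('a \<times> 'a) set \<Rightarrow> ('a \<Rightarrow> 'a \<Rightarrow> real) \<Rightarrow> bool" where
  "realizes \<delta> I S P N \<longleftrightarrow> psd_on S N \<and> (\<forall>v\<in>S. N v v = \<delta> v) \<and> (\<forall>(x, y)\<in>P. N x y \<in> I x y)"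

lemma realizesD:
  assumes "realizes \<delta> I S P N"
  shows "psd_on S N" "\<And>v. v \<in> S \<Longrightarrow> N v v = \<delta> v" "\<And>x y. (x, y) \<in> P \<Longrightarrow> N x y \<in> I x y"
  using assms by (auto simp: realizes_def)

lemma realizesI:
  assumes "psd_on S N" "\<And>v. v \<in> S \<Longrightarrow> N v v = \<delta> v" "\<And>x y. (x, y) \<in> P \<Longrightarrow> N x y \<in> I x y"
  shows "realizes \<delta> I S P N"
  using assms by (auto simp: realizes_def)

lemma convex_realizes:
  assumes "\<And>x y. (x, y) \<in> P \<Longrightarrow> convex (I x y)"
  shows "convex {N p q | N. realizes \<delta> I S P N}"
  unfolding convex_alt
proof (intro ballI allI impI)
  fix x y u :: real
  assume "x \<in> {N p q | N. realizes \<delta> I S P N}" "y \<in> {N p q | N. realizes \<delta> I S P N}" and u: "0 \<le> u \<and> u \<le> 1"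
  then obtain N1 N2 where N: "realizes \<delta> I S P N1" "realizes \<delta> I S P N2" "x = N1 p q" "y = N2 p q" by blast
  let ?N = "\<lambda>i j. (1 - u) * N1 i j + u * N2 i j"
  have "realizes \<delta> I S P ?N"
  proof (rule realizesI)
    show "psd_on S ?N" using u realizesD(1)[OF N(1)] realizesD(1)[OF N(2)]
      by (intro psd_on_add psd_on_scale) auto
    show "?N v v = \<delta> v" if "v \<in> S" for v
      using realizesD(2)[OF N(1) that] realizesD(2)[OF N(2) that] by (simp add: algebra_simps)
    show "?N i j \<in> I i j" if "(i, j) \<in> P" for i j
      using convexD_alt[OF assms[OF that] realizesD(3)[OF N(1) that] realizesD(3)[OF N(2) that], of u] u
      by simp
  qed
  then show "(1 - u) *\<^sub>R x + u *\<^sub>R y \<in> {N p q | N. realizes \<delta> I S P N}"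
    using N(3,4) by auto
qed

text \<open>A vertex of degree 2 is contracted into one of its neighbours; the values that its two edges
  allow between the neighbours form an interval. It meets the interval of the edge between the
  neighbours, and both meet the values allowed by a longer cycle through that edge, so all
  three have a common point.\<close>

theorem realizable_if_cycles_realizable:
  assumes "pair_graph G" "linked G" "\<not> has_K4 G" "\<And>v. v \<in> pverts G \<Longrightarrow> \<delta> v \<ge> 0"
    and "\<And>x y. (x, y) \<in> parcs G \<Longrightarrow> convex (I x y) \<and> I x y \<noteq> {} \<and> I x y = I y x"
    and "\<And>x y a. (x, y) \<in> parcs G \<Longrightarrow> a \<in> I x y \<Longrightarrow> a\<^sup>2 \<le> \<delta> x * \<delta> y"
    and "\<And>vs. cycle_in (parcs G) vs \<Longrightarrow> \<exists>N. realizes \<delta> I (set vs) (cyc_pairs vs) N"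
  shows "\<exists>N. realizes \<delta> I (pverts G) (parcs G) N"
  using assms
proof (induction "card (pverts G)" arbitrary: G I rule: less_induct)
  case less
  note G = pair_graphD[OF less.prems(1)]
  have s: "(i, j) \<in> parcs G \<longleftrightarrow> (j, i) \<in> parcs G" for i j by (rule pair_graph_sym[OF less.prems(1)])
  have irr: "(i, i) \<notin> parcs G" for i using G(4) by (auto simp: irrefl_def)
  have vert: "i \<in> pverts G" "j \<in> pverts G" if "(i, j) \<in> parcs G" for i j using that G(2) by auto
  note \<delta> = less.prems(4)
  have conv: "convex (I x y)" and ne: "I x y \<noteq> {}" and symI: "I x y = I y x" if "(x, y) \<in> parcs G" for x y
    using less.prems(5)[OF that] by auto
  note minor = less.prems(6)
  note cyc = less.prems(7)
  have edge: "psd_on {x, y} (\<lambda>i j. if i = j then \<delta> i else a)" if "(x, y) \<in> parcs G" "a \<in> I x y" for x y a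
    by (rule psd_on_pair) (use that minor[OF that] \<delta> vert[OF that(1)] irr in auto)
  show ?case
  proof (cases "card (pverts G) \<ge> 2")
    case False
    then have "pverts G = {} \<or> (\<exists>v. pverts G = {v})" using G(1)
      by (metis One_nat_def card_1_singletonE card_0_eq less_2_cases not_le)
    then have "psd_on (pverts G) (\<lambda>i j. \<delta> i)"
      using \<delta> psd_on_singleton[of "\<lambda>i j. \<delta> i"] by (auto simp: psd_on_def)
    moreover have "parcs G = {}" using \<open>pverts G = {} \<or> _\<close> G(2) irr by auto
    ultimately show ?thesis by (intro exI[of _ "\<lambda>i j. \<delta> i"] realizesI) auto
  next
    case True
    then obtain x where x: "x \<in> pverts G" by fastforce
    have "\<not> (\<forall>v\<in>pverts G. v \<noteq> x \<longrightarrow> card (parcs G `` {v}) \<ge> 3)"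
      using has_K4_if_degree_ge_3[OF less.prems(1,2) x True] less.prems(3) by blast
    then obtain v where v: "v \<in> pverts G" "v \<noteq> x" "card (parcs G `` {v}) \<le> 2" by fastforce
    obtain u where u: "(v, u) \<in> parcs G"
      by (rule linked_boundary[OF less.prems(2), of v "{v}" x]) (use v x in auto)
    then have uv: "(u, v) \<in> parcs G" using s by blast
    have ne_uv: "u \<noteq> v" using u irr by auto
    let ?G = "contract_edge u v G"
    note e = parcs_contract_edge[OF less.prems(1) uv]
    note vs = pverts_contract_edge[OF less.prems(1) uv]
    have G': "pair_graph ?G" "linked ?G" "\<not> has_K4 ?G" "card (pverts ?G) < card (pverts G)"
      using pair_graph_contract_edge[OF less.prems(1) uv] linked_contract_edge[OF less.prems(1) uv less.prems(2)]
        has_K4_contract_edge[OF uv] less.prems(3) card_pverts_contract_edge[OF less.prems(1) uv] by auto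
    have finv: "finite (parcs G `` {v})" by (rule finite_subset[OF _ G(1)]) (use G(2) in auto)
    show ?thesis
    proof (cases "parcs G `` {v} = {u}")
      case deg1: True
      then have nv: "(v, y) \<in> parcs G \<longleftrightarrow> y = u" for y by auto
      have sub: "(i, j) \<in> parcs ?G \<longleftrightarrow> (i, j) \<in> parcs G \<and> i \<noteq> v \<and> j \<noteq> v" for i j
        using nv irr by (auto simp: e)
      have "\<exists>N. realizes \<delta> I (pverts ?G) (parcs ?G) N"
      proof (rule less.hyps[OF G'(4,1,2,3)])
        show "\<delta> v \<ge> 0" if "v \<in> pverts ?G" for v using that \<delta> by (simp add: vs)
        show "convex (I x y) \<and> I x y \<noteq> {} \<and> I x y = I y x" if "(x, y) \<in> parcs ?G" for x y
          using that less.prems(5) sub by blast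
        show "a\<^sup>2 \<le> \<delta> x * \<delta> y" if "(x, y) \<in> parcs ?G" "a \<in> I x y" for x y a
          using that minor sub by blast
        show "\<exists>N. realizes \<delta> I (set vs) (cyc_pairs vs) N" if "cycle_in (parcs ?G) vs" for vs
        proof (rule cyc)
          have "parcs ?G \<subseteq> parcs G" using sub by auto
          then show "cycle_in (parcs G) vs" using that by (auto simp: cycle_in_def)
        qed
      qed
      then obtain N where N: "realizes \<delta> I (pverts ?G) (parcs ?G) N" by blast
      obtain a where a: "a \<in> I u v" using ne[OF uv] by blast
      let ?P = "\<lambda>i j. if i = j then \<delta> i else a"
      have int: "pverts ?G \<inter> {u, v} = {u}" using vert[OF uv] ne_uv by (auto simp: vs)
      have fin: "finite (pverts ?G)" "finite {u, v}" using G(1) by (auto simp: vs)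
      have agree: "N i j = ?P i j" if "i \<in> pverts ?G \<inter> {u, v}" "j \<in> pverts ?G \<inter> {u, v}" for i j
        using that realizesD(2)[OF N, of u] int by auto
      obtain K where K: "psd_on (pverts ?G \<union> {u, v}) K"
        "\<And>i j. i \<in> pverts ?G \<Longrightarrow> j \<in> pverts ?G \<Longrightarrow> K i j = N i j"
        "\<And>i j. i \<in> {u, v} \<Longrightarrow> j \<in> {u, v} \<Longrightarrow> K i j = ?P i j"
        using psd_on_glue[OF fin realizesD(1)[OF N] edge[OF uv a] agree] by blast
      have V: "pverts ?G \<union> {u, v} = pverts G" using vert[OF uv] by (auto simp: vs)
      have "realizes \<delta> I (pverts G) (parcs G) K"
      proof (rule realizesI)
        show "psd_on (pverts G) K" using K(1) V by simp
        show "K i i = \<delta> i" if "i \<in> pverts G" for i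
          using that K(2)[of i i] K(3)[of i i] realizesD(2)[OF N, of i] by (cases "i = v") (auto simp: vs)
        show "K i j \<in> I i j" if ij: "(i, j) \<in> parcs G" for i j
        proof (cases "i = v \<or> j = v")
          case True
          then have "i = v \<and> j = u \<or> i = u \<and> j = v" using ij nv s by blast
          moreover have "K u v = a" "K v u = a" using K(3)[of u v] K(3)[of v u] ne_uv by auto
          moreover have "a \<in> I v u" using a symI[OF uv] by blast
          ultimately show ?thesis using a by metis
        next
          case False
          then have "(i, j) \<in> parcs ?G" using ij sub by simp
          then show ?thesis using K(2)[of i j] realizesD(3)[OF N] False vert[OF ij] by (simp add: vs)
        qed
      qed
      then show ?thesis by blast
    next
      case False
      then obtain w where w: "(v, w) \<in> parcs G" "w \<noteq> u" using u by blast
      have Nv: "parcs G `` {v} = {u, w}"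
        using card_seteq[OF finv, of "{u, w}"] v(3) u w by (simp add: eq_commute)
      then have nv: "(v, y) \<in> parcs G \<longleftrightarrow> y = u \<or> y = w" for y by auto
      have wv: "w \<noteq> v" "u \<noteq> w" "(w, v) \<in> parcs G" using w irr s by auto
      have e': "(i, j) \<in> parcs ?G \<longleftrightarrow> i \<noteq> v \<and> j \<noteq> v \<and> ((i, j) \<in> parcs G \<or> (i = u \<and> j = w) \<or> (i = w \<and> j = u))" for i j
        using nv irr wv unfolding e by auto
      \<comment> \<open>The values that the two edges at \<open>v\<close> allow for the pair
        \<open>u\<close>, \<open>w\<close>. After the contraction they constrain the edge between
        \<open>u\<close> and \<open>w\<close>, together with \<open>I u w\<close> if that edge was
        already present.\<close>
      define J where "J = {M u w | M. realizes \<delta> I {u, v, w} {(u, v), (v, w)} M}"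
      define I' where "I' x y = (if x = u \<and> y = w \<or> x = w \<and> y = u
        then if (u, w) \<in> parcs G then I u w \<inter> J else J else I x y)" for x y
      have convJ: "convex J" unfolding J_def
        by (rule convex_realizes) (use conv[OF uv] conv[OF w(1)] in auto)
      have Jminor: "a\<^sup>2 \<le> \<delta> u * \<delta> w" if "a \<in> J" for a
      proof -
        obtain M where M: "realizes \<delta> I {u, v, w} {(u, v), (v, w)} M" "a = M u w"
          using \<open>a \<in> J\<close> by (auto simp: J_def)
        show ?thesis using psd_on_minor[OF _ realizesD(1)[OF M(1)], of u w]
          realizesD(2)[OF M(1), of u] realizesD(2)[OF M(1), of w] M(2) by simp
      qed
      have Jne: "J \<noteq> {}"
      proof -
        obtain a b where ab: "a \<in> I u v" "b \<in> I v w" using ne[OF uv] ne[OF w(1)] by blast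
        have int: "{u, v} \<inter> {v, w} = {v}" using wv ne_uv by auto
        obtain K where K: "psd_on ({u, v} \<union> {v, w}) K"
          "\<And>i j. i \<in> {u, v} \<Longrightarrow> j \<in> {u, v} \<Longrightarrow> K i j = (if i = j then \<delta> i else a)"
          "\<And>i j. i \<in> {v, w} \<Longrightarrow> j \<in> {v, w} \<Longrightarrow> K i j = (if i = j then \<delta> i else b)"
          by (rule psd_on_glue[OF _ _ edge[OF uv ab(1)] edge[OF w(1) ab(2)]])
            (use int in \<open>auto split: if_splits\<close>)
        have "realizes \<delta> I {u, v, w} {(u, v), (v, w)} K"
          by (rule realizesI) (use K ab wv ne_uv in \<open>auto simp: insert_commute\<close>)
        then show ?thesis by (auto simp: J_def)
      qed
      have IJ: "I u w \<inter> J \<noteq> {}" if uw: "(u, w) \<in> parcs G"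
      proof -
        have "cyc_pairs [u, v, w] = {(u, v), (v, w), (w, u)}" by (auto simp: cyc_pairs_def)
        moreover have "cycle_in (parcs G) [u, v, w]"
          using uv w uw wv ne_uv s by (auto simp: cycle_in_def cyc_pairs_def)
        ultimately obtain N where N: "realizes \<delta> I (set [u, v, w]) {(u, v), (v, w), (w, u)} N"
          using cyc[of "[u, v, w]"] by auto
        have "realizes \<delta> I {u, v, w} {(u, v), (v, w)} N" using N by (auto simp: realizes_def)
        moreover have "N u w \<in> I u w"
          using realizesD(3)[OF N, of w u] psd_on_sym[OF realizesD(1)[OF N], of u w] symI[OF uw] by simp
        ultimately show ?thesis by (auto simp: J_def)
      qed
      have I'convex: "convex (I' x y)" if "(x, y) \<in> parcs ?G" for x y
        using that convJ conv unfolding e' I'_def by (auto intro: convex_Int)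
      have cycle': "\<exists>N. realizes \<delta> I' (set xs) (cyc_pairs xs) N"
        if xs: "cycle_in (parcs ?G) xs" and pq: "p = u \<and> q = w \<or> p = w \<and> q = u"
          and mem: "(p, q) \<in> cyc_pairs xs" for xs p q
      proof -
        have d: "distinct xs" "length xs \<ge> 3" "cyc_pairs xs \<subseteq> parcs ?G" using xs by (auto simp: cycle_in_def)
        \<comment> \<open>Rotated so that the edge between \<open>u\<close> and \<open>w\<close>
          closes the cycle; \<open>consec ys\<close> is then a path of edges of
          \<open>G\<close>.\<close>
        obtain ys where ys: "cyc_pairs ys = cyc_pairs xs" "set ys = set xs" "distinct ys = distinct xs"
          "length ys = length xs" "last ys = p" "hd ys = q"
          by (rule cyc_pairs_rotate[OF mem]) (use d in auto)
        have yne: "ys \<noteq> []" using ys(4) d(2) by auto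
        have dy: "distinct ys" "length ys \<ge> 3" using ys d by auto
        have vys: "v \<notin> set ys"
        proof
          assume "v \<in> set ys"
          then obtain i where "i < length ys" "v = ys ! i" by (auto simp: in_set_conv_nth)
          then have "(v, ys ! (Suc i mod length ys)) \<in> cyc_pairs ys" using cyc_pairs_nth[OF yne] by auto
          then show False using ys(1) d(3) e' by auto
        qed
        have cons: "(i, j) \<in> parcs G \<and> \<not> (i = u \<and> j = w \<or> i = w \<and> j = u)" if ij: "(i, j) \<in> consec ys" for i j
        proof -
          obtain k where k: "Suc k < length ys" "i = ys ! k" "j = ys ! Suc k"
            using ij by (auto simp: consec_nth)
          have l: "p = ys ! (length ys - 1)" "q = ys ! 0"
            using ys(5,6) yne by (auto simp: last_conv_nth hd_conv_nth)
          have "\<not> (i = q \<and> j = p)"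
          proof
            assume "i = q \<and> j = p"
            then have "ys ! k = ys ! 0" "ys ! Suc k = ys ! (length ys - 1)" using k l by auto
            then have "k = 0" "Suc k = length ys - 1"
              using k(1) dy yne by (auto simp: nth_eq_iff_index_eq)
            then show False using dy by simp
          qed
          moreover have "\<not> (i = p \<and> j = q)"
          proof
            assume "i = p \<and> j = q"
            then have "ys ! Suc k = ys ! 0" using k l by auto
            then show False using k(1) dy yne by (auto simp: nth_eq_iff_index_eq)
          qed
          moreover have "(i, j) \<in> cyc_pairs ys" using ij by (simp add: cyc_pairs_def)
          then have "(i, j) \<in> parcs ?G" using ys(1) d(3) by blast
          ultimately show ?thesis using pq e' by blast
        qed
        \<comment> \<open>The values that the rest of the cycle allows for the pair.
          \<open>L\<close> meets \<open>J\<close> by the cycle with \<open>v\<close> inserted. If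
          \<open>u\<close> and \<open>w\<close> are adjacent in \<open>G\<close>, then
          \<open>L\<close> meets \<open>I u w\<close> by the cycle itself, and \<open>I u w\<close>
          meets \<open>J\<close> by the triangle with \<open>v\<close>.\<close>
        define L where "L = {N p q | N. realizes \<delta> I (set ys) (consec ys) N}"
        have convL: "convex L" unfolding L_def by (rule convex_realizes) (use cons conv in blast)
        have pv: "(p, v) \<in> parcs G" "(v, q) \<in> parcs G" using pq uv u w wv by auto
        have pqys: "p \<in> set ys" "q \<in> set ys" using ys(5,6) yne by auto
        have LJ: "L \<inter> J \<noteq> {}"
        proof -
          have cp: "cyc_pairs (ys @ [v]) = consec ys \<union> {(p, v), (v, q)}"
            using yne ys(5,6) by (auto simp: cyc_pairs_def consec_append)
          have "cycle_in (parcs G) (ys @ [v])"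
            unfolding cycle_in_def cp using cons pv dy vys by auto
          then obtain N where N: "realizes \<delta> I (set (ys @ [v])) (consec ys \<union> {(p, v), (v, q)}) N"
            using cyc cp by metis
          note R = realizesD[OF N]
          have "realizes \<delta> I (set ys) (consec ys) N"
            by (rule realizesI) (use R psd_on_subset[OF _ _ R(1)] in auto)
          moreover have "N p q \<in> J"
          proof -
            have uw: "u \<in> set ys" "w \<in> set ys" using pq pqys by auto
            have sN: "N i j = N j i" if "i \<in> set (ys @ [v])" "j \<in> set (ys @ [v])" for i j
              by (rule psd_on_sym[OF R(1) that])
            have "N u v \<in> I u v \<and> N v w \<in> I v w"
            proof -
              have "N u v = N v u" "N v w = N w v" using sN[of u v] sN[of v w] uw by auto
              moreover have "N p v \<in> I p v" "N v q \<in> I v q" using R(3) by auto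
              ultimately show ?thesis using pq symI[OF uv] symI[OF w(1)] by metis
            qed
            then have "realizes \<delta> I {u, v, w} {(u, v), (v, w)} N"
              by (intro realizesI) (use R(2) uw psd_on_subset[OF _ _ R(1), of "{u, v, w}"] in auto)
            moreover have "N p q = N u w" using pq sN[of u w] uw by auto
            ultimately show ?thesis by (auto simp: J_def)
          qed
          ultimately show ?thesis by (auto simp: L_def)
        qed
        have "L \<inter> I' p q \<noteq> {}"
        proof (cases "(u, w) \<in> parcs G")
          case True
          have "L \<inter> I u w \<noteq> {}"
          proof -
            have cp: "cyc_pairs ys = consec ys \<union> {(p, q)}" using ys by (auto simp: cyc_pairs_def)
            have pqE: "(p, q) \<in> parcs G" using pq True s by blast
            have "cycle_in (parcs G) ys" unfolding cycle_in_def cp using cons dy pqE by auto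
            then obtain N where N: "realizes \<delta> I (set ys) (consec ys \<union> {(p, q)}) N" using cyc cp by metis
            have "realizes \<delta> I (set ys) (consec ys) N" using N by (auto simp: realizes_def)
            moreover have "N p q \<in> I u w" using realizesD(3)[OF N, of p q] pq symI[OF True] by auto
            ultimately show ?thesis by (auto simp: L_def)
          qed
          then have "L \<inter> I u w \<inter> J \<noteq> {}"
            using convex_real_Int3[OF convL conv[OF True] convJ] IJ[OF True] LJ by blast
          then show ?thesis using pq True by (auto simp: I'_def)
        next
          case False
          then show ?thesis using LJ pq by (auto simp: I'_def)
        qed
        then obtain N where N: "realizes \<delta> I (set ys) (consec ys) N" "N p q \<in> I' p q"
          by (auto simp: L_def)
        have "realizes \<delta> I' (set ys) (cyc_pairs ys) N"
        proof (rule realizesI)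
          show "N i j \<in> I' i j" if ij: "(i, j) \<in> cyc_pairs ys" for i j
          proof (cases "(i, j) \<in> consec ys")
            case True
            then have "I' i j = I i j" using cons[OF True] unfolding I'_def by (simp only: if_False)
            then show ?thesis using realizesD(3)[OF N(1) True] by simp
          next
            case False
            then have "i = p" "j = q" using ij ys(5,6) by (auto simp: cyc_pairs_def)
            then show ?thesis using N(2) by simp
          qed
        qed (use realizesD[OF N(1)] in auto)
        then show ?thesis using ys(1,2) by auto
      qed
      have "\<exists>N. realizes \<delta> I' (pverts ?G) (parcs ?G) N"
      proof (rule less.hyps[OF G'(4,1,2,3)])
        show "\<delta> v \<ge> 0" if "v \<in> pverts ?G" for v using that \<delta> by (simp add: vs)
        show "convex (I' x y) \<and> I' x y \<noteq> {} \<and> I' x y = I' y x" if xy: "(x, y) \<in> parcs ?G" for x y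
        proof (cases "x = u \<and> y = w \<or> x = w \<and> y = u")
          case True
          moreover have "y = u \<and> x = w \<or> y = w \<and> x = u" using True by blast
          ultimately have I': "I' x y = (if (u, w) \<in> parcs G then I u w \<inter> J else J)" "I' y x = I' x y"
            by (simp_all only: I'_def if_True)
          moreover have "I' x y \<noteq> {}" unfolding I'(1) using IJ Jne by (cases "(u, w) \<in> parcs G") simp_all
          ultimately show ?thesis using I'convex[OF xy] by blast
        next
          case False
          moreover have "\<not> (y = u \<and> x = w \<or> y = w \<and> x = u)" using False by blast
          ultimately have I': "I' x y = I x y" "I' y x = I y x" by (simp_all only: I'_def if_False)
          have "(x, y) \<in> parcs G" using xy e' False by blast
          then show ?thesis using less.prems(5)[of x y] unfolding I' by blast
        qed
        show "a\<^sup>2 \<le> \<delta> x * \<delta> y" if "(x, y) \<in> parcs ?G" "a \<in> I' x y" for x y a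
          using that Jminor[of a] minor[of x y a] unfolding e' I'_def
          by (auto split: if_splits simp: mult.commute)
        show "\<exists>N. realizes \<delta> I' (set xs) (cyc_pairs xs) N" if xs: "cycle_in (parcs ?G) xs" for xs
        proof (cases "(u, w) \<in> cyc_pairs xs \<or> (w, u) \<in> cyc_pairs xs")
          case True
          then show ?thesis using cycle'[OF xs, of u w] cycle'[OF xs, of w u] by blast
        next
          case False
          have eq: "I' i j = I i j \<and> (i, j) \<in> parcs G" if "(i, j) \<in> cyc_pairs xs" for i j
            using that False xs e'[of i j] unfolding cycle_in_def I'_def by auto
          then have "cyc_pairs xs \<subseteq> parcs G" by auto
          then have "cycle_in (parcs G) xs" using xs by (simp add: cycle_in_def)
          then obtain N where N: "realizes \<delta> I (set xs) (cyc_pairs xs) N" using cyc by blast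
          have "realizes \<delta> I' (set xs) (cyc_pairs xs) N"
            by (rule realizesI) (use realizesD[OF N] eq in auto)
          then show ?thesis by blast
        qed
      qed
      then obtain N where N: "realizes \<delta> I' (pverts ?G) (parcs ?G) N" by blast
      have "N u w \<in> I' u w" using realizesD(3)[OF N, of u w] e' wv ne_uv by auto
      then have "N u w \<in> J" by (auto simp: I'_def split: if_splits)
      then obtain M where M: "realizes \<delta> I {u, v, w} {(u, v), (v, w)} M" "N u w = M u w"
        by (auto simp: J_def)
      have uwV: "u \<in> pverts ?G" "w \<in> pverts ?G" using vert[OF uv] vert[OF w(1)] ne_uv wv by (auto simp: vs)
      have int: "pverts ?G \<inter> {u, v, w} = {u, w}" using uwV by (auto simp: vs)
      have fin: "finite (pverts ?G)" "finite {u, v, w}" using G(1) by (auto simp: vs)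
      have agree: "N i j = M i j" if "i \<in> pverts ?G \<inter> {u, v, w}" "j \<in> pverts ?G \<inter> {u, v, w}" for i j
        using that realizesD(2)[OF N, of u] realizesD(2)[OF N, of w]
          realizesD(2)[OF M(1), of u] realizesD(2)[OF M(1), of w] M(2) uwV
          psd_on_sym[OF realizesD(1)[OF N] uwV] psd_on_sym[OF realizesD(1)[OF M(1)], of u w]
        int by auto
      obtain K where K: "psd_on (pverts ?G \<union> {u, v, w}) K"
        "\<And>i j. i \<in> pverts ?G \<Longrightarrow> j \<in> pverts ?G \<Longrightarrow> K i j = N i j"
        "\<And>i j. i \<in> {u, v, w} \<Longrightarrow> j \<in> {u, v, w} \<Longrightarrow> K i j = M i j"
        using psd_on_glue[OF fin realizesD(1)[OF N] realizesD(1)[OF M(1)] agree] by blast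
      have V: "pverts ?G \<union> {u, v, w} = pverts G" using vert[OF uv] vert[OF w(1)] by (auto simp: vs)
      have "realizes \<delta> I (pverts G) (parcs G) K"
      proof (rule realizesI)
        show "psd_on (pverts G) K" using K(1) V by simp
        show "K i i = \<delta> i" if "i \<in> pverts G" for i
          using that K(2)[of i i] K(3)[of v v] realizesD(2)[OF N, of i] realizesD(2)[OF M(1), of v]
          by (cases "i = v") (auto simp: vs)
        show "K i j \<in> I i j" if ij: "(i, j) \<in> parcs G" for i j
        proof (cases "i = v \<or> j = v")
          case True
          have Muv: "M u v \<in> I u v" "M v w \<in> I v w" using realizesD(3)[OF M(1)] by auto
          have Msym: "M v u = M u v" "M w v = M v w" using psd_on_sym[OF realizesD(1)[OF M(1)]] by auto
          have "i = v \<and> j = u \<or> i = u \<and> j = v \<or> i = v \<and> j = w \<or> i = w \<and> j = v"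
            using True ij nv s by blast
          moreover have "K u v = M u v" "K v u = M u v" "K v w = M v w" "K w v = M v w"
            using K(3) Msym by auto
          moreover have "M u v \<in> I v u" "M v w \<in> I w v"
            using Muv symI[OF uv] symI[OF w(1)] by blast+
          ultimately show ?thesis using Muv by metis
        next
          case False
          then have ij': "(i, j) \<in> parcs ?G" using ij e' by simp
          have "I' i j \<subseteq> I i j"
          proof (cases "i = u \<and> j = w \<or> i = w \<and> j = u")
            case True
            then have uw: "(u, w) \<in> parcs G" using ij s by blast
            have "I' i j = I u w \<inter> J" using True uw by (simp only: I'_def if_True)
            moreover have "I u w = I i j" using True symI[OF uw] by metis
            ultimately show ?thesis by blast
          qed (simp only: I'_def if_False order_refl)
          moreover have "K i j = N i j" using K(2)[of i j] False vert[OF ij] by (simp add: vs)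
          ultimately show ?thesis using realizesD(3)[OF N ij'] by auto
        qed
      qed
      then show ?thesis by blast
    qed
  qed
qed

section \<open>Graphs glued from chordal blocks\<close>

text \<open>Made for parallel arcs: a pair carries several intervals, and solvability is known for
  each choice of one interval per pair. The pairs are switched to the full intersection one after
  the other; the values that the other pairs allow at the current one meet each of its intervals,
  and Helly's theorem yields a common point.\<close>

lemma realizes_Inter:
  assumes "finite P" and F: "\<And>x y. (x, y) \<in> P \<Longrightarrow> finite (F x y) \<and> F x y \<noteq> {}"
    and conv: "\<And>x y e. (x, y) \<in> P \<Longrightarrow> e \<in> F x y \<Longrightarrow> convex (J e)"
    and pairw: "\<And>x y e f. (x, y) \<in> P \<Longrightarrow> e \<in> F x y \<Longrightarrow> f \<in> F x y \<Longrightarrow> J e \<inter> J f \<noteq> {}"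
    and choice: "\<And>c. (\<And>x y. (x, y) \<in> P \<Longrightarrow> c x y \<in> F x y) \<Longrightarrow> \<exists>N. realizes \<delta> (\<lambda>x y. J (c x y)) S P N"
  shows "\<exists>N. realizes \<delta> (\<lambda>x y. \<Inter>(J ` F x y)) S P N"
proof -
  have "\<exists>N. realizes \<delta> (\<lambda>x y. if (x, y) \<in> Q then \<Inter>(J ` F x y) else J (c x y)) S P N"
    if "finite Q" "Q \<subseteq> P" "\<And>x y. (x, y) \<in> P \<Longrightarrow> c x y \<in> F x y" for Q c
    using that
  proof (induction Q arbitrary: c rule: finite_induct)
    case empty
    then show ?case using choice[of c] by simp
  next
    case (insert pq Q)
    obtain p q where pq: "pq = (p, q)" by (cases pq)
    have mem: "(p, q) \<in> P" "(p, q) \<notin> Q" using insert.prems(1) insert.hyps(2) pq by auto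
    define I where "I x y = (if (x, y) \<in> Q then \<Inter>(J ` F x y) else J (c x y))" for x y
    define L where "L = {N p q | N. realizes \<delta> I S (P - {(p, q)}) N}"
    have "convex L" unfolding L_def
    proof (rule convex_realizes)
      fix x y assume "(x, y) \<in> P - {(p, q)}"
      then show "convex (I x y)"
        using conv[of x y] insert.prems(2)[of x y] by (auto simp: I_def intro: convex_Inter)
    qed
    have LJ: "L \<inter> J e \<noteq> {}" if e: "e \<in> F p q" for e
    proof -
      define c' where "c' x y = (if (x, y) = (p, q) then e else c x y)" for x y
      have "\<exists>N. realizes \<delta> (\<lambda>x y. if (x, y) \<in> Q then \<Inter>(J ` F x y) else J (c' x y)) S P N"
        by (rule insert.IH) (use insert.prems e in \<open>auto simp: c'_def\<close>)
      then obtain N where N: "realizes \<delta> (\<lambda>x y. if (x, y) \<in> Q then \<Inter>(J ` F x y) else J (c' x y)) S P N"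
        by blast
      have "N p q \<in> J e" using realizesD(3)[OF N mem(1)] mem(2) by (simp add: c'_def)
      moreover have "realizes \<delta> I S (P - {(p, q)}) N"
      proof (rule realizesI)
        fix x y assume "(x, y) \<in> P - {(p, q)}"
        then show "N x y \<in> I x y" using realizesD(3)[OF N, of x y] by (auto simp: I_def c'_def)
      qed (use realizesD[OF N] in auto)
      ultimately show ?thesis by (auto simp: L_def)
    qed
    have "\<Inter>(insert L (J ` F p q)) \<noteq> {}"
    proof (rule convex_real_Inter)
      show "finite (insert L (J ` F p q))" using F[OF mem(1)] by simp
      show "convex A" if "A \<in> insert L (J ` F p q)" for A
        using that \<open>convex L\<close> conv[OF mem(1)] by auto
      show "A \<inter> B \<noteq> {}" if AB: "A \<in> insert L (J ` F p q)" "B \<in> insert L (J ` F p q)" for A B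
      proof -
        have "L \<noteq> {}" using LJ F[OF mem(1)] by blast
        then have L: "L \<inter> A \<noteq> {}" if "A \<in> insert L (J ` F p q)" for A using that LJ by blast
        show ?thesis
        proof (cases "A = L \<or> B = L")
          case True
          then show ?thesis using L AB by (metis Int_commute)
        next
          case False
          then show ?thesis using AB pairw[OF mem(1)] by blast
        qed
      qed
    qed auto
    then obtain b where "b \<in> L" "b \<in> \<Inter>(J ` F p q)" by auto
    then obtain N where N: "realizes \<delta> I S (P - {(p, q)}) N" "N p q \<in> \<Inter>(J ` F p q)"
      by (auto simp: L_def)
    have "realizes \<delta> (\<lambda>x y. if (x, y) \<in> insert pq Q then \<Inter>(J ` F x y) else J (c x y)) S P N"
    proof (rule realizesI)
      fix x y assume xy: "(x, y) \<in> P"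
      show "N x y \<in> (if (x, y) \<in> insert pq Q then \<Inter>(J ` F x y) else J (c x y))"
      proof (cases "(x, y) = (p, q)")
        case True
        then show ?thesis using N(2) pq by simp
      next
        case False
        then have "N x y \<in> I x y" using realizesD(3)[OF N(1)] xy by blast
        moreover have "(x, y) \<in> insert pq Q \<longleftrightarrow> (x, y) \<in> Q" using False pq by blast
          ultimately show ?thesis unfolding I_def by (simp only:)
      qed
    qed (use realizesD[OF N(1)] in auto)
    then show ?case by blast
  qed
  note all = this
  define c where "c x y = (SOME e. e \<in> F x y)" for x y
  have "c x y \<in> F x y" if "(x, y) \<in> P" for x y
    unfolding c_def using F[OF that] by (simp add: some_in_eq)
  then obtain N where N: "realizes \<delta> (\<lambda>x y. if (x, y) \<in> P then \<Inter>(J ` F x y) else J (c x y)) S P N"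
    using all[OF assms(1) order_refl] by blast
  have "realizes \<delta> (\<lambda>x y. \<Inter>(J ` F x y)) S P N"
    by (rule realizesI) (use realizesD[OF N] in \<open>auto split: if_splits\<close>)
  then show ?thesis by blast
qed

text \<open>From three vertices on, a cycle does not return along the same edge, so the arcs chosen
  along it are distinct.\<close>

lemma cyc_pairs_asym:
  assumes "distinct vs" "length vs \<ge> 3" "(v, w) \<in> cyc_pairs vs"
  shows "(w, v) \<notin> cyc_pairs vs"
proof
  assume wv: "(w, v) \<in> cyc_pairs vs"
  let ?n = "length vs"
  have ne: "vs \<noteq> []" using assms(2) by auto
  obtain i where i: "i < ?n" "v = vs ! i" "w = vs ! (Suc i mod ?n)"
    using assms(3) cyc_pairs_nth[OF ne] by auto
  obtain k where k: "k < ?n" "w = vs ! k" "v = vs ! (Suc k mod ?n)"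
    using wv cyc_pairs_nth[OF ne] by auto
  have "Suc i mod ?n < ?n" "Suc k mod ?n < ?n" using ne by auto
  then have "k = Suc i mod ?n" "i = Suc k mod ?n"
    using i k assms(1) by (metis nth_eq_iff_index_eq)+
  then show False using assms(2) i(1) k(1) by (auto simp: mod_Suc split: if_splits)
qed

definition completes :: "('b \<Rightarrow> 'b \<Rightarrow> real) \<Rightarrow> real \<Rightarrow> 'b set \<Rightarrow> ('b \<times> 'b) set \<Rightarrow> ('b \<Rightarrow> 'b \<Rightarrow> real) \<Rightarrow> bool" where
  "completes X \<eta> B E K \<longleftrightarrow> psd_on B K \<and>
     (\<forall>i\<in>B. \<forall>j\<in>B. i = j \<or> (i, j) \<in> E \<longrightarrow> K i j = X i j + (if i = j then \<eta> else 0))"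

lemma convex_completes: "convex {K a b | K. completes X \<eta> B E K}"
  unfolding convex_alt
proof (intro ballI allI impI)
  fix x y u :: real
  assume "x \<in> {K a b | K. completes X \<eta> B E K}" "y \<in> {K a b | K. completes X \<eta> B E K}"
    and u: "0 \<le> u \<and> u \<le> 1"
  then obtain K1 K2 where K: "completes X \<eta> B E K1" "completes X \<eta> B E K2" "x = K1 a b" "y = K2 a b" by blast
  let ?K = "\<lambda>i j. (1 - u) * K1 i j + u * K2 i j"
  have "psd_on B ?K" using K(1,2) u by (intro psd_on_add psd_on_scale) (auto simp: completes_def)
  moreover have "?K i j = X i j + (if i = j then \<eta> else 0)" if "i \<in> B" "j \<in> B" "i = j \<or> (i, j) \<in> E" for i j
  proof -
    have "K1 i j = X i j + (if i = j then \<eta> else 0)" "K2 i j = X i j + (if i = j then \<eta> else 0)"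
      using K(1,2) that by (auto simp: completes_def)
    then show ?thesis by (simp add: algebra_simps)
  qed
  ultimately have "completes X \<eta> B E ?K" by (simp add: completes_def)
  then show "(1 - u) *\<^sub>R x + u *\<^sub>R y \<in> {K a b | K. completes X \<eta> B E K}" using K(3,4) by auto
qed

text \<open>Distance from \<open>s\<close>, capped at \<open>d - 1\<close> except at
  \<open>t\<close>, since other vertices may be as far from \<open>s\<close> as \<open>t\<close> or
  farther. The cap must be positive, which excludes \<open>d = 1\<close>.\<close>

lemma bfs_layering:
  fixes A :: "('b \<times> 'b) set" and s t :: 'b
  defines "d \<equiv> bfs A s t"
  assumes sym: "sym A" and irr: "irrefl A" and reach: "\<And>i. i \<in> B \<Longrightarrow> (s, i) \<in> A\<^sup>*"
    and "t \<in> B" "s \<noteq> t" "d \<noteq> 1"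
  shows "layering B A s t (\<lambda>i. if i = t then d else min (bfs A s i) (d - 1)) d"
proof -
  have "d \<noteq> 0" using bfs_eq_0[OF reach[OF \<open>t \<in> B\<close>]] assms by auto
  then have d: "d \<ge> 2" using \<open>d \<noteq> 1\<close> by simp
  have z: "bfs A s i = 0 \<longleftrightarrow> i = s" if "i \<in> B" for i by (rule bfs_eq_0[OF reach[OF that]])
  have e: "bfs A s j \<le> Suc (bfs A s i)" if "i \<in> B" "(i, j) \<in> A" for i j
    by (rule bfs_step[OF reach[OF that(1)] that(2)])
  have "(if i = t then d else min (bfs A s i) (d - 1)) \<le> Suc (if j = t then d else min (bfs A s j) (d - 1))"
    if "i \<in> B" "j \<in> B" "(i, j) \<in> A" for i j
  proof -
    have "bfs A s i \<le> Suc (bfs A s j)" using e[OF that(2)] symD[OF sym that(3)] by blast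
    then show ?thesis using d by (auto simp: d_def)
  qed
  moreover have "(j, i) \<in> A" if "(i, j) \<in> A" for i j using symD[OF sym that] .
  ultimately have "\<forall>i\<in>B. \<forall>j\<in>B. (i, j) \<in> A \<longrightarrow>
      (if i = t then d else min (bfs A s i) (d - 1)) \<le> Suc (if j = t then d else min (bfs A s j) (d - 1)) \<and>
      (if j = t then d else min (bfs A s j) (d - 1)) \<le> Suc (if i = t then d else min (bfs A s i) (d - 1))"
    by meson
  moreover have "\<forall>i\<in>B. (if i = t then d else min (bfs A s i) (d - 1)) \<le> d
      \<and> ((if i = t then d else min (bfs A s i) (d - 1)) = 0 \<longleftrightarrow> i = s)
      \<and> ((if i = t then d else min (bfs A s i) (d - 1)) = d \<longleftrightarrow> i = t)"
    using z d \<open>s \<noteq> t\<close> by (auto simp: min_def)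
  ultimately show ?thesis unfolding layering_def by blast
qed

text \<open>Blocks are subsets of the glued graph with their own edge sets. Parallel blocks share
  both terminals, so \<open>G\<close> may have an edge inside \<open>B e\<close> that is missing
  from \<open>E e\<close>; this is why \<open>tri\<close> speaks of triangles in \<open>E e\<close>.
  \<open>D\<close> is the underlying simple graph and \<open>j\<close> embeds its vertices.\<close>

locale block_graph =
  fixes V :: "'v set" and R :: "'e set" and src dst :: "'e \<Rightarrow> 'v" and j :: "'v \<Rightarrow> 'b"
    and B :: "'e \<Rightarrow> 'b set" and E :: "'e \<Rightarrow> ('b \<times> 'b) set"
    and G :: "'b pair_pre_digraph" and D :: "'v pair_pre_digraph"
  assumes fin: "finite V" "finite R" and inj: "inj j"
    and ends: "\<And>e. e \<in> R \<Longrightarrow> src e \<in> V" "\<And>e. e \<in> R \<Longrightarrow> dst e \<in> V" "\<And>e. e \<in> R \<Longrightarrow> src e \<noteq> dst e"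
    and finB: "\<And>e. e \<in> R \<Longrightarrow> finite (B e)"
    and terminals: "\<And>e. e \<in> R \<Longrightarrow> j (src e) \<in> B e" "\<And>e. e \<in> R \<Longrightarrow> j (dst e) \<in> B e"
    and jB: "\<And>e v. e \<in> R \<Longrightarrow> j v \<in> B e \<Longrightarrow> v = src e \<or> v = dst e"
    and BB: "\<And>e f b. e \<in> R \<Longrightarrow> f \<in> R \<Longrightarrow> e \<noteq> f \<Longrightarrow> b \<in> B e \<Longrightarrow> b \<in> B f \<Longrightarrow> b \<in> range j"
    and EB: "\<And>e. e \<in> R \<Longrightarrow> E e \<subseteq> B e \<times> B e"
    and symE: "\<And>e. e \<in> R \<Longrightarrow> sym (E e)" and irrE: "\<And>e. e \<in> R \<Longrightarrow> irrefl (E e)"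
    and chordalE: "\<And>e. e \<in> R \<Longrightarrow> chordal \<lparr>pverts = B e, parcs = E e\<rparr>"
    and connE: "\<And>e x y. e \<in> R \<Longrightarrow> x \<in> B e \<Longrightarrow> y \<in> B e \<Longrightarrow> (x, y) \<in> (E e)\<^sup>*"
    and G: "G = \<lparr>pverts = j ` V \<union> (\<Union>e\<in>R. B e), parcs = (\<Union>e\<in>R. E e)\<rparr>"
    and D: "D = \<lparr>pverts = V, parcs = (\<Union>e\<in>R. {(src e, dst e), (dst e, src e)})\<rparr>"
    and tri: "\<And>S. triangle G S \<Longrightarrow> \<exists>e\<in>R. triangle \<lparr>pverts = B e, parcs = E e\<rparr> S"
begin

lemma finG: "finite (pverts G)" using fin finB by (simp add: G)

lemma BG: "e \<in> R \<Longrightarrow> B e \<subseteq> pverts G" and EG: "e \<in> R \<Longrightarrow> E e \<subseteq> parcs G" by (auto simp: G)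

lemma symG: "sym (parcs G)" using symE by (fastforce simp: G sym_def)

lemma irrG: "irrefl (parcs G)" using irrE by (auto simp: G irrefl_def)

definition joins :: "'v \<Rightarrow> 'v \<Rightarrow> 'e set" where
  "joins x y = {e \<in> R. src e = x \<and> dst e = y \<or> src e = y \<and> dst e = x}"

lemma joins_sym: "joins x y = joins y x" by (auto simp: joins_def)

lemma parcs_D: "(x, y) \<in> parcs D \<longleftrightarrow> joins x y \<noteq> {}" by (auto simp: D joins_def)

lemma joinsD:
  assumes "e \<in> joins x y"
  shows "e \<in> R" "x \<in> V" "y \<in> V" "x \<noteq> y" "j x \<in> B e" "j y \<in> B e" "j v \<in> B e \<Longrightarrow> v = x \<or> v = y"
proof -
  have e: "e \<in> R" and xy: "src e = x \<and> dst e = y \<or> src e = y \<and> dst e = x"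
    using assms by (auto simp: joins_def)
  then show "e \<in> R" "x \<in> V" "y \<in> V" "x \<noteq> y" "j x \<in> B e" "j y \<in> B e"
    using ends[OF e] terminals[OF e] by metis+
  show "v = x \<or> v = y" if "j v \<in> B e" using jB[OF e that] xy by metis
qed

text \<open>Shortest paths through the blocks form a cycle of \<open>G\<close>. A triangle on its vertices would lie in
  one block, hence on a shortest path.\<close>

lemma induced_cycle_if_necklace:
  assumes vs: "distinct vs" "length vs \<ge> 2"
    and c: "\<And>v w. (v, w) \<in> cyc_pairs vs \<Longrightarrow> c v \<in> joins v w" "inj_on c (set vs)"
    and t: "\<And>v w. (v, w) \<in> cyc_pairs vs \<Longrightarrow> t v = j w"
    and len: "sum_list (map (\<lambda>v. bfs (E (c v)) (j v) (t v)) vs) \<ge> 3"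
  obtains m where "4 \<le> m" "m \<le> sum_list (map (\<lambda>v. bfs (E (c v)) (j v) (t v)) vs)" "has_induced_cycle G m"
proof -
  define d where "d v = bfs (E (c v)) (j v) (t v)" for v
  have ne: "vs \<noteq> []" using vs by auto
  have nxt: "\<exists>w. (v, w) \<in> cyc_pairs vs" if "v \<in> set vs" for v
    using that by (auto simp: cyc_pairs_nth[OF ne] in_set_conv_nth)
  have cv: "c v \<in> R" "j v \<in> B (c v)" "t v \<in> B (c v)" "t v \<in> range j" "j v \<noteq> t v"
    "\<And>u. j u \<in> B (c v) \<Longrightarrow> j u = j v \<or> j u = t v" if "v \<in> set vs" for v
  proof -
    obtain w where w: "(v, w) \<in> cyc_pairs vs" using nxt[OF \<open>v \<in> set vs\<close>] by blast
    note J = joinsD[OF c(1)[OF w]]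
    show "c v \<in> R" "j v \<in> B (c v)" "t v \<in> B (c v)" "t v \<in> range j" using J t[OF w] by auto
    show "j v \<noteq> t v" using J(4) t[OF w] injD[OF inj] by metis
    show "j u = j v \<or> j u = t v" if "j u \<in> B (c v)" for u using J(7)[OF that] t[OF w] by auto
  qed
  have "\<exists>\<pi>. \<pi> 0 = j v \<and> \<pi> (d v) = t v \<and> (\<forall>k<d v. (\<pi> k, \<pi> (Suc k)) \<in> E (c v))
      \<and> (\<forall>k\<le>d v. bfs (E (c v)) (j v) (\<pi> k) = k)" if v: "v \<in> set vs" for v
    unfolding d_def using shortest_path[OF connE[OF cv(1-3)[OF v]]] by metis
  then obtain \<pi> where \<pi>: "\<And>v. v \<in> set vs \<Longrightarrow> \<pi> v 0 = j v" "\<And>v. v \<in> set vs \<Longrightarrow> \<pi> v (d v) = t v"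
    "\<And>v k. v \<in> set vs \<Longrightarrow> k < d v \<Longrightarrow> (\<pi> v k, \<pi> v (Suc k)) \<in> E (c v)"
    "\<And>v k. v \<in> set vs \<Longrightarrow> k \<le> d v \<Longrightarrow> bfs (E (c v)) (j v) (\<pi> v k) = k"
    by metis
  have dpos: "d v > 0" if "v \<in> set vs" for v
    using bfs_eq_0[OF connE[OF cv(1-3)[OF that]]] cv(5)[OF that] by (auto simp: d_def)
  have \<pi>B: "\<pi> v k \<in> B (c v)" if "v \<in> set vs" "k < d v" for v k
    using \<pi>(3)[OF that] EB[OF cv(1)[OF that(1)]] by auto
  \<comment> \<open>A shortest path repeats no vertex, and the only vertices of \<open>D\<close> in
    its block are its two ends.\<close>
  have \<pi>j: "k = 0" if v: "v \<in> set vs" "k < d v" "\<pi> v k \<in> range j" for v k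
  proof -
    have "\<pi> v k = j v \<or> \<pi> v k = t v" using cv(6)[OF v(1)] \<pi>B[OF v(1,2)] v(3) by (metis imageE)
    then have "\<pi> v k = \<pi> v 0 \<or> \<pi> v k = \<pi> v (d v)" using \<pi>(1,2) v(1) by simp
    then have "k = 0 \<or> k = d v" using \<pi>(4)[OF v(1)] v(2) by (metis le_refl less_imp_le zero_le)
    then show ?thesis using v(2) by simp
  qed
  have other: "\<pi> v k = j v" if "v \<in> set vs" "k < d v" "e \<in> R" "c v \<noteq> e" "\<pi> v k \<in> B e" for v k e
  proof -
    have "\<pi> v k \<in> range j" using BB[OF cv(1)[OF that(1)] that(3,4) \<pi>B that(5)] that(1,2) by blast
    then show ?thesis using \<pi>j[OF that(1,2)] \<pi>(1) that(1) by simp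
  qed
  show thesis
  proof (rule has_induced_cycle_if_chain[OF symG irrG vs(1) ne, of d \<pi>])
    show "\<forall>v\<in>set vs. d v > 0" using dpos by blast
    show "3 \<le> sum_list (map d vs)" using len by (simp add: d_def[abs_def])
    show "(\<pi> v k, \<pi> v (Suc k)) \<in> parcs G" if "v \<in> set vs" "k < d v" for v k
      using \<pi>(3)[OF that] EG[OF cv(1)[OF that(1)]] by auto
    show "\<pi> v (d v) = \<pi> w 0" if "(v, w) \<in> cyc_pairs vs" for v w
    proof -
      have "v \<in> set vs" "w \<in> set vs" using that cyc_pairs_subset[OF ne] by auto
      then show ?thesis using \<pi>(1,2) t[OF that] by simp
    qed
    show "v = w \<and> k = l" if "v \<in> set vs" "w \<in> set vs" "k < d v" "l < d w" "\<pi> v k = \<pi> w l" for v w k l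
    proof (cases "v = w")
      case True
      then have "k = l" using \<pi>(4)[OF that(1) less_imp_le[OF that(3)]]
          \<pi>(4)[OF that(2) less_imp_le[OF that(4)]] that(5) by metis
      then show ?thesis using True by simp
    next
      case False
      then have cne: "c v \<noteq> c w" using inj_onD[OF c(2)] that(1,2) by blast
      have "\<pi> v k = j v"
        using other[OF that(1,3) cv(1)[OF that(2)] cne] \<pi>B[OF that(2,4)] that(5) by metis
      moreover have "\<pi> w l = j w"
        using other[OF that(2,4) cv(1)[OF that(1)] cne[symmetric]] \<pi>B[OF that(1,3)] that(5) by metis
      ultimately show ?thesis using that(5) False injD[OF inj] by metis
    qed
    show "\<pi> v k \<in> pverts G" if "v \<in> set vs" "k < d v" for v k
      using \<pi>B[OF that] BG[OF cv(1)[OF that(1)]] by auto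
    show "\<not> S \<subseteq> {\<pi> v k | v k. v \<in> set vs \<and> k < d v}" if S: "triangle G S" for S
    proof
      assume sub: "S \<subseteq> {\<pi> v k | v k. v \<in> set vs \<and> k < d v}"
      obtain e where e: "e \<in> R" "triangle \<lparr>pverts = B e, parcs = E e\<rparr> S" using tri[OF S] by blast
      then have SB: "S \<subseteq> B e" and S3: "card S = 3" by (auto simp: triangle_def clique_def)
      show False
      proof (cases "e \<in> c ` set vs")
        case False
        \<comment> \<open>A block off the necklace meets the paths at most in its two
          terminals.\<close>
        have "S \<subseteq> {j (src e), j (dst e)}"
        proof
          fix x assume x: "x \<in> S"
          then obtain v k where vk: "v \<in> set vs" "k < d v" "x = \<pi> v k" using sub by blast
          then have "x = j v" using other[OF vk(1,2) e(1)] False x SB by auto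
          then show "x \<in> {j (src e), j (dst e)}" using jB[OF e(1), of v] x SB by auto
        qed
        then have "card S \<le> card {j (src e), j (dst e)}" by (intro card_mono) auto
        also have "\<dots> \<le> 2" by (simp add: card_insert_if)
        finally show False using S3 by simp
      next
        case True
        then obtain v where v: "v \<in> set vs" "e = c v" by blast
        have lev: "\<exists>k\<le>d v. x = \<pi> v k" if x: "x \<in> S" for x
        proof -
          obtain w k where wk: "w \<in> set vs" "k < d w" "x = \<pi> w k" using sub x by blast
          show ?thesis
          proof (cases "w = v")
            case True then show ?thesis using wk(2,3) less_imp_le by blast
          next
            case False
            then have "c w \<noteq> e" using inj_onD[OF c(2)] v wk by blast
            then have "x = j w" using other[OF wk(1,2) e(1)] x SB wk(3) by auto
            then have "x = j v \<or> x = t v" using cv(6)[OF v(1), of w] x SB v(2) by blast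
            then show ?thesis using \<pi>(1,2)[OF v(1)] by (metis le_refl zero_le)
          qed
        qed
        have "\<not> triangle \<lparr>pverts = B e, parcs = E e\<rparr> S"
        proof (rule no_triangle_if_levels)
          show "inj_on (bfs (E e) (j v)) S"
            by (rule inj_onI) (metis lev \<pi>(4)[OF v(1)] v(2))
          show "bfs (E e) (j v) y \<le> Suc (bfs (E e) (j v) x)"
            if "(x, y) \<in> parcs \<lparr>pverts = B e, parcs = E e\<rparr>" "x \<in> S" for x y
            by (rule bfs_step) (use that connE[OF e(1)] cv(2)[OF v(1)] v(2) SB in auto)
        qed
        then show False using e(2) by blast
      qed
    qed
    show thesis if "4 \<le> m" "m \<le> sum_list (map d vs)" "has_induced_cycle G m" for m
      using \<open>\<And>m. 4 \<le> m \<Longrightarrow> m \<le> sum_list (map (\<lambda>v. bfs (E (c v)) (j v) (t v)) vs) \<Longrightarrow> has_induced_cycle G m \<Longrightarrow> thesis\<close>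
        that by (simp add: d_def[abs_def])
  qed
qed

end

section \<open>Completion of the glued graph\<close>

context block_graph
begin

context
  fixes X :: "'b \<Rightarrow> 'b \<Rightarrow> real" and \<epsilon> \<eta> :: real
  assumes X: "\<And>S. clique G S \<Longrightarrow> psd_on S X" and \<epsilon>: "\<epsilon> \<ge> 0"
    and bound: "\<And>n. n \<ge> 4 \<Longrightarrow> has_induced_cycle G n \<Longrightarrow> cycle_bound n \<epsilon>"
    and \<eta>: "\<eta> = \<epsilon> * (\<Sum>b\<in>pverts G. X b b)"
begin

lemma X_diag: "b \<in> pverts G \<Longrightarrow> X b b \<ge> 0"
  using psd_on_diag_nonneg[of "{b}" X b] X[of "{b}"] by (simp add: clique_def)

lemma \<eta>_nonneg: "\<eta> \<ge> 0"
  using \<epsilon> X_diag by (simp add: \<eta> sum_nonneg)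

lemma block_psd:
  assumes e: "e \<in> R"
  obtains M where "psd_on (B e) M"
    "\<And>a b. a \<in> B e \<Longrightarrow> b \<in> B e \<Longrightarrow> a = b \<or> (a, b) \<in> E e \<Longrightarrow> M a b = X a b"
proof -
  let ?G = "\<lparr>pverts = B e, parcs = E e\<rparr>"
  have "psd_on S X" if "clique ?G S" for S
    using that BG[OF e] EG[OF e] by (intro X) (auto simp: clique_def)
  then show thesis
    using chordal_psd_completion[of ?G "B e" X] symE[OF e] irrE[OF e] chordalE[OF e] finB[OF e] that
    by auto
qed

definition blockM :: "'e \<Rightarrow> 'b \<Rightarrow> 'b \<Rightarrow> real" where
  "blockM e = (SOME M. psd_on (B e) M \<and> (\<forall>a\<in>B e. \<forall>b\<in>B e. a = b \<or> (a, b) \<in> E e \<longrightarrow> M a b = X a b))"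

lemma blockM:
  assumes "e \<in> R"
  shows "psd_on (B e) (blockM e)"
    "a \<in> B e \<Longrightarrow> b \<in> B e \<Longrightarrow> a = b \<or> (a, b) \<in> E e \<Longrightarrow> blockM e a b = X a b"
proof -
  have "\<exists>M. psd_on (B e) M \<and> (\<forall>a\<in>B e. \<forall>b\<in>B e. a = b \<or> (a, b) \<in> E e \<longrightarrow> M a b = X a b)"
    using block_psd[OF assms] by metis
  then have *: "psd_on (B e) (blockM e) \<and>
      (\<forall>a\<in>B e. \<forall>b\<in>B e. a = b \<or> (a, b) \<in> E e \<longrightarrow> blockM e a b = X a b)"
    unfolding blockM_def by (rule someI_ex)
  then show "psd_on (B e) (blockM e)" by (rule conjunct1)
  show "blockM e a b = X a b" if "a \<in> B e" "b \<in> B e" "a = b \<or> (a, b) \<in> E e"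
    using conjunct2[OF *] that by blast
qed

definition shiftM :: "'e \<Rightarrow> 'b \<Rightarrow> 'b \<Rightarrow> real" where
  "shiftM e a b = blockM e a b + (if a = b then \<eta> else 0)"

lemma completes_shiftM: "e \<in> R \<Longrightarrow> completes X \<eta> (B e) (E e) (shiftM e)"
  unfolding completes_def shiftM_def using blockM finB \<eta>_nonneg
  by (auto intro!: psd_on_add_diag)

text \<open>If the shortest paths have total length at least 3, they yield an induced cycle that is
  not longer, and the bound for it carries over to the total length. Otherwise there are two
  parallel arcs with adjacent terminals in both blocks, and the terminal entry is prescribed by
  \<open>X\<close>.\<close>

lemma necklace_completes:
  assumes vs: "distinct vs" "length vs \<ge> 2"
    and c: "\<And>v w. (v, w) \<in> cyc_pairs vs \<Longrightarrow> c v \<in> joins v w" "inj_on c (set vs)"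
  shows "\<exists>N K. psd_on (set vs) N \<and> (\<forall>v\<in>set vs. N v v = X (j v) (j v) + \<eta>) \<and>
    (\<forall>(v, w)\<in>cyc_pairs vs. completes X \<eta> (B (c v)) (E (c v)) (K v) \<and> N v w = K v (j v) (j w))"
proof -
  define t where "t v = j (if src (c v) = v then dst (c v) else src (c v))" for v
  define d where "d v = bfs (E (c v)) (j v) (t v)" for v
  have ne: "vs \<noteq> []" using vs by auto
  have nxt: "\<exists>w. (v, w) \<in> cyc_pairs vs" if "v \<in> set vs" for v
    using that by (auto simp: cyc_pairs_nth[OF ne] in_set_conv_nth)
  have mem: "v \<in> set vs" "w \<in> set vs" if "(v, w) \<in> cyc_pairs vs" for v w
    using that cyc_pairs_subset[OF ne] by auto
  have t: "t v = j w" if "(v, w) \<in> cyc_pairs vs" for v w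
    using c(1)[OF that] joinsD(4)[OF c(1)[OF that]] by (auto simp: t_def joins_def)
  have cv: "c v \<in> R" "j v \<in> B (c v)" "t v \<in> B (c v)" "j v \<noteq> t v"
    "\<And>u. j u \<in> B (c v) \<Longrightarrow> u = v \<or> j u = t v" if v: "v \<in> set vs" for v
  proof -
    obtain w where w: "(v, w) \<in> cyc_pairs vs" using nxt[OF v] by blast
    note J = joinsD[OF c(1)[OF w]]
    show "c v \<in> R" "j v \<in> B (c v)" "t v \<in> B (c v)" using J t[OF w] by auto
    show "j v \<noteq> t v" using J(4) t[OF w] injD[OF inj] by metis
    show "u = v \<or> j u = t v" if "j u \<in> B (c v)" for u using J(7)[OF that] t[OF w] by auto
  qed
  have dpos: "d v > 0" if "v \<in> set vs" for v
    using bfs_eq_0[OF connE[OF cv(1-3)[OF that]]] cv(4)[OF that] by (auto simp: d_def)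
  show ?thesis
  proof (cases "sum_list (map d vs) \<ge> 3")
    case True
    obtain m where m: "4 \<le> m" "m \<le> sum_list (map d vs)" "has_induced_cycle G m"
      using induced_cycle_if_necklace[where t = t, OF vs c t] True unfolding d_def[abs_def] by blast
    have cb: "cycle_bound (sum_list (map d vs)) \<epsilon>"
      by (rule cycle_bound_mono[OF _ \<epsilon> bound[OF m(1,3)] m(2)]) (use m(1) in simp)
    define f where "f v i = (if i = t v then d v else min (bfs (E (c v)) (j v) i) (d v - 1))" for v i
    have "\<exists>N K. necklace_completion vs (\<lambda>v. B (c v)) (\<lambda>v. E (c v)) j t (\<lambda>v. blockM (c v)) \<eta> N K"
    proof (rule necklace_completion_exists[OF vs \<epsilon>, where d = d and f = f])
      show "finite (B (c v))" if "v \<in> set vs" for v using finB cv(1)[OF that] by blast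
      show "d v = 1 \<or> layering (B (c v)) (E (c v)) (j v) (t v) (f v) (d v)" if "v \<in> set vs" for v
      proof (cases "d v = 1")
        case False
        show ?thesis unfolding f_def[abs_def] d_def
          by (intro disjI2 bfs_layering symE irrE connE)
            (use cv[OF that] False in \<open>auto simp: d_def\<close>)
      qed simp
      show "psd_on (B (c v)) (blockM (c v))" if "v \<in> set vs" for v using blockM(1) cv(1)[OF that] .
      show "blockM (c v) (t v) (t v) = blockM (c w) (j w) (j w)" if vw: "(v, w) \<in> cyc_pairs vs" for v w
        using blockM(2)[OF cv(1)[OF mem(1)[OF vw]]] blockM(2)[OF cv(1)[OF mem(2)[OF vw]]]
          cv(3)[OF mem(1)[OF vw]] cv(2)[OF mem(2)[OF vw]] t[OF vw] by simp
      \<comment> \<open>Without \<open>t v\<close>, each terminal on the necklace is counted once,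
        so the traces of the blocks add up to at most the trace of \<open>X\<close> on
        \<open>G\<close>.\<close>
      have disj: "(B (c v) - {t v}) \<inter> (B (c w) - {t w}) = {}" if vw: "v \<in> set vs" "w \<in> set vs" "v \<noteq> w" for v w
      proof -
        have "c v \<noteq> c w" using inj_onD[OF c(2)] vw by blast
        have False if b: "b \<in> B (c v)" "b \<noteq> t v" "b \<in> B (c w)" "b \<noteq> t w" for b
        proof -
          obtain u where "b = j u"
            using BB[OF cv(1)[OF vw(1)] cv(1)[OF vw(2)] \<open>c v \<noteq> c w\<close> b(1,3)] by blast
          then have "u = v" "u = w" using cv(5)[OF vw(1), of u] cv(5)[OF vw(2), of u] b by auto
          then show False using vw(3) by simp
        qed
        then show ?thesis by blast
      qed
      have "(\<Sum>v\<in>set vs. \<Sum>b\<in>B (c v) - {t v}. blockM (c v) b b) = (\<Sum>v\<in>set vs. \<Sum>b\<in>B (c v) - {t v}. X b b)"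
        using blockM(2) cv(1) by (intro sum.cong) auto
      also have "\<dots> = (\<Sum>b\<in>(\<Union>v\<in>set vs. B (c v) - {t v}). X b b)"
        using disj finB cv(1) by (intro sum.UNION_disjoint[symmetric]) auto
      also have "\<dots> \<le> (\<Sum>b\<in>pverts G. X b b)"
        using BG cv(1) X_diag finG by (intro sum_mono2) auto
      finally show "\<epsilon> * (\<Sum>v\<in>set vs. \<Sum>b\<in>B (c v) - {t v}. blockM (c v) b b) \<le> \<eta>"
        unfolding \<eta> using \<epsilon> by (rule mult_left_mono)
    qed (use cv dpos cb in auto)
    then obtain N K where NK: "necklace_completion vs (\<lambda>v. B (c v)) (\<lambda>v. E (c v)) j t (\<lambda>v. blockM (c v)) \<eta> N K"
      by blast
    have "completes X \<eta> (B (c v)) (E (c v)) (K v)" if "v \<in> set vs" for v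
      using NK that blockM(2)[OF cv(1)[OF that]] by (simp add: necklace_completion_def completes_def)
    moreover have "N v v = X (j v) (j v) + \<eta>" if "v \<in> set vs" for v
      using NK that blockM(2)[OF cv(1)[OF that]] cv(2)[OF that] by (simp add: necklace_completion_def)
    moreover have "N v w = K v (j v) (j w)" if "(v, w) \<in> cyc_pairs vs" for v w
      using NK that t[OF that] by (auto simp: necklace_completion_def)
    moreover have "psd_on (set vs) N" using NK by (simp add: necklace_completion_def)
    ultimately show ?thesis using mem by blast
  next
    case False
    obtain v w us where vw: "vs = v # w # us"
      using vs(2) by (metis Suc_le_length_iff numeral_2_eq_2)
    have "us = []"
    proof (cases us)
      case (Cons a us')
      then show ?thesis using False dpos[of v] dpos[of w] dpos[of a] vw by auto
    qed
    then have vs2: "vs = [v, w]" using vw by simp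
    have d1: "d u = 1" if "u \<in> set vs" for u
      using that False dpos[of v] dpos[of w] vs2 by auto
    have edge: "(j u, t u) \<in> E (c u)" if "u \<in> set vs" for u
      using bfs_relpow[OF connE[OF cv(1-3)[OF that]]] d1[OF that] by (simp add: d_def)
    have cp: "cyc_pairs vs = {(v, w), (w, v)}" by (auto simp: vs2 cyc_pairs_def)
    have "t v = j w" using t cp by blast
    then have "(j v, j w) \<in> parcs G" using edge[of v] EG[OF cv(1)[of v]] vs2 by auto
    then have "clique G {j v, j w}"
      using symD[OF symG] BG cv[of v] cv[of w] vs2 by (auto simp: clique_def)
    then have "psd_on {j v, j w} X" by (rule X)
    then have "psd_on {v, w} (\<lambda>x y. X (j x) (j y))" by (rule psd_on_reindex[rotated]) auto
    then have psdN: "psd_on {v, w} (\<lambda>x y. X (j x) (j y) + (if x = y then \<eta> else 0))"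
      by (intro psd_on_add_diag) (use \<eta>_nonneg in auto)
    have eq: "X (j x) (j y) + (if x = y then \<eta> else 0) = shiftM (c x) (j x) (j y)"
      if xy: "(x, y) \<in> cyc_pairs vs" for x y
    proof -
      have "j x \<noteq> j y" using cv(4)[OF mem(1)[OF xy]] t[OF xy] by simp
      then show ?thesis
        using blockM(2)[OF cv(1)[OF mem(1)[OF xy]]] cv(2,3)[OF mem(1)[OF xy]] edge[OF mem(1)[OF xy]] t[OF xy]
        by (auto simp: shiftM_def)
    qed
    show ?thesis
    proof (intro exI conjI)
      show "psd_on (set vs) (\<lambda>x y. X (j x) (j y) + (if x = y then \<eta> else 0))"
        using psdN vs2 by simp
      show "\<forall>(x, y)\<in>cyc_pairs vs. completes X \<eta> (B (c x)) (E (c x)) (shiftM (c x)) \<and>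
          X (j x) (j y) + (if x = y then \<eta> else 0) = shiftM (c x) (j x) (j y)"
      proof clarify
        fix x y assume xy: "(x, y) \<in> cyc_pairs vs"
        show "completes X \<eta> (B (c x)) (E (c x)) (shiftM (c x)) \<and>
          X (j x) (j y) + (if x = y then \<eta> else 0) = shiftM (c x) (j x) (j y)"
          using completes_shiftM[OF cv(1)[OF mem(1)[OF xy]]] eq[OF xy] by (rule conjI)
      qed
    qed simp
  qed
qed

section \<open>The intervals of terminal values and their common realization\<close>

definition terminal_values :: "'e \<Rightarrow> real set" where
  "terminal_values e = {K (j (src e)) (j (dst e)) | K. completes X \<eta> (B e) (E e) K}"

lemma terminal_valuesI:
  assumes "e \<in> joins x y" "completes X \<eta> (B e) (E e) K"
  shows "K (j x) (j y) \<in> terminal_values e"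
proof -
  have "K (j x) (j y) = K (j y) (j x)"
    using assms joinsD(5,6)[OF assms(1)] by (intro psd_on_sym[of "B e"]) (auto simp: completes_def)
  then have "K (j x) (j y) = K (j (src e)) (j (dst e))" using assms(1) by (auto simp: joins_def)
  then show ?thesis using assms(2) by (auto simp: terminal_values_def)
qed

text \<open>Two distinct arcs form a necklace with the two vertices \<open>x\<close> and
  \<open>y\<close>; the symmetric matrix on it gives one value that both blocks admit.\<close>

lemma terminal_values_Int:
  assumes "e \<in> joins x y" "f \<in> joins x y"
  shows "terminal_values e \<inter> terminal_values f \<noteq> {}"
proof (cases "e = f")
  case True
  then show ?thesis using terminal_valuesI[OF assms(1) completes_shiftM] joinsD(1)[OF assms(1)] by blast
next
  case False
  have xy: "x \<noteq> y" by (rule joinsD(4)[OF assms(1)])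
  define c where "c v = (if v = x then e else f)" for v
  have cp: "cyc_pairs [x, y] = {(x, y), (y, x)}" by (auto simp: cyc_pairs_def)
  have cj: "c v \<in> joins v w" if "(v, w) \<in> cyc_pairs [x, y]" for v w
    using that assms joins_sym[of x y] xy unfolding cp by (auto simp: c_def)
  have "inj_on c (set [x, y])" using False by (auto simp: inj_on_def c_def)
  then obtain N K where NK: "psd_on (set [x, y]) N"
    "\<forall>(v, w)\<in>cyc_pairs [x, y]. completes X \<eta> (B (c v)) (E (c v)) (K v) \<and> N v w = K v (j v) (j w)"
    using necklace_completes[of "[x, y]" c] cj xy by auto
  then have N: "completes X \<eta> (B (c v)) (E (c v)) (K v)" "N v w = K v (j v) (j w)"
    if "(v, w) \<in> {(x, y), (y, x)}" for v w using that unfolding cp by blast+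
  have "N x y \<in> terminal_values e"
    using terminal_valuesI[OF cj N(1), of x y] N(2)[of x y] xy unfolding cp by (simp add: c_def)
  moreover have "N y x \<in> terminal_values f"
    using terminal_valuesI[OF cj N(1), of y x] N(2)[of y x] xy unfolding cp by (simp add: c_def)
  moreover have "N x y = N y x" using psd_on_sym[OF NK(1), of x y] by simp
  ultimately show ?thesis by auto
qed

lemma convex_terminal_values: "convex (terminal_values e)"
  unfolding terminal_values_def by (rule convex_completes)

abbreviation "\<delta> v \<equiv> X (j v) (j v) + \<eta>"
abbreviation "entries x y \<equiv> \<Inter>(terminal_values ` joins x y)"

lemma finite_joins: "finite (joins x y)"
  using fin(2) by (auto simp: joins_def)

lemma realizes_cycle:
  assumes "cycle_in (parcs D) vs"
  shows "\<exists>N. realizes \<delta> entries (set vs) (cyc_pairs vs) N"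
proof (rule realizes_Inter)
  have vs: "distinct vs" "length vs \<ge> 3" "cyc_pairs vs \<subseteq> parcs D" using assms by (auto simp: cycle_in_def)
  then have ne: "vs \<noteq> []" and l2: "length vs \<ge> 2" by auto
  show "finite (cyc_pairs vs)" using cyc_pairs_subset[OF ne] finite_subset by blast
  show "finite (joins x y) \<and> joins x y \<noteq> {}" if "(x, y) \<in> cyc_pairs vs" for x y
    using that vs(3) parcs_D finite_joins by blast
  fix c assume c: "\<And>x y. (x, y) \<in> cyc_pairs vs \<Longrightarrow> c x y \<in> joins x y"
  define c' where "c' v = c v (SOME w. (v, w) \<in> cyc_pairs vs)" for v
  have nxt: "(SOME w'. (v, w') \<in> cyc_pairs vs) = w" if "(v, w) \<in> cyc_pairs vs" for v w
    by (rule cyc_pairs_fun[OF vs(1) l2 someI that]) (rule that)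
  have c': "c' v = c v w" if "(v, w) \<in> cyc_pairs vs" for v w using nxt[OF that] by (simp add: c'_def)
  have cj: "c' v \<in> joins v w" if "(v, w) \<in> cyc_pairs vs" for v w using c[OF that] c'[OF that] by simp
  \<comment> \<open>An arc chosen at two places would be traversed in both directions, which a cycle
    on at least three vertices does not do.\<close>
  have "inj_on c' (set vs)"
  proof (rule inj_onI)
    fix v v' assume v: "v \<in> set vs" "v' \<in> set vs" "c' v = c' v'"
    obtain w where w: "(v, w) \<in> cyc_pairs vs" using cyc_pairs_ex[OF l2 v(1)] by blast
    obtain w' where w': "(v', w') \<in> cyc_pairs vs" using cyc_pairs_ex[OF l2 v(2)] by blast
    show "v = v'"
    proof (rule ccontr)
      assume "v \<noteq> v'"
      then have "v' = w" "w' = v" using cj[OF w] cj[OF w'] v(3) by (auto simp: joins_def)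
      then show False using cyc_pairs_asym[OF vs(1,2) w] w' by simp
    qed
  qed
  then obtain N K where NK: "psd_on (set vs) N" "\<forall>v\<in>set vs. N v v = \<delta> v"
    "\<forall>(v, w)\<in>cyc_pairs vs. completes X \<eta> (B (c' v)) (E (c' v)) (K v) \<and> N v w = K v (j v) (j w)"
    using necklace_completes[OF vs(1) l2 cj] by blast
  have "realizes \<delta> (\<lambda>x y. terminal_values (c x y)) (set vs) (cyc_pairs vs) N"
  proof (rule realizesI)
    show "N x y \<in> terminal_values (c x y)" if xy: "(x, y) \<in> cyc_pairs vs" for x y
      using terminal_valuesI[OF cj[OF xy]] NK(3) xy c'[OF xy] by fastforce
  qed (use NK in auto)
  then show "\<exists>N. realizes \<delta> (\<lambda>x y. terminal_values (c x y)) (set vs) (cyc_pairs vs) N" by blast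
qed (use convex_terminal_values terminal_values_Int in auto)

text \<open>The reduction to cycles works in connected graphs; the matrices found on the components
  are glued as matrices on disjoint sets.\<close>

lemma realizes_D:
  assumes "\<And>x. x \<in> V \<Longrightarrow> \<not> has_K4 (restrict_to D {y. (x, y) \<in> (parcs D)\<^sup>*})"
  shows "\<exists>N. realizes \<delta> entries V (parcs D) N"
proof -
  have VD: "pverts D = V" by (simp add: D)
  have pgD: "pair_graph D"
    by (rule pair_graphI) (use fin ends ends(3)[symmetric] in \<open>auto simp: D sym_def irrefl_def\<close>)
  note GD = pair_graphD[OF pgD]
  have symr: "sym ((parcs D)\<^sup>*)" by (rule sym_rtrancl[OF GD(3)])
  let ?c = "\<lambda>x. {y. (x, y) \<in> (parcs D)\<^sup>*}"
  have cV: "?c x \<subseteq> V" if "x \<in> V" for x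
  proof
    fix y assume "y \<in> ?c x"
    then have "(x, y) \<in> (parcs D)\<^sup>*" by simp
    then show "y \<in> V" by (induction rule: rtrancl_induct) (use that GD(2) VD in auto)
  qed
  have real: "\<exists>N. realizes \<delta> entries (?c x) (parcs D \<inter> ?c x \<times> ?c x) N" if x: "x \<in> V" for x
  proof -
    let ?H = "restrict_to D (?c x)"
    have "\<exists>N. realizes \<delta> entries (pverts ?H) (parcs ?H) N"
    proof (rule realizable_if_cycles_realizable)
      show "pair_graph ?H" by (rule pair_graph_restrict_to[OF pgD]) (use cV[OF x] VD in simp)
      have inH: "(x, y) \<in> (parcs ?H)\<^sup>*" if "y \<in> ?c x" for y
      proof -
        from that have "(x, y) \<in> (parcs D)\<^sup>*" by simp
        then show ?thesis
        proof (induction rule: rtrancl_induct)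
          case (step y z)
          then have "y \<in> ?c x" "z \<in> ?c x" using rtrancl_into_rtrancl[OF step(1,2)] by blast+
          then have "(y, z) \<in> parcs ?H" using step(2) by simp
          then show ?case using step.IH by (meson rtrancl.rtrancl_into_rtrancl)
        qed simp
      qed
      have "sym (parcs ?H)" using GD(3) by (auto simp: sym_def)
      then have "sym ((parcs ?H)\<^sup>*)" by (rule sym_rtrancl)
      then show "linked ?H"
        unfolding linked_def restrict_to_simps(1)[of D "?c x"]
        by (intro ballI) (rule rtrancl_trans[OF symD[OF _ inH] inH])
      show "\<not> has_K4 ?H" by (rule assms[OF x])
      have \<delta>nn: "0 \<le> \<delta> v" if "v \<in> V" for v
        using that X_diag[of "j v"] \<eta>_nonneg by (auto simp: G intro!: add_nonneg_nonneg)
      show "0 \<le> \<delta> v" if "v \<in> pverts ?H" for v using \<delta>nn cV[OF x] that by auto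
      show "convex (entries p q) \<and> entries p q \<noteq> {} \<and> entries p q = entries q p" if pq: "(p, q) \<in> parcs ?H" for p q
      proof (intro conjI)
        show "convex (entries p q)" using convex_terminal_values by (intro convex_Inter) auto
        show "entries p q = entries q p" by (simp add: joins_sym[of p q])
        show "entries p q \<noteq> {}"
        proof (rule convex_real_Inter)
          show "terminal_values ` joins p q \<noteq> {}" using pq parcs_D by auto
          show "A \<inter> A' \<noteq> {}" if AA: "A \<in> terminal_values ` joins p q" "A' \<in> terminal_values ` joins p q" for A A'
            using AA terminal_values_Int by blast
        qed (use finite_joins convex_terminal_values in auto)
      qed
      show "a\<^sup>2 \<le> \<delta> p * \<delta> q" if pq: "(p, q) \<in> parcs ?H" and a: "a \<in> entries p q" for p q a
      proof -
        obtain e where e: "e \<in> joins p q" using pq parcs_D by auto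
        then have "a \<in> terminal_values e" using a by blast
        then obtain K where K: "completes X \<eta> (B e) (E e) K" "a = K (j (src e)) (j (dst e))"
          by (auto simp: terminal_values_def)
        have eR: "e \<in> R" by (rule joinsD(1)[OF e])
        have "a\<^sup>2 \<le> K (j (src e)) (j (src e)) * K (j (dst e)) (j (dst e))"
          unfolding K(2) using psd_on_minor[OF finB[OF eR] _ terminals[OF eR]] K(1) by (simp add: completes_def)
        also have "\<dots> = \<delta> (src e) * \<delta> (dst e)" using K(1) terminals[OF eR] by (simp add: completes_def)
        also have "\<dots> = \<delta> p * \<delta> q" using e by (auto simp: joins_def)
        finally show ?thesis .
      qed
      show "\<exists>N. realizes \<delta> entries (set vs) (cyc_pairs vs) N" if "cycle_in (parcs ?H) vs" for vs
        by (rule realizes_cycle) (use that in \<open>auto simp: cycle_in_def\<close>)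
    qed
    then show ?thesis by simp
  qed
  define cN where "cN x = (SOME N. realizes \<delta> entries (?c x) (parcs D \<inter> ?c x \<times> ?c x) N)" for x
  have cN: "realizes \<delta> entries (?c x) (parcs D \<inter> ?c x \<times> ?c x) (cN x)" if "x \<in> V" for x
    unfolding cN_def using real[OF that] by (rule someI_ex)
  define rep where "rep U = (SOME x. x \<in> V \<and> ?c x = U)" for U
  have rep: "rep U \<in> V" "?c (rep U) = U" if "U \<in> ?c ` V" for U
  proof -
    have "\<exists>x. x \<in> V \<and> ?c x = U" using that by blast
    then have *: "rep U \<in> V \<and> ?c (rep U) = U" unfolding rep_def by (rule someI_ex)
    show "rep U \<in> V" using * by (rule conjunct1)
    show "?c (rep U) = U" using * by (rule conjunct2)
  qed
  define Cs where "Cs = ?c ` V"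
  have N1: "finite Cs" using fin(1) by (simp add: Cs_def)
  have N2: "finite U" if "U \<in> Cs" for U
    using that cV fin(1) unfolding Cs_def by (auto intro: finite_subset)
  have N3: "psd_on U (cN (rep U))" if "U \<in> Cs" for U
    using realizesD(1)[OF cN[OF rep(1)]] rep(2) that unfolding Cs_def by metis
  have N4: "U \<inter> U' = {}" if U: "U \<in> Cs" "U' \<in> Cs" "U \<noteq> U'" for U U'
  proof (rule ccontr)
    assume "U \<inter> U' \<noteq> {}"
    then obtain x y z where xyz: "U = ?c x" "U' = ?c y" "(x, z) \<in> (parcs D)\<^sup>*" "(y, z) \<in> (parcs D)\<^sup>*"
      using U unfolding Cs_def by blast
    have "(x, y) \<in> (parcs D)\<^sup>*" "(y, x) \<in> (parcs D)\<^sup>*"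
      using rtrancl_trans[OF xyz(3) symD[OF symr xyz(4)]] rtrancl_trans[OF xyz(4) symD[OF symr xyz(3)]] .
    then have "?c x = ?c y" using rtrancl_trans by fast
    then show False using U(3) xyz by simp
  qed
  obtain N where N': "psd_on (\<Union>Cs) N" "\<And>U x y. U \<in> Cs \<Longrightarrow> x \<in> U \<Longrightarrow> y \<in> U \<Longrightarrow> N x y = cN (rep U) x y"
    using psd_on_glue_family[where M = "\<lambda>U. cN (rep U)", OF N1 N2 N3 N4] by blast
  note N = N'[unfolded Cs_def]
  have UV: "\<Union>(?c ` V) = V" using cV by blast
  have "realizes \<delta> entries V (parcs D) N"
  proof (rule realizesI)
    show "psd_on V N" using N(1) UV by simp
    show "N v v = \<delta> v" if "v \<in> V" for v
    proof -
      have U: "?c v \<in> ?c ` V" "v \<in> ?c v" using that by auto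
      then show ?thesis using N(2)[OF U(1) U(2) U(2)] realizesD(2)[OF cN[OF rep(1)[OF U(1)]], of v] rep(2)[OF U(1)] by simp
    qed
    show "N p q \<in> entries p q" if pq: "(p, q) \<in> parcs D" for p q
    proof -
      have p: "p \<in> V" using pq GD(2) VD by auto
      then have U: "?c p \<in> ?c ` V" by blast
      have m: "p \<in> ?c p" "q \<in> ?c p" using pq by auto
      have "(p, q) \<in> parcs D \<inter> ?c (rep (?c p)) \<times> ?c (rep (?c p))" unfolding rep(2)[OF U] using pq m by blast
      then show ?thesis using N(2)[OF U m] realizesD(3)[OF cN[OF rep(1)[OF U]]] by metis
    qed
  qed
  then show ?thesis by blast
qed

text \<open>Starting from the realized matrix on the vertices of \<open>D\<close>, blocks are
  attached one at a time. A new block meets what is already there only in its terminals, where a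
  completion with the value given by \<open>N\<close> is chosen.\<close>

theorem block_completion:
  assumes "\<And>x. x \<in> V \<Longrightarrow> \<not> has_K4 (restrict_to D {y. (x, y) \<in> (parcs D)\<^sup>*})"
  shows "\<exists>M. completes X \<eta> (pverts G) (parcs G) M"
proof -
  obtain N where N: "realizes \<delta> entries V (parcs D) N" using realizes_D[OF assms] by blast
  have "\<exists>M. psd_on (j ` V \<union> (\<Union>e\<in>Q. B e)) M \<and> (\<forall>x\<in>V. \<forall>y\<in>V. M (j x) (j y) = N x y) \<and>
      (\<forall>e\<in>Q. \<forall>a\<in>B e. \<forall>b\<in>B e. a = b \<or> (a, b) \<in> E e \<longrightarrow> M a b = X a b + (if a = b then \<eta> else 0))"
    if "finite Q" "Q \<subseteq> R" for Q
    using that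
  proof (induction Q rule: finite_induct)
    case empty
    have "psd_on (j ` V) (\<lambda>a b. N (inv j a) (inv j b))"
      by (rule psd_on_reindex[OF _ realizesD(1)[OF N]]) (use fin(1) inj in auto)
    then show ?case using inj by (intro exI[of _ "\<lambda>a b. N (inv j a) (inv j b)"]) auto
  next
    case (insert e Q)
    have e: "e \<in> R" "Q \<subseteq> R" using insert.prems by auto
    let ?S = "j ` V \<union> (\<Union>e\<in>Q. B e)"
    obtain M where M: "psd_on ?S M" "\<And>x y. x \<in> V \<Longrightarrow> y \<in> V \<Longrightarrow> M (j x) (j y) = N x y"
      "\<And>f a b. f \<in> Q \<Longrightarrow> a \<in> B f \<Longrightarrow> b \<in> B f \<Longrightarrow> a = b \<or> (a, b) \<in> E f
        \<Longrightarrow> M a b = X a b + (if a = b then \<eta> else 0)"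
      using insert.IH[OF e(2)] by blast
    have ej: "e \<in> joins (src e) (dst e)" using e(1) by (simp add: joins_def)
    then have "(src e, dst e) \<in> parcs D" using parcs_D by blast
    then have "N (src e) (dst e) \<in> terminal_values e" using realizesD(3)[OF N] ej by blast
    then obtain K where K: "completes X \<eta> (B e) (E e) K" "N (src e) (dst e) = K (j (src e)) (j (dst e))"
      by (auto simp: terminal_values_def)
    have pK: "psd_on (B e) K" using K(1) by (simp add: completes_def)
    have int: "a = j (src e) \<or> a = j (dst e)" if "a \<in> ?S" "a \<in> B e" for a
    proof -
      have "a \<in> range j" using that BB[OF _ e(1), of _ a] e(2) insert.hyps(2) by blast
      then show ?thesis using jB[OF e(1)] that(2) by blast
    qed
    have agree: "M a b = K a b" if ab: "a \<in> ?S \<inter> B e" "b \<in> ?S \<inter> B e" for a b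
    proof -
      note ee = ends(1,2)[OF e(1)] and te = terminals[OF e(1)]
      have "M (j (src e)) (j (dst e)) = K (j (src e)) (j (dst e))" using M(2)[OF ee] K(2) by simp
      moreover have "M (j (dst e)) (j (src e)) = K (j (dst e)) (j (src e))"
        using M(2)[OF ee(2,1)] K(2) psd_on_sym[OF realizesD(1)[OF N] ee] psd_on_sym[OF pK te] by simp
      moreover have "M (j x) (j x) = K (j x) (j x)" if "x = src e \<or> x = dst e" for x
        using that M(2)[of x x] ee te realizesD(2)[OF N, of x] K(1) by (auto simp: completes_def)
      ultimately show ?thesis using int[of a] int[of b] ab by blast
    qed
    have finS: "finite ?S" using fin finB e(2) insert.hyps(1) by auto
    obtain M' where M': "psd_on (?S \<union> B e) M'" "\<And>a b. a \<in> ?S \<Longrightarrow> b \<in> ?S \<Longrightarrow> M' a b = M a b"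
      "\<And>a b. a \<in> B e \<Longrightarrow> b \<in> B e \<Longrightarrow> M' a b = K a b"
      using psd_on_glue[OF finS finB[OF e(1)] M(1) pK agree] by blast
    have "?S \<union> B e = j ` V \<union> (\<Union>e\<in>insert e Q. B e)" by auto
    moreover have "M' (j x) (j y) = N x y" if "x \<in> V" "y \<in> V" for x y
      using M'(2)[of "j x" "j y"] M(2)[OF that] that by simp
    moreover have "M' a b = X a b + (if a = b then \<eta> else 0)"
      if "f \<in> insert e Q" "a \<in> B f" "b \<in> B f" "a = b \<or> (a, b) \<in> E f" for f a b
    proof (cases "f = e")
      case True
      then have "a \<in> B e" "b \<in> B e" "a = b \<or> (a, b) \<in> E e" using that by auto
      moreover from this have "K a b = X a b + (if a = b then \<eta> else 0)"
        using K(1) unfolding completes_def by blast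
      ultimately show ?thesis using M'(3)[of a b] by simp
    next
      case False
      then have "f \<in> Q" "a \<in> ?S" "b \<in> ?S" using that by auto
      then show ?thesis using M'(2)[of a b] M(3)[OF \<open>f \<in> Q\<close> that(2-4)] by simp
    qed
    ultimately show ?case using M'(1) by (intro exI[of _ M']) simp
  qed
  from this[OF fin(2) order_refl] obtain M where M: "psd_on (j ` V \<union> (\<Union>e\<in>R. B e)) M"
    "\<And>x y. x \<in> V \<Longrightarrow> y \<in> V \<Longrightarrow> M (j x) (j y) = N x y"
    "\<And>f a b. f \<in> R \<Longrightarrow> a \<in> B f \<Longrightarrow> b \<in> B f \<Longrightarrow> a = b \<or> (a, b) \<in> E f
        \<Longrightarrow> M a b = X a b + (if a = b then \<eta> else 0)" by blast
  have "completes X \<eta> (pverts G) (parcs G) M"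
    unfolding completes_def
  proof (intro conjI ballI impI)
    show "psd_on (pverts G) M" using M(1) by (simp add: G)
    fix a b assume ab: "a \<in> pverts G" "b \<in> pverts G" "a = b \<or> (a, b) \<in> parcs G"
    show "M a b = X a b + (if a = b then \<eta> else 0)"
    proof (cases "a = b")
      case True
      from ab(1) consider x where "x \<in> V" "a = j x" | e where "e \<in> R" "a \<in> B e" by (auto simp: G)
      then show ?thesis
      proof cases
        case 1
        then show ?thesis using True M(2)[of x x] realizesD(2)[OF N, of x] by simp
      next
        case 2
        then show ?thesis using True M(3)[of e a a] by simp
      qed
    next
      case False
      then obtain e where e: "e \<in> R" "(a, b) \<in> E e" using ab(3) by (auto simp: G)
      then show ?thesis using M(3)[of e a b] EB[OF e(1)] by blast
    qed
  qed
  then show ?thesis by blast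
qed

end

end

section \<open>The additive distance\<close>

definition shifts :: "'a pair_pre_digraph \<Rightarrow> ('a \<Rightarrow> 'a \<Rightarrow> real) \<Rightarrow> real set" where
  "shifts G X = {\<epsilon>. (\<lambda>i j. X i j + \<epsilon> * partial_id G i j) \<in> completable_cone G}"

lemma additive_distance_at_shifts: "additive_distance_at G X = Inf (shifts G X)"
  by (simp add: additive_distance_at_def shifts_def)

lemma sliceD:
  assumes "X \<in> clique_psd_slice G"
  shows "X i j = X j i" "\<not> specified G i j \<Longrightarrow> X i j = 0" "clique G S \<Longrightarrow> psd_on S X"
    "(\<Sum>i\<in>pverts G. X i i) = 1"
  using assms by (auto simp: clique_psd_slice_def clique_psd_cone_def Sym_space_def partial_trace_def)

lemma shiftsI:
  assumes "X \<in> clique_psd_slice G" "psd_on (pverts G) M"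
    and "\<And>i j. specified G i j \<Longrightarrow> M i j = X i j + \<epsilon> * partial_id G i j"
  shows "\<epsilon> \<in> shifts G X"
  using assms sliceD(1,2)[OF assms(1)]
  by (auto simp: shifts_def completable_cone_def Sym_space_def partial_id_def specified_def)

lemma shiftsD:
  assumes "\<epsilon> \<in> shifts G X"
  obtains M where "psd_on (pverts G) M" "\<And>i j. specified G i j \<Longrightarrow> M i j = X i j + \<epsilon> * partial_id G i j"
  using assms by (auto simp: shifts_def completable_cone_def)

lemma shifts_ge:
  assumes "finite (pverts G)" "v \<in> pverts G" "\<epsilon> \<in> shifts G X"
  shows "- X v v \<le> \<epsilon>"
proof -
  obtain M where M: "psd_on (pverts G) M" "\<And>i j. specified G i j \<Longrightarrow> M i j = X i j + \<epsilon> * partial_id G i j"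
    using shiftsD[OF assms(3)] by blast
  have "M v v = X v v + \<epsilon>" using M(2)[of v v] assms(2) by (simp add: specified_def partial_id_def)
  then show ?thesis using psd_on_diag_nonneg[OF assms(1) M(1) assms(2)] by linarith
qed

lemma bdd_below_shifts: "finite (pverts G) \<Longrightarrow> pverts G \<noteq> {} \<Longrightarrow> bdd_below (shifts G X)"
  using shifts_ge[of G] by (meson all_not_in_conv bdd_belowI)

lemma psd_on_diagonally_dominant:
  assumes "finite S" "\<And>i j. i \<in> S \<Longrightarrow> j \<in> S \<Longrightarrow> X i j = X j i" "\<And>i j. i \<in> S \<Longrightarrow> j \<in> S \<Longrightarrow> \<bar>X i j\<bar> \<le> 1"
  shows "psd_on S (\<lambda>i j. X i j + (if i = j then real (card S) else 0))"
proof (rule psd_onI)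
  fix v :: "'a \<Rightarrow> real"
  define q where "q i = (v i)\<^sup>2 / 2" for i
  have b: "- q i - q j \<le> v i * X i j * v j" if "i \<in> S" "j \<in> S" for i j
  proof -
    have "\<bar>v i * X i j * v j\<bar> \<le> \<bar>v i\<bar> * \<bar>v j\<bar>"
      using mult_left_mono[OF assms(3)[OF that], of "\<bar>v i\<bar> * \<bar>v j\<bar>"] by (simp add: abs_mult mult_ac)
    moreover have "2 * (\<bar>v i\<bar> * \<bar>v j\<bar>) \<le> 2 * q i + 2 * q j"
      using sum_squares_bound[of "\<bar>v i\<bar>" "\<bar>v j\<bar>"] by (simp add: q_def)
    moreover have "- (v i * X i j * v j) \<le> \<bar>v i * X i j * v j\<bar>" by (rule abs_ge_minus_self)
    ultimately show ?thesis by linarith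
  qed
  have "(\<Sum>i\<in>S. \<Sum>j\<in>S. - q i - q j) \<le> bform S X v v"
    unfolding bform_def by (intro sum_mono b)
  moreover have "(\<Sum>i\<in>S. \<Sum>j\<in>S. - q i - q j) = - (real (card S) * sum q S) - real (card S) * sum q S"
    by (simp add: sum_subtractf sum_negf sum_distrib_left)
  moreover have "(\<Sum>i\<in>S. v i * real (card S) * v i) = 2 * (real (card S) * sum q S)"
    by (simp add: q_def sum_distrib_left power2_eq_square mult_ac)
  ultimately have "bform S X v v + (\<Sum>i\<in>S. v i * real (card S) * v i) \<ge> 0" by linarith
  then show "bform S (\<lambda>i j. X i j + (if i = j then real (card S) else 0)) v v \<ge> 0"
    by (simp add: bform_add bform_diag[OF assms(1)])
qed (use assms(2) in auto)

text \<open>The trace bounds the diagonal, the 2x2 minors on edges bound the specified entries, and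
  the dummy value of all others is 0.\<close>

lemma slice_abs_le_1:
  assumes "finite (pverts G)" "X \<in> clique_psd_slice G" "sym (parcs G)"
  shows "\<bar>X i j\<bar> \<le> 1"
proof -
  note X = sliceD[OF assms(2)]
  have nn: "X v v \<ge> 0" if "v \<in> pverts G" for v
    using psd_on_diag_nonneg[of "{v}" X v] X(3)[of "{v}"] that by (simp add: clique_def)
  have le: "X v v \<le> 1" if "v \<in> pverts G" for v
    using member_le_sum[of v "pverts G" "\<lambda>v. X v v"] that nn assms(1) X(4) by auto
  show ?thesis
  proof (cases "specified G i j")
    case True
    then have ij: "i \<in> pverts G" "j \<in> pverts G" "clique G {i, j}"
      using symD[OF assms(3)] by (auto simp: specified_def clique_def)
    have "(X i j)\<^sup>2 \<le> X i i * X j j" using psd_on_minor[OF _ X(3)[OF ij(3)]] by simp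
    also have "\<dots> \<le> 1 * 1" using nn le ij by (intro mult_mono) auto
    finally show ?thesis by (simp add: abs_square_le_1)
  qed (use X(2) in simp)
qed

text \<open>A crude shift. It makes \<open>shifts\<close> nonempty and bounds its infima uniformly
  over the slice, so that \<open>Inf\<close> and \<open>Sup\<close> behave as intended.\<close>

lemma card_in_shifts:
  assumes "finite (pverts G)" "X \<in> clique_psd_slice G" "sym (parcs G)"
  shows "real (card (pverts G)) \<in> shifts G X"
proof (rule shiftsI[OF assms(2)])
  show "psd_on (pverts G) (\<lambda>i j. X i j + (if i = j then real (card (pverts G)) else 0))"
    by (rule psd_on_diagonally_dominant[OF assms(1) sliceD(1)[OF assms(2)] slice_abs_le_1[OF assms]])
qed (auto simp: partial_id_def specified_def)

lemma additive_distance_ge: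
  assumes "finite (pverts G)" "pverts G \<noteq> {}" "sym (parcs G)" "X \<in> clique_psd_slice G"
  shows "additive_distance_at G X \<le> additive_distance G"
  unfolding additive_distance_def
proof (rule cSup_upper)
  show "bdd_above (additive_distance_at G ` clique_psd_slice G)"
    unfolding bdd_above_def additive_distance_at_shifts
    by (auto intro!: exI[of _ "real (card (pverts G))"] cInf_lower card_in_shifts bdd_below_shifts assms)
qed (use assms(4) in simp)

lemma slice_unit:
  assumes "finite (pverts G)" "v \<in> pverts G"
  shows "(\<lambda>i j. if i = v \<and> j = v then 1 else 0) \<in> clique_psd_slice G" (is "?X \<in> _")
proof -
  have "psd_on S ?X" for S
    using psd_on_rank1[of S "\<lambda>i. if i = v then 1 else 0"] by (rule psd_on_cong[rotated]) auto
  moreover have "(\<Sum>i\<in>pverts G. ?X i i) = 1" using assms by simp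
  ultimately show ?thesis using assms(2)
    by (auto simp: clique_psd_slice_def clique_psd_cone_def Sym_space_def partial_trace_def specified_def)
qed

lemma additive_distance_le:
  assumes "finite (pverts G)" "pverts G \<noteq> {}" "\<And>X. X \<in> clique_psd_slice G \<Longrightarrow> additive_distance_at G X \<le> c"
  shows "additive_distance G \<le> c"
  unfolding additive_distance_def
proof (rule cSup_least)
  obtain v where "v \<in> pverts G" using assms(2) by blast
  then show "additive_distance_at G ` clique_psd_slice G \<noteq> {}" using slice_unit[OF assms(1)] by auto
qed (use assms(3) in blast)

text \<open>The matrix with the single entry 1 at \<open>v\<close> has diagonal 0 at
  \<open>w\<close>, so no negative shift makes it completable. With one vertex only, the additive
  distance is -1.\<close>

lemma additive_distance_nonneg:
  assumes "finite (pverts G)" "sym (parcs G)" "v \<in> pverts G" "w \<in> pverts G" "v \<noteq> w"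
  shows "additive_distance G \<ge> 0"
proof -
  let ?X = "\<lambda>i j. if i = v \<and> j = v then 1 else 0 :: real"
  have X: "?X \<in> clique_psd_slice G" by (rule slice_unit[OF assms(1,3)])
  have "Inf (shifts G ?X) \<ge> 0"
  proof (rule cInf_greatest)
    show "shifts G ?X \<noteq> {}" using card_in_shifts[OF assms(1) X assms(2)] by blast
    show "0 \<le> \<epsilon>" if "\<epsilon> \<in> shifts G ?X" for \<epsilon> using shifts_ge[OF assms(1,4) that] assms(5) by simp
  qed
  then have "additive_distance_at G ?X \<ge> 0" by (simp add: additive_distance_at_shifts)
  also have "additive_distance_at G ?X \<le> additive_distance G"
    by (rule additive_distance_ge[OF assms(1) _ assms(2) X]) (use assms(3) in auto)
  finally show ?thesis .
qed

section \<open>Cycle graphs and comparison with induced cycles\<close>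

lemma cycle_graph_simps:
  "pverts (cycle_graph n) = {..<n}"
  "(i, j) \<in> parcs (cycle_graph n) \<longleftrightarrow> i < n \<and> j < n \<and> (j = Suc i mod n \<or> i = Suc j mod n)"
  by (auto simp: cycle_graph_def)

lemma sym_cycle_graph: "sym (parcs (cycle_graph n))"
  by (auto simp: sym_def cycle_graph_simps)

lemma cycle_graph_clique:
  assumes "n \<ge> 4" "clique (cycle_graph n) S"
  obtains i where "i < n" "S \<subseteq> {i, Suc i mod n}"
proof (cases "S = {}")
  case True
  then show thesis using that[of 0] assms(1) by auto
next
  case False
  then obtain x where x: "x \<in> S" by blast
  have adj: "y < n \<and> z < n \<and> (z = Suc y mod n \<or> y = Suc z mod n)" if "y \<in> S" "z \<in> S" "y \<noteq> z" for y z
    using assms(2) that by (auto simp: clique_def cycle_graph_simps)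
  have xn: "x < n" using assms(2) x by (auto simp: clique_def cycle_graph_simps)
  define p where "p = (if x = 0 then n - 1 else x - 1)"
  have p: "p < n" "Suc p mod n = x" using xn assms(1) by (auto simp: p_def)
  have nb: "y = x \<or> y = Suc x mod n \<or> y = p" if "y \<in> S" for y
  proof (cases "y = x")
    case False
    then have "y < n" "y = Suc x mod n \<or> x = Suc y mod n" using adj[OF x that] by auto
    then show ?thesis by (auto simp: p_def mod_Suc split: if_splits)
  qed simp
  have "\<not> (Suc x mod n \<in> S \<and> p \<in> S)"
  proof
    assume "Suc x mod n \<in> S \<and> p \<in> S"
    moreover have "Suc x mod n \<noteq> p" using xn assms(1) by (auto simp: p_def mod_Suc)
    ultimately have "p = Suc (Suc x mod n) mod n \<or> Suc x mod n = Suc p mod n" using adj by blast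
    then show False using xn assms(1) p by (auto simp: p_def mod_Suc split: if_splits)
  qed
  then consider "S \<subseteq> {x, Suc x mod n}" | "S \<subseteq> {p, x}" using nb by blast
  then show thesis
  proof cases
    case 1 then show thesis using that[OF xn] by blast
  next
    case 2 then show thesis using that[OF p(1)] p(2) by simp
  qed
qed

text \<open>Divided by the total of the diagonal, the data lie in the slice. The strict inequality
  yields a feasible shift below \<open>\<epsilon>\<close> whether or not the infimum is attained;
  the diagonal is then raised to \<open>\<epsilon>\<close>.\<close>

lemma cycle_bound_if_additive_distance:
  assumes n: "n \<ge> 4" and \<epsilon>: "additive_distance (cycle_graph n) < \<epsilon>"
  shows "cycle_bound n \<epsilon>"
  unfolding cycle_bound_def
proof (intro allI impI)
  fix \<delta> a :: "nat \<Rightarrow> real"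
  assume \<delta>: "\<forall>i<n. \<delta> i \<ge> 0" and a: "\<forall>i<n. (a i)\<^sup>2 \<le> \<delta> i * \<delta> (Suc i mod n)"
  let ?\<tau> = "sum \<delta> {..<n}" and ?G = "cycle_graph n"
  have sn: "Suc i mod n < n" "Suc i mod n \<noteq> i" "Suc (Suc i mod n) mod n \<noteq> i" if "i < n" for i
    using that n by (auto simp: mod_Suc)
  show "\<exists>M. psd_on {..<n} M \<and> (\<forall>i<n. M i i = \<delta> i + \<epsilon> * ?\<tau> \<and> M i (Suc i mod n) = a i)"
  proof (cases "?\<tau> = 0")
    case True
    then have "\<delta> i = 0" if "i < n" for i
      using sum_nonneg_eq_0_iff[of "{..<n}" \<delta>] \<delta> that by auto
    then show ?thesis using a sn(1) True psd_on_zero[of "{..<n}"] by (intro exI[of _ "\<lambda>i j. 0"]) auto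
  next
    case False
    then have \<tau>: "?\<tau> > 0" using sum_nonneg[of "{..<n}" \<delta>] \<delta> by fastforce
    define X where "X i j = (if i < n \<and> j < n then
      (if i = j then \<delta> i else if j = Suc i mod n then a i else if i = Suc j mod n then a j else 0) / ?\<tau> else 0)" for i j
    have Xs: "X i j = X j i" for i j
      using sn(2,3)[symmetric] by (cases "i < n \<and> j < n") (auto simp: X_def)
    have Xe: "X i i = \<delta> i / ?\<tau>" "X i (Suc i mod n) = a i / ?\<tau>" if "i < n" for i
      using sn[OF that] that by (auto simp: X_def)
    have "psd_on S X" if S: "clique ?G S" for S
    proof -
      obtain i where i: "i < n" "S \<subseteq> {i, Suc i mod n}" using cycle_graph_clique[OF n S] by blast
      have "psd_on {i, Suc i mod n} X"
      proof (rule psd_on_pair)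
        show "(X i (Suc i mod n))\<^sup>2 \<le> X i i * X (Suc i mod n) (Suc i mod n)"
          using a[rule_format, OF i(1)] \<tau> Xe[OF i(1)] Xe(1)[OF sn(1)[OF i(1)]]
          by (simp add: power_divide power2_eq_square divide_right_mono)
        show "X i i \<ge> 0" "X (Suc i mod n) (Suc i mod n) \<ge> 0"
          using \<delta> \<tau> Xe(1) sn(1)[OF i(1)] i(1) by auto
      qed (use sn(2)[OF i(1)] Xs in auto)
      then show ?thesis using psd_on_subset[of "{i, Suc i mod n}"] i(2) by blast
    qed
    moreover have "(\<Sum>i\<in>pverts ?G. X i i) = 1"
      using \<tau> by (simp add: cycle_graph_simps Xe sum_divide_distrib[symmetric])
    moreover have "X i j = 0" if "\<not> specified ?G i j" for i j
      using that by (auto simp: specified_def cycle_graph_simps X_def)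
    ultimately have XG: "X \<in> clique_psd_slice ?G"
      using Xs by (simp add: clique_psd_slice_def clique_psd_cone_def Sym_space_def partial_trace_def)
    have f: "finite (pverts ?G)" "pverts ?G \<noteq> {}" using n by (auto simp: cycle_graph_simps lessThan_empty_iff)
    have "Inf (shifts ?G X) < \<epsilon>"
      using additive_distance_ge[OF f sym_cycle_graph XG] \<epsilon> by (simp add: additive_distance_at_shifts)
    then obtain \<epsilon>' where \<epsilon>': "\<epsilon>' \<in> shifts ?G X" "\<epsilon>' < \<epsilon>"
      using cInf_lessD[of "shifts ?G X" \<epsilon>] card_in_shifts[OF f(1) XG sym_cycle_graph] by blast
    obtain M where M: "psd_on (pverts ?G) M"
      "\<And>i j. specified ?G i j \<Longrightarrow> M i j = X i j + \<epsilon>' * partial_id ?G i j"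
      using shiftsD[OF \<epsilon>'(1)] by blast
    let ?M = "\<lambda>i j. ?\<tau> * M i j + (if i = j then ?\<tau> * (\<epsilon> - \<epsilon>') else 0)"
    have "psd_on {..<n} ?M" using M(1) \<tau> \<epsilon>'(2)
      by (intro psd_on_add_diag psd_on_scale) (auto simp: cycle_graph_simps)
    moreover have "?M i i = \<delta> i + \<epsilon> * ?\<tau> \<and> ?M i (Suc i mod n) = a i" if "i < n" for i
      using M(2)[of i i] M(2)[of i "Suc i mod n"] that sn[OF that] Xe[OF that] \<tau>
      by (auto simp: specified_def cycle_graph_simps partial_id_def field_simps)
    ultimately show ?thesis by blast
  qed
qed

text \<open>As the cycle is induced, a clique of \<open>G\<close> meets it in a clique of the cycle,
  so the extension by 0 is positive semidefinite on cliques. Completions of the extension restrict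
  to the cycle, so its feasible shifts are feasible for the cycle, and the infimum over the smaller
  set is larger.\<close>

lemma additive_distance_induced_cycle:
  assumes fin: "finite (pverts G)" and sym: "sym (parcs G)" and n: "n \<ge> 4" and ind: "has_induced_cycle G n"
  shows "additive_distance (cycle_graph n) \<le> additive_distance G"
proof -
  let ?C = "cycle_graph n"
  obtain f where f: "inj_on f {..<n}" "f ` {..<n} \<subseteq> pverts G"
    "\<And>i k. i < n \<Longrightarrow> k < n \<Longrightarrow> (f i, f k) \<in> parcs G \<longleftrightarrow> (i, k) \<in> parcs ?C"
    using ind by (auto simp: has_induced_cycle_def)
  have fC: "finite (pverts ?C)" "pverts ?C \<noteq> {}" using n by (auto simp: cycle_graph_simps lessThan_empty_iff)
  have "f 0 \<in> pverts G" using f(2) n by (auto simp: image_subset_iff)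
  then have fG: "pverts G \<noteq> {}" by blast
  define r where "r = inv_into {..<n} f"
  have r: "r (f i) = i" if "i < n" for i using f(1) that by (simp add: r_def)
  have spec: "specified G (f i) (f k) \<longleftrightarrow> specified ?C i k" if "i < n" "k < n" for i k
    using f(2,3) inj_on_eq_iff[OF f(1)] that by (auto simp: specified_def cycle_graph_simps)
  show ?thesis
  proof (rule additive_distance_le[OF fC])
    fix X assume X: "X \<in> clique_psd_slice ?C"
    note XD = sliceD[OF X]
    let ?I = "f ` {..<n}"
    define Y where "Y u v = (if u \<in> ?I \<and> v \<in> ?I then X (r u) (r v) else 0)" for u v
    have Yf: "Y (f i) (f k) = X i k" if "i < n" "k < n" for i k using that r by (simp add: Y_def)
    have "psd_on S Y" if S: "clique G S" for S
    proof -
      have finS: "finite S" using S fin by (auto simp: clique_def intro: finite_subset)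
      have "clique ?C (r ` (S \<inter> ?I))"
        unfolding clique_def
      proof (intro conjI ballI impI)
        show "r ` (S \<inter> ?I) \<subseteq> pverts ?C" using r by (auto simp: cycle_graph_simps)
        fix i k assume ik: "i \<in> r ` (S \<inter> ?I)" "k \<in> r ` (S \<inter> ?I)" "i \<noteq> k"
        then have ikS: "i < n" "k < n" "f i \<in> S" "f k \<in> S" using r by auto
        then have "f i \<noteq> f k" using inj_on_eq_iff[OF f(1), of i k] ik(3) by simp
        then have "(f i, f k) \<in> parcs G" using S ikS(3,4) unfolding clique_def by blast
        then show "(i, k) \<in> parcs ?C" using f(3)[OF ikS(1,2)] by blast
      qed
      then have "psd_on (r ` (S \<inter> ?I)) X" by (rule XD(3))
      then have "psd_on (S \<inter> ?I) (\<lambda>u v. X (r u) (r v))"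
        by (rule psd_on_reindex[rotated]) (use finS in auto)
      then have "psd_on S (\<lambda>u v. if u \<in> S \<inter> ?I \<and> v \<in> S \<inter> ?I then X (r u) (r v) else 0)"
        by (rule psd_on_extend_zero[OF finS]) auto
      then show ?thesis by (rule psd_on_cong[rotated]) (auto simp: Y_def)
    qed
    moreover have "(\<Sum>u\<in>pverts G. Y u u) = 1"
    proof -
      have "(\<Sum>u\<in>pverts G. Y u u) = (\<Sum>u\<in>?I. Y u u)"
        by (rule sum.mono_neutral_right[OF fin f(2)]) (auto simp: Y_def)
      also have "\<dots> = (\<Sum>i<n. X i i)" by (subst sum.reindex[OF f(1)]) (simp add: Yf)
      finally show ?thesis using XD(4) by (simp add: cycle_graph_simps)
    qed
    moreover have "Y u v = Y v u" for u v using XD(1) by (auto simp: Y_def)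
    moreover have "Y u v = 0" if ns: "\<not> specified G u v" for u v
    proof (cases "u \<in> ?I \<and> v \<in> ?I")
      case True
      then obtain i k where "i < n" "k < n" "u = f i" "v = f k" by auto
      then show ?thesis using Yf XD(2) spec ns by simp
    qed (simp only: Y_def if_False)
    ultimately have Y: "Y \<in> clique_psd_slice G"
      by (auto simp: clique_psd_slice_def clique_psd_cone_def Sym_space_def partial_trace_def)
    have "shifts G Y \<subseteq> shifts ?C X"
    proof
      fix \<epsilon> assume "\<epsilon> \<in> shifts G Y"
      then obtain M where M: "psd_on (pverts G) M"
        "\<And>u v. specified G u v \<Longrightarrow> M u v = Y u v + \<epsilon> * partial_id G u v"
        using shiftsD by blast
      show "\<epsilon> \<in> shifts ?C X"
      proof (rule shiftsI[OF X])
        show "psd_on (pverts ?C) (\<lambda>i k. M (f i) (f k))"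
          by (rule psd_on_reindex[OF fC(1) M(1) _ fin]) (use f(2) in \<open>simp add: cycle_graph_simps\<close>)
        fix i k assume s: "specified ?C i k"
        then have ik: "i < n" "k < n" by (auto simp: specified_def cycle_graph_simps)
        have "partial_id G (f i) (f k) = partial_id ?C i k"
          using ik f(2) inj_on_eq_iff[OF f(1)] by (auto simp: partial_id_def cycle_graph_simps)
        then show "M (f i) (f k) = X i k + \<epsilon> * partial_id ?C i k"
          using M(2)[of "f i" "f k"] spec[OF ik] s Yf[OF ik] by simp
      qed
    qed
    then have "Inf (shifts ?C X) \<le> Inf (shifts G Y)"
      using card_in_shifts[OF fin Y sym] by (intro cInf_superset_mono bdd_below_shifts fC) auto
    then show "additive_distance_at ?C X \<le> additive_distance G"
      using additive_distance_ge[OF fin fG sym Y] by (simp add: additive_distance_at_shifts)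
  qed
qed

lemma chordal_girth_enat:
  assumes "chordal_girth G = enat g"
  shows "g \<ge> 4" "has_induced_cycle G g" "\<And>n. n \<ge> 4 \<Longrightarrow> has_induced_cycle G n \<Longrightarrow> g \<le> n"
proof -
  let ?A = "{enat n | n. n \<ge> 4 \<and> has_induced_cycle G n}"
  have "?A \<noteq> {}"
  proof
    assume "?A = {}"
    then have "chordal_girth G = Inf {}" unfolding chordal_girth_def by (simp only:)
    then show False using assms by (simp add: Inf_enat_def)
  qed
  then obtain a where "a \<in> ?A" by blast
  then have "Inf ?A \<in> ?A" by (rule wellorder_InfI)
  then show "g \<ge> 4" "has_induced_cycle G g" using assms by (auto simp: chordal_girth_def)
  show "g \<le> n" if "n \<ge> 4" "has_induced_cycle G n" for n
  proof -
    have "Inf ?A \<le> enat n" by (rule Inf_lower) (use that in blast)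
    then show ?thesis using assms by (simp add: chordal_girth_def)
  qed
qed

lemma chordal_girth_infinity:
  assumes "chordal_girth G = \<infinity>" "n \<ge> 4"
  shows "\<not> has_induced_cycle G n"
proof
  assume "has_induced_cycle G n"
  then have "Inf {enat n | n. n \<ge> 4 \<and> has_induced_cycle G n} \<le> enat n"
    by (intro Inf_lower) (use assms(2) in blast)
  then show False using assms(1) by (simp add: chordal_girth_def)
qed

lemma additive_distance_eq_cycle:
  assumes fin: "finite (pverts G)" and sym: "sym (parcs G)" and card: "2 \<le> card (pverts G)"
    and completion: "\<And>X \<epsilon>. (\<And>S. clique G S \<Longrightarrow> psd_on S X) \<Longrightarrow> \<epsilon> \<ge> 0 \<Longrightarrow>
      (\<And>n. n \<ge> 4 \<Longrightarrow> has_induced_cycle G n \<Longrightarrow> cycle_bound n \<epsilon>) \<Longrightarrow>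
      \<exists>M. completes X (\<epsilon> * (\<Sum>i\<in>pverts G. X i i)) (pverts G) (parcs G) M"
  shows "additive_distance G = cycle_additive_distance (chordal_girth G)"
proof -
  have ne: "pverts G \<noteq> {}" using card by auto
  obtain v w where vw: "v \<in> pverts G" "w \<in> pverts G" "v \<noteq> w"
  proof -
    obtain v where "v \<in> pverts G" using ne by blast
    moreover have "\<not> pverts G \<subseteq> {v}" using card card_mono[of "{v}" "pverts G"] by auto
    ultimately show thesis using that by blast
  qed
  have upper: "additive_distance G \<le> \<epsilon>"
    if \<epsilon>: "\<epsilon> \<ge> 0" "\<And>n. n \<ge> 4 \<Longrightarrow> has_induced_cycle G n \<Longrightarrow> cycle_bound n \<epsilon>" for \<epsilon>
  proof (rule additive_distance_le[OF fin ne])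
    fix X assume X: "X \<in> clique_psd_slice G"
    obtain M where M: "completes X (\<epsilon> * (\<Sum>i\<in>pverts G. X i i)) (pverts G) (parcs G) M"
      using completion[OF sliceD(3)[OF X] \<epsilon>] by blast
    have "\<epsilon> \<in> shifts G X"
      by (rule shiftsI[OF X, of M])
        (use M sliceD(4)[OF X] in \<open>auto simp: completes_def specified_def partial_id_def\<close>)
    then show "additive_distance_at G X \<le> \<epsilon>"
      unfolding additive_distance_at_shifts by (intro cInf_lower bdd_below_shifts fin ne)
  qed
  show ?thesis
  proof (cases "chordal_girth G")
    case (enat g)
    note g = chordal_girth_enat[OF enat]
    have d0: "additive_distance (cycle_graph g) \<ge> 0"
      by (rule additive_distance_nonneg[of _ 0 1])
        (use g(1) sym_cycle_graph in \<open>auto simp: cycle_graph_simps\<close>)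
    \<comment> \<open>\<open>cycle_bound\<close> is available strictly above the additive distance
      of the cycle; the slack \<open>e\<close> is removed by
      \<open>field_le_epsilon\<close>.\<close>
    have "additive_distance G \<le> additive_distance (cycle_graph g) + e" if "e > 0" for e
    proof (rule upper)
      show "additive_distance (cycle_graph g) + e \<ge> 0" using d0 that by simp
      have "cycle_bound g (additive_distance (cycle_graph g) + e)"
        using cycle_bound_if_additive_distance[OF g(1)] that by simp
      then show "cycle_bound n (additive_distance (cycle_graph g) + e)"
        if "n \<ge> 4" "has_induced_cycle G n" for n
        using cycle_bound_mono[of g _ n] g(1) g(3)[OF that] d0 \<open>e > 0\<close> by simp
    qed
    then have "additive_distance G \<le> additive_distance (cycle_graph g)" by (rule field_le_epsilon)
    moreover have "additive_distance (cycle_graph g) \<le> additive_distance G"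
      by (rule additive_distance_induced_cycle[OF fin sym g(1,2)])
    ultimately show ?thesis by (simp add: cycle_additive_distance_def enat)
  next
    case infinity
    \<comment> \<open>Without induced cycles on at least 4 vertices the condition on
      \<open>\<epsilon>\<close> is vacuous, so the shift 0 suffices.\<close>
    have "additive_distance G \<le> 0" using upper[of 0] chordal_girth_infinity[OF infinity] by blast
    then show ?thesis
      using additive_distance_nonneg[OF fin sym vw] by (simp add: cycle_additive_distance_def infinity)
  qed
qed

section \<open>Application to the glued graph\<close>

lemma has_induced_cycle_image:
  assumes "inj g" "has_induced_cycle \<lparr>pverts = g ` V, parcs = {(g x, g y) | x y. (x, y) \<in> A}\<rparr> n"
  shows "has_induced_cycle \<lparr>pverts = V, parcs = A\<rparr> n"
proof -
  obtain f where f: "inj_on f {..<n}" "f ` {..<n} \<subseteq> g ` V"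
    "\<And>i k. i < n \<Longrightarrow> k < n \<Longrightarrow> (f i, f k) \<in> {(g x, g y) | x y. (x, y) \<in> A} \<longleftrightarrow> (i, k) \<in> parcs (cycle_graph n)"
    using assms(2) by (auto simp: has_induced_cycle_def)
  have gf: "g (inv g (f i)) = f i" "inv g (f i) \<in> V" if "i < n" for i
  proof -
    obtain v where v: "v \<in> V" "f i = g v" using f(2) \<open>i < n\<close> by blast
    then have "inv g (f i) = v" using inv_f_f[OF assms(1)] by simp
    then show "g (inv g (f i)) = f i" "inv g (f i) \<in> V" using v by auto
  qed
  have e: "(x, y) \<in> A \<longleftrightarrow> (g x, g y) \<in> {(g x, g y) | x y. (x, y) \<in> A}" for x y
    using assms(1) by (auto simp: inj_eq)
  show ?thesis
    unfolding has_induced_cycle_def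
  proof (intro exI[of _ "\<lambda>i. inv g (f i)"] conjI allI impI)
    show "inj_on (\<lambda>i. inv g (f i)) {..<n}"
      by (rule inj_onI) (metis f(1) gf(1) inj_onD lessThan_iff)
    show "(\<lambda>i. inv g (f i)) ` {..<n} \<subseteq> pverts \<lparr>pverts = V, parcs = A\<rparr>" using gf(2) by auto
    show "(inv g (f i), inv g (f k)) \<in> parcs \<lparr>pverts = V, parcs = A\<rparr> \<longleftrightarrow> (i, k) \<in> parcs (cycle_graph n)"
      if "i < n" "k < n" for i k
      using f(3)[OF that] e[of "inv g (f i)" "inv g (f k)"] gf(1) that by simp
  qed
qed

text \<open>The vertices reachable from \<open>x\<close> induce a strongly connected component, to
  which the definition of \<open>series_parallel\<close> applies.\<close>

lemma no_K4_component:
  assumes "pair_graph G" "series_parallel G" "x \<in> pverts G"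
  shows "\<not> has_K4 (restrict_to G {y. (x, y) \<in> (parcs G)\<^sup>*})"
proof -
  interpret pair_graph G by fact
  have "reachable (with_proj G) x y \<longleftrightarrow> (x, y) \<in> (parcs G)\<^sup>*" for y
  proof
    show "(x, y) \<in> (parcs G)\<^sup>*" if "reachable (with_proj G) x y"
      using reachable_rtranclI[OF that] by simp
    assume r: "(x, y) \<in> (parcs G)\<^sup>*"
    then have "y \<in> pverts G"
      by (induction rule: rtrancl_induct) (use assms(3) in \<open>auto intro: in_arcsD2\<close>)
    then show "reachable (with_proj G) x y"
      unfolding reachable_def using r assms(3)
      by (auto intro!: rtrancl_consistent_rtrancl_on intro: in_arcsD2)
  qed
  then have "{y. reachable (with_proj G) x y} = {y. (x, y) \<in> (parcs G)\<^sup>*}" by blast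
  moreover have "with_proj (restrict_to G P) = induce_subgraph (with_proj G) P" for P
  proof -
    have "parcs G \<inter> P \<times> P = {e \<in> parcs G. fst e \<in> P \<and> snd e \<in> P}" by auto
    then show ?thesis by (simp add: with_proj_def induce_subgraph_def restrict_to_def)
  qed
  ultimately have "with_proj (restrict_to G {y. (x, y) \<in> (parcs G)\<^sup>*})
      = induce_subgraph (with_proj G) {y. reachable (with_proj G) x y}"
    by simp
  then have "with_proj (restrict_to G {y. (x, y) \<in> (parcs G)\<^sup>*}) \<in> pre_digraph.sccs (with_proj G)"
    using induce_reachable_is_in_sccs[of x] assms(3) by simp
  then show ?thesis using assms(2) unfolding series_parallel_def has_K4_def by blast
qed

lemma connected_rtrancl:
  assumes "pair_graph G" "Digraph_Component.connected (with_proj G)" "x \<in> pverts G" "y \<in> pverts G"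
  shows "(x, y) \<in> (parcs G)\<^sup>*"
proof -
  have "parcs (mk_symmetric (with_proj G)) = parcs G"
    using pair_graph_sym[OF assms(1)] by (fastforce simp: parcs_mk_symmetric)
  moreover have "reachable (with_proj (mk_symmetric (with_proj G))) x y"
    using assms(2-4) by (simp add: Digraph_Component.connected_def strongly_connected_def)
  ultimately show ?thesis using reachable_rtranclI by fastforce
qed

text \<open>The representative \<open>Inr (e, x)\<close> carries the arc, so different blocks meet
  only in vertices of the form \<open>Inl v\<close>. The underlying simple graph of \<open>D\<close>
  is \<open>mk_symmetric D\<close>.\<close>

lemma block_graph_glued_graph:
  assumes D: "multidigraph D" and th: "thickening D C T H"
  shows "block_graph (verts D) (arcs D) (tail D) (head D) Inl (\<lambda>e. glue D T H e ` pverts (C e))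
    (\<lambda>e. {(glue D T H e x, glue D T H e y) | x y. (x, y) \<in> parcs (C e)})
    (glued_graph D C T H) (mk_symmetric D)"
proof -
  have C: "gluing_data D C T H" using th by (simp add: thickening_def)
  have fD: "finite (verts D)" "finite (arcs D)"
    using D by (auto simp: multidigraph_def fin_digraph_def fin_digraph_axioms_def)
  have wf: "wf_digraph D" using D by (simp add: multidigraph_def fin_digraph_def)
  have nl: "tail D e \<noteq> head D e" if "e \<in> arcs D" for e
    using D that by (auto simp: multidigraph_def loopfree_digraph.no_loops)
  have Ce: "pair_graph (C e)" "Digraph_Component.connected (with_proj (C e))" "chordal (C e)"
    "T e \<in> pverts (C e)" "H e \<in> pverts (C e)" "T e \<noteq> H e" if "e \<in> arcs D" for e
    using C that by (auto simp: gluing_data_def)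
  have inj: "inj (glue D T H e)" if "e \<in> arcs D" for e
    using nl[OF that] by (auto simp: inj_def glue_def split: if_splits)
  let ?B = "\<lambda>e. glue D T H e ` pverts (C e)"
  let ?E = "\<lambda>e. {(glue D T H e x, glue D T H e y) | x y. (x, y) \<in> parcs (C e)}"
  show ?thesis
  proof unfold_locales
    show "finite (verts D)" "finite (arcs D)" by fact+
    show "inj (Inl :: 'a \<Rightarrow> 'a + 'b \<times> 'c)" by simp
    show "tail D e \<in> verts D" "head D e \<in> verts D" "tail D e \<noteq> head D e" if "e \<in> arcs D" for e
      using that wf nl by (auto simp: wf_digraph_def)
    show "finite (?B e)" if "e \<in> arcs D" for e using pair_graphD(1)[OF Ce(1)[OF that]] by simp
    show "Inl (tail D e) \<in> ?B e" if "e \<in> arcs D" for e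
      using Ce(4)[OF that] by (intro image_eqI[of _ _ "T e"]) (auto simp: glue_def)
    show "Inl (head D e) \<in> ?B e" if "e \<in> arcs D" for e
      using Ce(5,6)[OF that] by (intro image_eqI[of _ _ "H e"]) (auto simp: glue_def)
    show "v = tail D e \<or> v = head D e" if "Inl v \<in> ?B e" for e v
      using that by (auto simp: glue_def split: if_splits)
    show "b \<in> range Inl" if "e \<noteq> f" "b \<in> ?B e" "b \<in> ?B f" for e f b
      using that by (auto simp: glue_def split: if_splits)
    show "?E e \<subseteq> ?B e \<times> ?B e" if "e \<in> arcs D" for e using pair_graphD(2)[OF Ce(1)[OF that]] by blast
    show "sym (?E e)" if "e \<in> arcs D" for e
      using pair_graphD(3)[OF Ce(1)[OF that]] by (fastforce simp: sym_def)
    show "irrefl (?E e)" if "e \<in> arcs D" for e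
      using pair_graphD(4)[OF Ce(1)[OF that]] inj[OF that] by (auto simp: irrefl_def inj_eq)
    show "chordal \<lparr>pverts = ?B e, parcs = ?E e\<rparr>" if "e \<in> arcs D" for e
      unfolding chordal_def
    proof (intro allI impI notI)
      fix n :: nat
      assume n: "4 \<le> n" "has_induced_cycle \<lparr>pverts = ?B e, parcs = ?E e\<rparr> n"
      have "has_induced_cycle \<lparr>pverts = pverts (C e), parcs = parcs (C e)\<rparr> n"
        by (rule has_induced_cycle_image[OF inj[OF that] n(2)])
      moreover have "\<lparr>pverts = pverts (C e), parcs = parcs (C e)\<rparr> = C e" by simp
      ultimately have "has_induced_cycle (C e) n" by (simp only:)
      then show False using Ce(3)[OF that] n(1) unfolding chordal_def by blast
    qed
    show "(x, y) \<in> (?E e)\<^sup>*" if e: "e \<in> arcs D" and xy: "x \<in> ?B e" "y \<in> ?B e" for e x y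
    proof -
      obtain x' y' where x': "x' \<in> pverts (C e)" "y' \<in> pverts (C e)" "x = glue D T H e x'" "y = glue D T H e y'"
        using xy by blast
      have "(x', y') \<in> (parcs (C e))\<^sup>*" by (rule connected_rtrancl[OF Ce(1,2)[OF e] x'(1,2)])
      then have "(glue D T H e x', glue D T H e y') \<in> (?E e)\<^sup>*"
      proof (induction rule: rtrancl_induct)
        case (step y z)
        then have "(glue D T H e y, glue D T H e z) \<in> ?E e" by blast
        then show ?case using step.IH by (rule rtrancl_into_rtrancl[rotated])
      qed simp
      then show ?thesis using x' by simp
    qed
    show "glued_graph D C T H = \<lparr>pverts = Inl ` verts D \<union> (\<Union>e\<in>arcs D. ?B e), parcs = (\<Union>e\<in>arcs D. ?E e)\<rparr>"
      by (simp add: glued_graph_def)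
    show "mk_symmetric D = \<lparr>pverts = verts D, parcs = \<Union>e\<in>arcs D. {(tail D e, head D e), (head D e, tail D e)}\<rparr>"
      by (simp add: mk_symmetric_def)
    show "\<exists>e\<in>arcs D. triangle \<lparr>pverts = ?B e, parcs = ?E e\<rparr> S" if S: "triangle (glued_graph D C T H) S" for S
    proof -
      obtain e S' where e: "e \<in> arcs D" "triangle (C e) S'" "S = glue D T H e ` S'"
        using th S unfolding thickening_def by blast
      have "card S = card S'"
        unfolding e(3) by (rule card_image[OF inj_on_subset[OF inj[OF e(1)] subset_UNIV]])
      moreover have "clique \<lparr>pverts = ?B e, parcs = ?E e\<rparr> S"
        unfolding clique_def
      proof (intro conjI ballI impI)
        have c: "clique (C e) S'" using e(2) by (simp add: triangle_def)
        then show "S \<subseteq> pverts \<lparr>pverts = ?B e, parcs = ?E e\<rparr>" unfolding e(3) clique_def by auto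
        fix a b assume ab: "a \<in> S" "b \<in> S" "a \<noteq> b"
        then obtain x y where xy: "x \<in> S'" "y \<in> S'" "a = glue D T H e x" "b = glue D T H e y"
          unfolding e(3) by blast
        have "x \<noteq> y" using ab(3) xy(3,4) by metis
        then have "(x, y) \<in> parcs (C e)" using c xy(1,2) unfolding clique_def by simp
        then show "(a, b) \<in> parcs \<lparr>pverts = ?B e, parcs = ?E e\<rparr>"
          unfolding xy(3,4) pair_pre_digraph.simps by blast
      qed
      ultimately show ?thesis using e(1,2) by (auto simp: triangle_def)
    qed
  qed
qed

theorem corollary3p2:
  fixes D :: "('v, 'e) pre_digraph"
    and C :: "'e \<Rightarrow> 'c pair_pre_digraph"
    and T H :: "'e \<Rightarrow> 'c"
  assumes "multidigraph D"
    and "2 \<le> card (verts D)"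
    and "triangle_free (mk_symmetric D)"
    and "series_parallel (mk_symmetric D)"
    and "thickening D C T H"
  shows "additive_distance (glued_graph D C T H) =
         cycle_additive_distance (chordal_girth (glued_graph D C T H))"
proof -
  let ?G = "glued_graph D C T H"
  interpret bg: block_graph "verts D" "arcs D" "tail D" "head D" "Inl :: 'v \<Rightarrow> 'v + 'e \<times> 'c"
    "\<lambda>e. glue D T H e ` pverts (C e)" "\<lambda>e. {(glue D T H e x, glue D T H e y) | x y. (x, y) \<in> parcs (C e)}"
    ?G "mk_symmetric D"
    by (rule block_graph_glued_graph[OF assms(1,5)])
  have pgD: "pair_graph (mk_symmetric D)"
    by (rule pair_graphI) (use bg.fin bg.ends bg.ends(3)[symmetric] in \<open>auto simp: mk_symmetric_def sym_def irrefl_def\<close>)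
  \<comment> \<open>Distinct vertices of \<open>D\<close> stay distinct in the glued graph, which
    therefore has two vertices and a nonnegative additive distance.\<close>
  have "card (verts D) = card ((Inl :: 'v \<Rightarrow> 'v + 'e \<times> 'c) ` verts D)" by (simp add: card_image)
  also have "\<dots> \<le> card (pverts ?G)" by (rule card_mono[OF bg.finG]) (simp add: glued_graph_def)
  finally have card: "2 \<le> card (pverts ?G)" using assms(2) by simp
  show ?thesis
  proof (rule additive_distance_eq_cycle[OF bg.finG bg.symG card])
    fix X and \<epsilon> :: real
    assume X: "\<And>S. clique ?G S \<Longrightarrow> psd_on S X" "\<epsilon> \<ge> 0"
      "\<And>n. n \<ge> 4 \<Longrightarrow> has_induced_cycle ?G n \<Longrightarrow> cycle_bound n \<epsilon>"
    show "\<exists>M. completes X (\<epsilon> * (\<Sum>i\<in>pverts ?G. X i i)) (pverts ?G) (parcs ?G) M"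
    proof (rule bg.block_completion[OF X HOL.refl])
      fix x assume "x \<in> verts D"
      then have "x \<in> pverts (mk_symmetric D)" by simp
      then show "\<not> has_K4 (restrict_to (mk_symmetric D) {y. (x, y) \<in> (parcs (mk_symmetric D))\<^sup>*})"
        by (rule no_K4_component[OF pgD assms(4)])
    qed
  qed
qed

end
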